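(* There is no critical graph with average degree less than $3$ and girth at least $5$.
   Context: All graphs are finite and simple. A good edge-labeling of a graph $G$ is a map $\phi\colon E(G)\to\mathbb{R}$ such that for every ordered pair of vertices $u,v$ there is at most one path from $u$ to $v$ along which the edge labels are nondecreasing. A graph is bad if it has no good edge-labeling. A graph is critical if it is bad and every proper subgraph of it has a good edge-labeling. *)

theory Defs
  imports Complex_Main "HOL-Library.Extended_Nat"
begin

text \<open>An edge is the two-element set of its ends.\<close>

locale simple_graph =
  fixes V :: "'a set" and E :: "'a set set"
  assumes finite_verts: "finite V"
    and edge_verts: "e \<in> E \<Longrightarrow> e \<subseteq> V"
    and edge_card: "e \<in> E \<Longrightarrow> card e = 2"

definition subgraph :: "'a set \<Rightarrow> 'a set set \<Rightarrow> 'a set \<Rightarrow> 'a set set \<Rightarrow> bool" where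
  "subgraph V' E' V E \<longleftrightarrow> simple_graph V' E' \<and> V' \<subseteq> V \<and> E' \<subseteq> E"

definition proper_subgraph :: "'a set \<Rightarrow> 'a set set \<Rightarrow> 'a set \<Rightarrow> 'a set set \<Rightarrow> bool" where
  "proper_subgraph V' E' V E \<longleftrightarrow> subgraph V' E' V E \<and> (V', E') \<noteq> (V, E)"

fun walk_edges :: "'a list \<Rightarrow> 'a set list" where
  "walk_edges (x # y # p) = {x, y} # walk_edges (y # p)"
| "walk_edges _ = []"

text \<open>A path is given by its sequence of vertices, which are pairwise distinct. Since the
  graphs are simple, this sequence determines the edges; \<^term>\<open>[v]\<close> is the trivial path at
  \<^term>\<open>v\<close>.\<close>

definition path_from_to :: "'a set \<Rightarrow> 'a set set \<Rightarrow> 'a \<Rightarrow> 'a list \<Rightarrow> 'a \<Rightarrow> bool" where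
  "path_from_to V E u p v \<longleftrightarrow>
     p \<noteq> [] \<and> hd p = u \<and> last p = v \<and> distinct p \<and> set p \<subseteq> V \<and> set (walk_edges p) \<subseteq> E"

text \<open>Edge-labelings are total functions on vertex sets; only their values on edges matter.\<close>

definition nondecreasing_path ::
    "'a set \<Rightarrow> 'a set set \<Rightarrow> ('a set \<Rightarrow> real) \<Rightarrow> 'a \<Rightarrow> 'a list \<Rightarrow> 'a \<Rightarrow> bool" where
  "nondecreasing_path V E \<phi> u p v \<longleftrightarrow>
     path_from_to V E u p v \<and> sorted (map \<phi> (walk_edges p))"

definition good_edge_labeling :: "'a set \<Rightarrow> 'a set set \<Rightarrow> ('a set \<Rightarrow> real) \<Rightarrow> bool" where
  "good_edge_labeling V E \<phi> \<longleftrightarrow>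
     (\<forall>u\<in>V. \<forall>v\<in>V. \<exists>\<^sub>\<le>\<^sub>1 p. nondecreasing_path V E \<phi> u p v)"

definition bad :: "'a set \<Rightarrow> 'a set set \<Rightarrow> bool" where
  "bad V E \<longleftrightarrow> \<not> (\<exists>\<phi>. good_edge_labeling V E \<phi>)"

definition critical :: "'a set \<Rightarrow> 'a set set \<Rightarrow> bool" where
  "critical V E \<longleftrightarrow>
     bad V E \<and> (\<forall>V' E'. proper_subgraph V' E' V E \<longrightarrow> (\<exists>\<phi>. good_edge_labeling V' E' \<phi>))"

definition degree :: "'a set set \<Rightarrow> 'a \<Rightarrow> nat" where
  "degree E v = card {e \<in> E. v \<in> e}"

definition average_degree :: "'a set \<Rightarrow> 'a set set \<Rightarrow> real" where
  "average_degree V E = (\<Sum>v\<in>V. real (degree E v)) / real (card V)"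

text \<open>A cycle is listed without repeating its first vertex, so its length is the length of
  the list.\<close>

definition is_cycle :: "'a set \<Rightarrow> 'a set set \<Rightarrow> 'a list \<Rightarrow> bool" where
  "is_cycle V E c \<longleftrightarrow>
     length c \<ge> 3 \<and> distinct c \<and> set c \<subseteq> V \<and> set (walk_edges (c @ [hd c])) \<subseteq> E"

text \<open>The girth of a forest is \<^term>\<open>\<infinity> :: enat\<close>, the infimum of the empty set.\<close>

definition girth :: "'a set \<Rightarrow> 'a set set \<Rightarrow> enat" where
  "girth V E = (INF c \<in> {c. is_cycle V E c}. enat (length c))"

end

theory Submission
  imports Defs
begin

text \<open>A matching cut makes a graph good if both sides are good: give the cut edges the lowest labels.
  Hence in a critical graph of girth at least 5 the vertices of degree 2 are independent. Let \<open>B\<close> be the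
  set of the other vertices, and let \<open>x \<in> B\<close> with \<open>d0 x\<close> neighbours in \<open>B\<close> and \<open>d1 x\<close> neighbours of
  degree 2 have charge \<open>2 * d0 x + d1 x - 6\<close>. Average degree below 3 means that the total charge is
  negative, and it is even. If the total is less than \<open>-6\<close>, a contraction argument as in the theorem of
  Farley and Proskurowski on matching-immune graphs yields a matching cut. A vertex of degree 2 with a
  neighbour \<open>z\<close> such that \<open>d0 z = 2\<close> can be deleted, which lowers the total by 2, and reinserted
  with one lowest and one highest label; the neighbour \<open>z\<close> acts as a token that pays for the deletion.
  So at most two tokens can be available, and then the total is \<open>-2\<close>. The remaining configurations
  either have at most one vertex of degree above 3, up to one exception, and the neighbourhood of a
  shortest cycle provides a labeling, or contain one of two explicit small subgraphs.\<close>

section \<open>Labelings from partitions and ears\<close>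

text \<open>The charge comes from weights on \<open>B\<close>: an edge inside \<open>B\<close>
  weighs 2, since cutting it uses up the one cut edge allowed at each end, and a path through a
  vertex of degree 2 weighs 1, since cutting one of its two edges is enough. A cut of
  \<open>B\<close> in which no vertex carries load above 1 extends to a matching cut. It exists once
  the weights, summed over ordered pairs, stay below \<open>6 * (card B - 1)\<close>, whereas
  average degree below 3 only gives \<open>6 * card B\<close>. This gap of 6 shapes the proof: by
  parity the sum is at most \<open>6 * card B - 2\<close>, and each deleted vertex of degree 2 gains
  2, so three deletions always suffice. The obstacle is that tokens interfere. If the cut separates
  the two neighbours of a token in \<open>B\<close>, the token must become a part of its own, and
  the labels at such parts have to respect an order between the tokens. Two tokens that block each
  other in both orders are what leads to the two special subgraphs.\<close>

definition nondec :: "'a set set \<Rightarrow> ('a set \<Rightarrow> real) \<Rightarrow> 'a set \<Rightarrow> 'a list \<Rightarrow> bool" where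
  "nondec E \<phi> X p \<longleftrightarrow> p \<noteq> [] \<and> distinct p \<and> set p \<subseteq> X \<and> set (walk_edges p) \<subseteq> E \<and>
     sorted (map \<phi> (walk_edges p))"

text \<open>Edges and labels are those of the whole graph and only the vertex set varies, as all
  subgraphs to be relabeled are induced ones.\<close>

definition good_on :: "'a set set \<Rightarrow> ('a set \<Rightarrow> real) \<Rightarrow> 'a set \<Rightarrow> bool" where
  "good_on E \<phi> X \<longleftrightarrow>
     (\<forall>p q. nondec E \<phi> X p \<longrightarrow> nondec E \<phi> X q \<longrightarrow> hd p = hd q \<longrightarrow> last p = last q \<longrightarrow> p = q)"

lemma good_onD: "good_on E \<phi> X \<Longrightarrow> nondec E \<phi> X p \<Longrightarrow> nondec E \<phi> X q \<Longrightarrow> hd p = hd q \<Longrightarrow> last p = last q \<Longrightarrow> p = q"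
  unfolding good_on_def by blast

lemma walk_edges_subset: "e \<in> set (walk_edges p) \<Longrightarrow> e \<subseteq> set p"
  by (induction p rule: walk_edges.induct) auto

lemma good_edge_labeling_iff_good_on:
  "good_edge_labeling X {e \<in> E. e \<subseteq> X} \<phi> \<longleftrightarrow> good_on E \<phi> X"
proof -
  have *: "nondecreasing_path X {e \<in> E. e \<subseteq> X} \<phi> u p v \<longleftrightarrow> nondec E \<phi> X p \<and> hd p = u \<and> last p = v" for u p v
    unfolding nondecreasing_path_def path_from_to_def nondec_def using walk_edges_subset by fastforce
  have **: "hd p \<in> X" "last p \<in> X" if "nondec E \<phi> X p" for p
    using that unfolding nondec_def by auto
  show ?thesis unfolding good_edge_labeling_def good_on_def Uniq_def * using ** by metis
qed

lemma nondec_Cons: "nondec E \<phi> X (u # a # r) \<longleftrightarrow>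
   u \<in> X \<and> u \<notin> set (a # r) \<and> {u, a} \<in> E \<and> (\<forall>e\<in>set (walk_edges (a # r)). \<phi> {u, a} \<le> \<phi> e) \<and> nondec E \<phi> X (a # r)"
  unfolding nondec_def by auto

lemma nondec_single: "nondec E \<phi> X [u] \<longleftrightarrow> u \<in> X"
  unfolding nondec_def by auto

lemma nondec_subset: "nondec E \<phi> X p \<Longrightarrow> set p \<subseteq> Y \<Longrightarrow> nondec E \<phi> Y p"
  unfolding nondec_def by auto

lemma sorted_map_cong_order:
  assumes "\<And>x y. x \<in> set xs \<Longrightarrow> y \<in> set xs \<Longrightarrow> f x \<le> f y \<longleftrightarrow> g x \<le> (g y :: real)"
  shows "sorted (map (f :: _ \<Rightarrow> real) xs) \<longleftrightarrow> sorted (map g xs)"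
  using assms by (induction xs) auto

lemma nondec_cong_order:
  assumes "\<And>x y. x \<in> E \<Longrightarrow> y \<in> E \<Longrightarrow> x \<subseteq> X \<Longrightarrow> y \<subseteq> X \<Longrightarrow> \<phi> x \<le> \<phi> y \<longleftrightarrow> \<psi> x \<le> \<psi> y"
  shows "nondec E \<phi> X p \<longleftrightarrow> nondec E \<psi> X p"
proof -
  have "sorted (map \<phi> (walk_edges p)) \<longleftrightarrow> sorted (map \<psi> (walk_edges p))"
    if "set p \<subseteq> X" "set (walk_edges p) \<subseteq> E"
  proof (rule sorted_map_cong_order)
    fix x y assume "x \<in> set (walk_edges p)" "y \<in> set (walk_edges p)"
    then show "\<phi> x \<le> \<phi> y \<longleftrightarrow> \<psi> x \<le> \<psi> y"
      using assms that walk_edges_subset by (metis subset_iff)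
  qed
  then show ?thesis unfolding nondec_def by blast
qed

text \<open>Only the order of the labels matters, so a labeling can be squeezed monotonically:
  \<open>exp\<close> lifts it above all negative labels, \<open>arctan\<close> puts it between two
  extreme ones.\<close>

lemma good_on_cong_order:
  assumes "\<And>x y. x \<in> E \<Longrightarrow> y \<in> E \<Longrightarrow> x \<subseteq> X \<Longrightarrow> y \<subseteq> X \<Longrightarrow> \<phi> x \<le> \<phi> y \<longleftrightarrow> \<psi> x \<le> \<psi> y"
  shows "good_on E \<phi> X \<longleftrightarrow> good_on E \<psi> X"
proof -
  have "nondec E \<phi> X p \<longleftrightarrow> nondec E \<psi> X p" for p by (rule nondec_cong_order) (rule assms)
  then show ?thesis unfolding good_on_def by simp
qed

text \<open>\<open>Q u a\<close> bounds the parts in which a nondecreasing path can end if it starts with the crossing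
  edge from \<open>u\<close> to \<open>a\<close>: as crossing labels are the lowest ones, such a path crosses first and then
  stays in one part.\<close>

lemma good_on_parts:
  fixes \<pi> :: "'a \<Rightarrow> 'b" and Q :: "'a \<Rightarrow> 'a \<Rightarrow> 'b set" and \<rho> :: "'a set \<Rightarrow> real"
  assumes edges: "\<And>e. e \<in> E \<Longrightarrow> e \<noteq> {}"
    and part: "\<And>c. c \<in> \<pi> ` X \<Longrightarrow> \<exists>\<psi>. good_on E \<psi> {v \<in> X. \<pi> v = c}"
    and cr_def: "\<And>u v. cr u v \<longleftrightarrow> u \<in> X \<and> v \<in> X \<and> {u, v} \<in> E \<and> \<pi> u \<noteq> \<pi> v"
    and neg: "\<And>u v. cr u v \<Longrightarrow> \<rho> {u, v} < 0"
    and Q1: "\<And>u a. cr u a \<Longrightarrow> \<pi> a \<in> Q u a"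
    and Q2: "\<And>u a b. cr u a \<Longrightarrow> cr a b \<Longrightarrow> b \<noteq> u \<Longrightarrow> \<rho> {u, a} \<le> \<rho> {a, b} \<Longrightarrow> Q a b \<subseteq> Q u a"
    and Q3: "\<And>u a. cr u a \<Longrightarrow> \<pi> u \<notin> Q u a"
    and Q4: "\<And>u a b. cr u a \<Longrightarrow> cr u b \<Longrightarrow> a \<noteq> b \<Longrightarrow> Q u a \<inter> Q u b = {}"
  obtains \<Phi> where "good_on E \<Phi> X"
    and "\<And>u v. cr u v \<Longrightarrow> \<Phi> {u, v} = \<rho> {u, v}"
    and "\<And>u v. u \<in> X \<Longrightarrow> v \<in> X \<Longrightarrow> {u, v} \<in> E \<Longrightarrow> \<not> cr u v \<Longrightarrow> \<Phi> {u, v} > 0"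
    and "\<And>u a r. nondec E \<Phi> X (u # a # r) \<Longrightarrow> \<not> cr u a \<Longrightarrow> \<pi> (last (a # r)) = \<pi> u"
proof -
  obtain \<psi> where \<psi>: "\<And>c. c \<in> \<pi> ` X \<Longrightarrow> good_on E (\<psi> c) {v \<in> X. \<pi> v = c}"
    using part by metis
  \<comment> \<open>Through \<open>exp\<close> all labels inside a part are positive, hence above
    every crossing label. Both ends of such an edge lie in one part, so any end picked by
    \<open>SOME\<close> identifies the labeling to be used.\<close>
  define \<Phi> where "\<Phi> e = (if \<exists>u v. u \<in> e \<and> v \<in> e \<and> \<pi> u \<noteq> \<pi> v then \<rho> e else exp (\<psi> (\<pi> (SOME v. v \<in> e)) e))" for e
  have c1: "\<Phi> {u, v} = \<rho> {u, v}" if "cr u v" for u v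
    using that unfolding cr_def \<Phi>_def by auto
  have c2: "\<Phi> {u, v} > 0" if "u \<in> X" "v \<in> X" "{u, v} \<in> E" "\<not> cr u v" for u v
    using that unfolding cr_def \<Phi>_def by auto
  have part': "good_on E \<Phi> {v \<in> X. \<pi> v = c}" if c: "c \<in> \<pi> ` X" for c
  proof -
    have *: "\<Phi> x = exp (\<psi> c x)" if "x \<in> E" "x \<subseteq> {v \<in> X. \<pi> v = c}" for x
    proof -
      have "x \<noteq> {}" using edges that by auto
      then have "(SOME v. v \<in> x) \<in> x" by (simp add: some_in_eq)
      then have "\<pi> (SOME v. v \<in> x) = c" using that by blast
      moreover have "\<not> (\<exists>u v. u \<in> x \<and> v \<in> x \<and> \<pi> u \<noteq> \<pi> v)" using that by blast
      ultimately show ?thesis unfolding \<Phi>_def by (metis (no_types, lifting))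
    qed
    have "good_on E (\<psi> c) {v \<in> X. \<pi> v = c} \<longleftrightarrow> good_on E \<Phi> {v \<in> X. \<pi> v = c}"
      by (rule good_on_cong_order) (simp only: * exp_le_cancel_iff)
    then show ?thesis using \<psi> c by blast
  qed
  have nc: "set (u # r) \<subseteq> {v \<in> X. \<pi> v = \<pi> u}"
    if "nondec E \<Phi> X (u # r)" "\<And>e. e \<in> set (walk_edges (u # r)) \<Longrightarrow> \<Phi> e > 0" for u r
    using that
  proof (induction r arbitrary: u)
    case Nil
    then show ?case by (auto simp: nondec_single)
  next
    case (Cons a r)
    have *: "u \<in> X" "{u, a} \<in> E" "nondec E \<Phi> X (a # r)" using Cons.prems(1) by (auto simp: nondec_Cons)
    then have "a \<in> X" by (auto simp: nondec_def)
    have "\<Phi> {u, a} > 0" using Cons.prems(2) by simp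
    then have "\<not> cr u a" using c1[of u a] neg[of u a] by fastforce
    then have "\<pi> a = \<pi> u" using * \<open>a \<in> X\<close> unfolding cr_def by auto
    moreover have "set (a # r) \<subseteq> {v \<in> X. \<pi> v = \<pi> a}" using Cons.IH[of a] Cons.prems(2) * by simp
    ultimately show ?case using * by auto
  qed
  \<comment> \<open>A first edge inside a part has a positive label, so all later labels are
    positive too and the path never crosses.\<close>
  have nc': "set (u # a # r) \<subseteq> {v \<in> X. \<pi> v = \<pi> u}" if "nondec E \<Phi> X (u # a # r)" "\<not> cr u a" for u a r
  proof (rule nc[OF that(1)])
    have *: "u \<in> X" "{u, a} \<in> E" "nondec E \<Phi> X (a # r)" "\<forall>e\<in>set (walk_edges (a # r)). \<Phi> {u, a} \<le> \<Phi> e"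
      using that(1) by (auto simp: nondec_Cons)
    then have "a \<in> X" by (auto simp: nondec_def)
    then have "\<Phi> {u, a} > 0" using c2 that * by blast
    then show "\<And>e. e \<in> set (walk_edges (u # a # r)) \<Longrightarrow> \<Phi> e > 0" using *(4) by fastforce
  qed
  have Qend: "\<pi> (last (u # a # r)) \<in> Q u a" if "nondec E \<Phi> X (u # a # r)" "cr u a" for u a r
    using that
  proof (induction r arbitrary: u a)
    case Nil
    then show ?case using Q1 by simp
  next
    case (Cons b r)
    have *: "nondec E \<Phi> X (a # b # r)" "u \<noteq> b" "\<Phi> {u, a} \<le> \<Phi> {a, b}"
      using Cons.prems(1) by (auto simp: nondec_Cons)
    show ?case
    proof (cases "cr a b")
      case True
      then have "\<pi> (last (a # b # r)) \<in> Q a b" using Cons.IH * by blast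
      moreover have "Q a b \<subseteq> Q u a" using Q2 True Cons.prems(2) * c1 by metis
      ultimately show ?thesis by auto
    next
      case False
      then have "set (a # b # r) \<subseteq> {v \<in> X. \<pi> v = \<pi> a}" using nc' * by blast
      moreover have "last (a # b # r) \<in> set (a # b # r)" by (rule last_in_set) simp
      ultimately have "\<pi> (last (a # b # r)) = \<pi> a" by blast
      then show ?thesis using Q1[OF Cons.prems(2)] by auto
    qed
  qed
  have "p = q" if "nondec E \<Phi> X p" "nondec E \<Phi> X q" "hd p = hd q" "last p = last q" for p q
    using that
  proof (induction p arbitrary: q)
    case Nil
    then show ?case by (simp add: nondec_def)
  next
    case (Cons u p)
    obtain q' where q: "q = u # q'" using Cons.prems by (cases q) (auto simp: nondec_def)
    show ?case
    proof (cases p)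
      case Nil
      then have "last q = u" using Cons.prems by simp
      then have "q' = []" using Cons.prems(2) q unfolding nondec_def by (cases q' rule: rev_cases) auto
      then show ?thesis using Nil q by simp
    next
      case p: (Cons a p')
      show ?thesis
      proof (cases q')
        case Nil
        then have "last p = u" using Cons.prems q p by simp
        then show ?thesis using Cons.prems(1) p unfolding nondec_def by (metis distinct.simps(2) last_in_set list.distinct(1))
      next
        case q': (Cons b q'')
        have l: "last (a # p') = last (b # q'')" using Cons.prems(4) p q q' by simp
        have P: "nondec E \<Phi> X (u # a # p')" and R: "nondec E \<Phi> X (u # b # q'')"
          using Cons.prems p q q' by auto
        show ?thesis
        proof (cases "a = b")
          case True
          then have "p = b # q''" using Cons.IH[of "b # q''"] P R p l by (auto simp: nondec_Cons)
          then show ?thesis using q q' by simp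
        next
          case False
          have uX: "u \<in> X" using P by (auto simp: nondec_Cons)
          \<comment> \<open>The first edges differ: \<open>Q4\<close> separates two crossing starts,
            \<open>Q3\<close> a crossing start from one inside the part, and two starts inside the
            part are left to the labeling of that part.\<close>
          consider "cr u a" "cr u b" | "cr u a" "\<not> cr u b" | "\<not> cr u a" "cr u b" | "\<not> cr u a" "\<not> cr u b" by blast
          then show ?thesis
          proof cases
            case 1
            then have "\<pi> (last (a # p')) \<in> Q u a \<inter> Q u b" using Qend[OF P] Qend[OF R] l by auto
            then show ?thesis using Q4[OF 1 False] by auto
          next
            case 2
            have "last (u # b # q'') \<in> set (u # b # q'')" by (rule last_in_set) simp
            then have "\<pi> (last (u # b # q'')) = \<pi> u" using nc'[OF R 2(2)] by blast
            then show ?thesis using Qend[OF P 2(1)] l Q3[OF 2(1)] by auto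
          next
            case 3
            have "last (u # a # p') \<in> set (u # a # p')" by (rule last_in_set) simp
            then have "\<pi> (last (u # a # p')) = \<pi> u" using nc'[OF P 3(1)] by blast
            then show ?thesis using Qend[OF R 3(2)] l Q3[OF 3(2)] by auto
          next
            case 4
            have "nondec E \<Phi> {v \<in> X. \<pi> v = \<pi> u} (u # a # p')" "nondec E \<Phi> {v \<in> X. \<pi> v = \<pi> u} (u # b # q'')"
              by (rule nondec_subset[OF P nc'[OF P 4(1)]], rule nondec_subset[OF R nc'[OF R 4(2)]])
            then have "u # a # p' = u # b # q''"
              by (rule good_onD[OF part'[OF imageI[OF uX]]]) (use l in auto)
            then show ?thesis using p q q' by simp
          qed
        qed
      qed
    qed
  qed
  then have "good_on E \<Phi> X" unfolding good_on_def by blast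
  moreover have "\<pi> (last (a # r)) = \<pi> u" if "nondec E \<Phi> X (u # a # r)" "\<not> cr u a" for u a r
    using nc'[OF that] last_in_set[of "a # r"] by auto
  ultimately show ?thesis using that c1 c2 by blast
qed

section \<open>Inserting a vertex of degree 2 with one lowest and one highest label\<close>

lemma walk_edges_append: "walk_edges (xs @ x # ys) = walk_edges (xs @ [x]) @ walk_edges (x # ys)"
proof (induction xs)
  case (Cons a xs)
  then show ?case by (cases xs) auto
qed simp

lemma nondec_appendD:
  assumes "nondec E \<phi> X (xs @ x # ys)"
  shows "nondec E \<phi> X (xs @ [x])" "nondec E \<phi> X (x # ys)"
    and "\<And>e f. e \<in> set (walk_edges (xs @ [x])) \<Longrightarrow> f \<in> set (walk_edges (x # ys)) \<Longrightarrow> \<phi> e \<le> \<phi> f"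
  using assms unfolding nondec_def walk_edges_append[of xs x ys] by (auto simp: sorted_append)

text \<open>The edge to \<open>c\<close> becomes the lowest and the edge to \<open>o'\<close> the
  highest. Then \<open>b\<close> is an inner vertex only of the path \<open>[c, b, o']\<close>, a
  path leaving \<open>b\<close> towards \<open>o'\<close> stops there, and a path arriving from
  \<open>c\<close> starts there. Every conflict would require a nondecreasing path from
  \<open>c\<close> to \<open>o'\<close>, which \<open>no\<close> excludes. The second conclusion,
  that no other pair of old vertices gains a path, makes the insertion repeatable.\<close>

lemma good_on_ear:
  assumes b: "b \<notin> X" and co: "c \<in> X" "o' \<in> X" "c \<noteq> o'"
    and nb: "\<And>v. v \<in> X \<Longrightarrow> {b, v} \<in> E \<Longrightarrow> v = c \<or> v = o'"
    and good: "good_on E \<phi> X"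
    and no: "\<And>p. nondec E \<phi> X p \<Longrightarrow> hd p = c \<Longrightarrow> last p = o' \<Longrightarrow> False"
  obtains \<Phi> where "good_on E \<Phi> (insert b X)"
    and "\<And>p. nondec E \<Phi> (insert b X) p \<Longrightarrow> hd p \<in> X \<Longrightarrow> last p \<in> X \<Longrightarrow> (hd p, last p) \<noteq> (c, o') \<Longrightarrow> nondec E \<phi> X p"
proof -
  \<comment> \<open>The values of \<open>arctan\<close> lie strictly between -2 and 2, because pi is
    less than 4.\<close>
  define \<Phi> where "\<Phi> e = (if e = {b, c} then - 2 else if e = {b, o'} then 2 else arctan (\<phi> e))" for e
  have at: "- 2 < arctan x" "arctan x < 2" for x
    using arctan_lbound[of x] arctan_ubound[of x] pi_less_4 by linarith+
  have bc: "\<Phi> {b, c} = - 2" and bo: "\<Phi> {b, o'} = 2"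
    using co b unfolding \<Phi>_def by (auto simp: doubleton_eq_iff)
  have inX: "\<Phi> e = arctan (\<phi> e)" if "e \<subseteq> X" for e using that b unfolding \<Phi>_def by auto
  have A: "nondec E \<phi> X p" if "nondec E \<Phi> (insert b X) p" "b \<notin> set p" for p
  proof -
    have "nondec E \<Phi> X p" using that by (auto simp: nondec_def)
    moreover have "nondec E \<Phi> X p \<longleftrightarrow> nondec E \<phi> X p"
      by (rule nondec_cong_order) (simp add: inX arctan_le_iff)
    ultimately show ?thesis by simp
  qed
  have rangeX: "- 2 < \<Phi> {x, y} \<and> \<Phi> {x, y} < 2" if "x \<noteq> b" "y \<noteq> b" for x y
    using that at unfolding \<Phi>_def by (auto simp: doubleton_eq_iff)
  have nbE: "v = c \<or> v = o'" if "{b, v} \<in> E" "v \<in> insert b X" "v \<noteq> b" for v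
    using that nb by auto
  have start: "p = [b, o'] \<or> (\<exists>r. p = b # c # r \<and> nondec E \<phi> X (c # r))"
    if p: "nondec E \<Phi> (insert b X) p" and hp: "hd p = b" "p \<noteq> [b]" for p
  proof -
    obtain y r where pr: "p = b # y # r"
      using p hp unfolding nondec_def by (cases p; cases "tl p") auto
    have *: "b \<noteq> y" "b \<notin> set r" "{b, y} \<in> E" "nondec E \<Phi> (insert b X) (y # r)" "y \<in> insert b X"
       "\<forall>e\<in>set (walk_edges (y # r)). \<Phi> {b, y} \<le> \<Phi> e"
      using p unfolding pr nondec_Cons by (auto simp: nondec_def)
    have N: "nondec E \<phi> X (y # r)" using A * by simp
    consider "y = c" | "y = o'" using nbE[of y] * by auto
    then show ?thesis
    proof cases
      case 1
      then show ?thesis using N pr by auto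
    next
      case 2
      have "r = []"
      proof (cases r)
        case (Cons z r')
        then have "\<Phi> {b, y} \<le> \<Phi> {y, z}" using *(6) by simp
        then show ?thesis using rangeX[of y z] * Cons bo 2 by auto
      qed
      then show ?thesis using 2 pr by simp
    qed
  qed
  have ending: "p = [c, b] \<or> (\<exists>r. p = r @ [o', b] \<and> nondec E \<phi> X (r @ [o']))"
    if p: "nondec E \<Phi> (insert b X) p" and lp: "last p = b" "p \<noteq> [b]" for p
  proof -
    obtain r y where pr: "p = r @ [y, b]"
    proof -
      obtain s where s: "p = s @ [b]" using lp p unfolding nondec_def by (metis append_butlast_last_id)
      then obtain r y where "s = r @ [y]" using lp by (cases s rule: rev_cases) auto
      then show ?thesis using that s by auto
    qed
    have d: "nondec E \<Phi> (insert b X) (r @ [y])" "nondec E \<Phi> (insert b X) [y, b]"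
       "\<And>e. e \<in> set (walk_edges (r @ [y])) \<Longrightarrow> \<Phi> e \<le> \<Phi> {b, y}"
      using nondec_appendD[of E \<Phi> "insert b X" r y "[b]"] p unfolding pr by (auto simp: insert_commute)
    have bn: "b \<notin> set (r @ [y])" using p unfolding pr nondec_def by auto
    have N: "nondec E \<phi> X (r @ [y])" using A d(1) bn by blast
    have "y = c \<or> y = o'" using nbE[of y] d(2) bn by (auto simp: nondec_def insert_commute)
    then show ?thesis
    proof
      assume y: "y = c"
      have "r = []"
      proof (cases r rule: rev_cases)
        case (snoc r' z)
        have "{z, y} \<in> set (walk_edges (r @ [y]))"
          using walk_edges_append[of r' z "[y]"] snoc by simp
        then have "\<Phi> {z, y} \<le> - 2" using d(3) y bc by metis
        then show ?thesis using rangeX[of z y] bn snoc by auto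
      qed
      then show ?thesis using y pr by simp
    next
      assume "y = o'"
      then show ?thesis using N pr by auto
    qed
  qed
  have mid: "p = [c, b, o']"
    if p: "nondec E \<Phi> (insert b X) p" and "hd p \<noteq> b" "last p \<noteq> b" and bp: "b \<in> set p" for p
  proof -
    obtain xs ys where pr: "p = xs @ b # ys" using bp by (meson split_list)
    then have ne: "xs \<noteq> []" "ys \<noteq> []" using that by auto
    have d1: "nondec E \<Phi> (insert b X) (xs @ [b])" "nondec E \<Phi> (insert b X) (b # ys)"
      "\<And>e f. e \<in> set (walk_edges (xs @ [b])) \<Longrightarrow> f \<in> set (walk_edges (b # ys)) \<Longrightarrow> \<Phi> e \<le> \<Phi> f"
      using nondec_appendD[of E \<Phi> "insert b X" xs b ys] p unfolding pr by auto
    have dis: "set xs \<inter> set ys = {}" using p pr by (auto simp: nondec_def)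
    consider "xs = [c]" | r where "xs = r @ [o']"
      using ending[OF d1(1)] ne by auto
    then show ?thesis
    proof cases
      case 1
      then show ?thesis using start[OF d1(2)] dis ne pr by auto
    next
      case (2 r)
      then obtain r' where "ys = c # r'" using start[OF d1(2)] dis ne by auto
      then have "\<Phi> {o', b} \<le> \<Phi> {b, c}" using d1(3) walk_edges_append[of r o' "[b]"] 2 by simp
      then show ?thesis using bc bo by (simp add: insert_commute)
    qed
  qed
  have tr: "nondec E \<phi> X p" if "nondec E \<Phi> (insert b X) p" "hd p \<in> X" "last p \<in> X" "(hd p, last p) \<noteq> (c, o')" for p
    using A mid that b by (metis hd_conv_nth last.simps list.distinct(1) list.sel(1))
  have "good_on E \<Phi> (insert b X)"
    unfolding good_on_def
  proof (intro allI impI)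
    fix p q assume p: "nondec E \<Phi> (insert b X) p" and q: "nondec E \<Phi> (insert b X) q"
      and h: "hd p = hd q" and l: "last p = last q"
    have single: "r = [b]" if "nondec E \<Phi> (insert b X) r" "hd r = b" "last r = b" for r
      using that unfolding nondec_def by (metis distinct.simps(2) last_in_set last_ConsR list.collapse)
    show "p = q"
    proof (cases "hd p = b")
      case hb: True
      show ?thesis
      proof (cases "last p = b")
        case True
        then show ?thesis using single p q h l hb by metis
      next
        case False
        then have "p \<noteq> [b]" "q \<noteq> [b]" using l by auto
        then have "p = [b, o'] \<or> (\<exists>r. p = b # c # r \<and> nondec E \<phi> X (c # r))"
          "q = [b, o'] \<or> (\<exists>r. q = b # c # r \<and> nondec E \<phi> X (c # r))"
          using start p q h hb by metis+
        then show ?thesis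
        proof (elim disjE exE conjE)
          fix r assume "p = [b, o']" "q = b # c # r" "nondec E \<phi> X (c # r)"
          then show ?thesis using no[of "c # r"] l by simp
        next
          fix r assume "q = [b, o']" "p = b # c # r" "nondec E \<phi> X (c # r)"
          then show ?thesis using no[of "c # r"] l by simp
        next
          fix r r' assume "p = b # c # r" "nondec E \<phi> X (c # r)" "q = b # c # r'" "nondec E \<phi> X (c # r')"
          then show ?thesis using good_onD[OF good, of "c # r" "c # r'"] l by simp
        qed simp
      qed
    next
      case hb: False
      show ?thesis
      proof (cases "last p = b")
        case True
        have "p \<noteq> [b]" "q \<noteq> [b]" using h hb by (metis list.sel(1))+
        have "p = [c, b] \<or> (\<exists>r. p = r @ [o', b] \<and> nondec E \<phi> X (r @ [o']))"
          "q = [c, b] \<or> (\<exists>r. q = r @ [o', b] \<and> nondec E \<phi> X (r @ [o']))"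
          using ending p q l True \<open>p \<noteq> [b]\<close> \<open>q \<noteq> [b]\<close> by metis+
        then show ?thesis
        proof (elim disjE exE conjE)
          fix r assume "p = [c, b]" "q = r @ [o', b]" "nondec E \<phi> X (r @ [o'])"
          then show ?thesis using no[of "r @ [o']"] h by (cases r) auto
        next
          fix r assume "q = [c, b]" "p = r @ [o', b]" "nondec E \<phi> X (r @ [o'])"
          then show ?thesis using no[of "r @ [o']"] h by (cases r) auto
        next
          fix r r' assume "p = r @ [o', b]" "nondec E \<phi> X (r @ [o'])" "q = r' @ [o', b]" "nondec E \<phi> X (r' @ [o'])"
          moreover then have "hd (r @ [o']) = hd (r' @ [o'])" using h by (cases r; cases r') auto
          ultimately show ?thesis using good_onD[OF good, of "r @ [o']" "r' @ [o']"] by simp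
        qed simp
      next
        case lb: False
        have X: "hd p \<in> X" "last p \<in> X"
          using p hb lb unfolding nondec_def by (metis hd_in_set last_in_set insertE subsetD)+
        consider "b \<in> set p" "b \<in> set q" | "b \<in> set p" "b \<notin> set q" | "b \<notin> set p" "b \<in> set q" | "b \<notin> set p" "b \<notin> set q" by blast
        then show ?thesis
        proof cases
          case 1
          then show ?thesis using mid p q h l hb lb by metis
        next
          case 2
          then have "p = [c, b, o']" using mid p hb lb by metis
          then show ?thesis using no[of q] A[OF q] 2 h l by simp
        next
          case 3
          then have "q = [c, b, o']" using mid q hb lb h l by metis
          then show ?thesis using no[of p] A[OF p] 3 h l by simp
        next
          case 4
          then show ?thesis using good_onD[OF good] A p q h l by blast
        qed
      qed
    qed
  qed
  then show ?thesis using that tr by blast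
qed

text \<open>Each insertion creates a path only for its own ordered pair of low and high end. By
  \<open>dis\<close> these pairs differ, so the ears not yet inserted keep satisfying
  \<open>no\<close>.\<close>

lemma good_on_ears:
  assumes fin: "finite A" and AX: "A \<inter> X = {}"
    and ends: "\<And>a. a \<in> A \<Longrightarrow> lo a \<in> X \<and> hi a \<in> X \<and> lo a \<noteq> hi a"
    and nb: "\<And>a v. a \<in> A \<Longrightarrow> {a, v} \<in> E \<Longrightarrow> v = lo a \<or> v = hi a"
    and dis: "\<And>a a'. a \<in> A \<Longrightarrow> a' \<in> A \<Longrightarrow> a \<noteq> a' \<Longrightarrow> (lo a, hi a) \<noteq> (lo a', hi a')"
    and good: "good_on E \<phi> X"
    and no: "\<And>a p. a \<in> A \<Longrightarrow> nondec E \<phi> X p \<Longrightarrow> hd p = lo a \<Longrightarrow> last p = hi a \<Longrightarrow> False"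
  shows "\<exists>\<Phi>. good_on E \<Phi> (X \<union> A)"
proof -
  have "B \<subseteq> A \<Longrightarrow> \<exists>\<Phi>. good_on E \<Phi> (X \<union> B) \<and>
     (\<forall>a\<in>A - B. \<forall>p. nondec E \<Phi> (X \<union> B) p \<longrightarrow> hd p = lo a \<longrightarrow> last p \<noteq> hi a)" if "finite B" for B
    using that
  proof (induction B)
    case empty
    then show ?case using good no by (intro exI[of _ \<phi>]) auto
  next
    case (insert b B)
    then obtain \<Phi> where \<Phi>: "good_on E \<Phi> (X \<union> B)"
      "\<And>a p. a \<in> A - B \<Longrightarrow> nondec E \<Phi> (X \<union> B) p \<Longrightarrow> hd p = lo a \<Longrightarrow> last p \<noteq> hi a" by blast
    have bA: "b \<in> A" using insert.prems by auto
    have 1: "b \<notin> X \<union> B" "lo b \<in> X \<union> B" "hi b \<in> X \<union> B" "lo b \<noteq> hi b"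
      using insert.hyps AX ends[OF bA] bA by auto
    obtain \<Psi> where \<Psi>: "good_on E \<Psi> (insert b (X \<union> B))"
      "\<And>p. nondec E \<Psi> (insert b (X \<union> B)) p \<Longrightarrow> hd p \<in> X \<union> B \<Longrightarrow> last p \<in> X \<union> B \<Longrightarrow>
         (hd p, last p) \<noteq> (lo b, hi b) \<Longrightarrow> nondec E \<Phi> (X \<union> B) p"
      by (rule good_on_ear[OF 1, of E \<Phi>]) (use nb[OF bA] \<Phi> bA insert.hyps in blast)+
    have "last p \<noteq> hi a" if a: "a \<in> A - insert b B" and p: "nondec E \<Psi> (insert b (X \<union> B)) p" "hd p = lo a" for a p
    proof
      assume l: "last p = hi a"
      have "nondec E \<Phi> (X \<union> B) p"
        using \<Psi>(2)[OF p(1)] p(2) l ends[of a] dis[of a b] a bA by auto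
      then show False using \<Phi>(2)[of a p] a p l by auto
    qed
    then show ?case using \<Psi>(1) by (intro exI[of _ \<Psi>]) auto
  qed
  from this[OF fin] show ?thesis by auto
qed

section \<open>Matching cuts of sparse weighted graphs\<close>

text \<open>The load \<open>l u v\<close> is the part of the weight between \<open>u\<close> and \<open>v\<close> that is charged to \<open>u\<close>.\<close>

definition load_cut :: "'a set \<Rightarrow> ('a \<Rightarrow> 'a \<Rightarrow> nat) \<Rightarrow> 'a set \<Rightarrow> ('a \<Rightarrow> 'a \<Rightarrow> nat) \<Rightarrow> bool" where
  "load_cut B m S l \<longleftrightarrow> S \<subseteq> B \<and> S \<noteq> {} \<and> S \<noteq> B \<and>
     (\<forall>u\<in>B. \<forall>v\<in>B. l u v + l v u = (if u \<in> S \<longleftrightarrow> v \<in> S then 0 else m u v)) \<and>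
     (\<forall>u\<in>B. sum (l u) B \<le> 1)"

text \<open>To undo the merging of \<open>v\<close> into \<open>u\<close>, both are put on the same
  side. The load of the merged vertex towards \<open>y\<close> goes to \<open>u\<close> as far as
  \<open>m u y\<close> permits and the remainder to \<open>v\<close>. So neither exceeds the old
  load, and the total load of every other vertex is unchanged.\<close>

lemma load_cut_contract:
  fixes m :: "'a \<Rightarrow> 'a \<Rightarrow> nat"
  assumes fin: "finite B" and uv: "u \<in> B" "v \<in> B" "u \<noteq> v"
    and sym: "\<And>x y. m x y = m y x"
    and m': "\<And>x y. m' x y = (if x = y then 0 else if x = u then m u y + m v y else if y = u then m x u + m x v else m x y)"
    and cut: "load_cut (B - {v}) m' S' l'"
  shows "\<exists>S l. load_cut B m S l"
proof -
  define B' where "B' = B - {v}"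
  have B: "B = insert v B'" "v \<notin> B'" "finite B'" "u \<in> B'" using uv fin unfolding B'_def by auto
  have S': "S' \<subseteq> B'" "S' \<noteq> {}" "S' \<noteq> B'"
    and l': "\<And>x y. x \<in> B' \<Longrightarrow> y \<in> B' \<Longrightarrow> l' x y + l' y x = (if x \<in> S' \<longleftrightarrow> y \<in> S' then 0 else m' x y)"
    and s': "\<And>x. x \<in> B' \<Longrightarrow> sum (l' x) B' \<le> 1"
    using cut unfolding load_cut_def B'_def by auto
  define S where "S = (if u \<in> S' then insert v S' else S')"
  have Sx: "x \<in> S \<longleftrightarrow> x \<in> S'" if "x \<in> B'" for x using that B unfolding S_def by auto
  have Sv: "v \<in> S \<longleftrightarrow> u \<in> S'" using S' B unfolding S_def by auto
  define sep where "sep y \<longleftrightarrow> (u \<in> S') \<noteq> (y \<in> S')" for y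
  define l where "l x y =
     (if x = u then (if y = v \<or> \<not> sep y then 0 else min (l' u y) (m u y))
      else if x = v then (if y = u \<or> y = v \<or> \<not> sep y then 0 else l' u y - min (l' u y) (m u y))
      else if y = u then (if sep x then m u x - min (l' u x) (m u x) else 0)
      else if y = v then (if sep x then m v x - (l' u x - min (l' u x) (m u x)) else 0)
      else l' x y)" for x y
  have le: "l' u y \<le> m u y + m v y" if "y \<in> B'" "sep y" for y
    using l'[of u y] B that m' unfolding sep_def by (auto split: if_splits)
  have e: "l x y + l y x = (if x \<in> S \<longleftrightarrow> y \<in> S then 0 else m x y)" if x: "x \<in> B" and y: "y \<in> B" for x y
  proof -
    have A: "l u y + l y u = (if u \<in> S \<longleftrightarrow> y \<in> S then 0 else m u y)" if "y \<in> B" for y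
      using that B Sx Sv uv sep_def unfolding l_def by (auto simp: sym)
    have C: "l v y + l y v = (if v \<in> S \<longleftrightarrow> y \<in> S then 0 else m v y)" if "y \<in> B" "y \<noteq> u" for y
      using that B Sx Sv uv sep_def le[of y] unfolding l_def by (auto simp: sym)
    consider "x = u" | "y = u" | "x = v" "y \<noteq> u" | "y = v" "x \<noteq> u" | "x \<notin> {u, v}" "y \<notin> {u, v}" by auto
    then show ?thesis
    proof cases
      case 1
      then show ?thesis using A[OF y] by simp
    next
      case 2
      then show ?thesis using A[OF x] sym[of x u] by (simp add: add.commute eq_commute)
    next
      case 3
      then show ?thesis using C[OF y] by simp
    next
      case 4
      then show ?thesis using C[OF x] sym[of x v] by (simp add: add.commute eq_commute)
    next
      case 5
      then have "x \<in> B'" "y \<in> B'" using x y B by auto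
      then show ?thesis using 5 l'[of x y] Sx m'[of x y] unfolding l_def by auto
    qed
  qed
  have su: "sum (l x) B \<le> 1" if x: "x \<in> B" for x
  proof -
    consider "x = u" | "x = v" | "x \<in> B'" "x \<noteq> u" using x B by auto
    then show ?thesis
    proof cases
      case 1
      have "sum (l x) B = sum (l u) B'" using B 1 unfolding l_def by (simp add: uv)
      also have "\<dots> \<le> sum (l' u) B'" by (rule sum_mono) (auto simp: l_def)
      finally show ?thesis using s' B by (meson le_trans)
    next
      case 2
      have "sum (l x) B = sum (l v) B'" using B 2 uv unfolding l_def by simp
      also have "\<dots> \<le> sum (l' u) B'" by (rule sum_mono) (auto simp: l_def uv)
      finally show ?thesis using s' B by (meson le_trans)
    next
      case 3
      have xv: "x \<noteq> v" using 3 B by auto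
      have "l x u + l x v = l' x u"
      proof (cases "sep x")
        case True
        then show ?thesis using l'[of u x] 3 B le[of x] m'[of u x] xv uv unfolding l_def sep_def by auto
      next
        case False
        then show ?thesis using l'[of u x] 3 B m'[of u x] xv uv unfolding l_def sep_def by auto
      qed
      moreover have "sum (l x) (B' - {u}) = sum (l' x) (B' - {u})"
        using 3 B xv by (intro sum.cong) (auto simp: l_def)
      moreover have "sum (l x) B = l x v + (l x u + sum (l x) (B' - {u}))"
        using B by (simp add: sum.remove[of B' u "l x"])
      moreover have "sum (l' x) B' = l' x u + sum (l' x) (B' - {u})"
        using B by (simp add: sum.remove[of B' u "l' x"])
      ultimately show ?thesis using s'[OF 3(1)] by simp
    qed
  qed
  have "S \<subseteq> B" "S \<noteq> {}" "S \<noteq> B"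
    using S' B unfolding S_def by (auto split: if_splits)
  then show ?thesis unfolding load_cut_def using e su by blast
qed

text \<open>Cutting off \<open>v\<close> alone works: each neighbour bears one unit of its weight
  towards \<open>v\<close>, and the second unit of the only pair of weight 2, if there is one, is
  borne by \<open>v\<close>.\<close>

lemma load_cut_star:
  fixes m :: "'a \<Rightarrow> 'a \<Rightarrow> nat"
  assumes fin: "finite B" and v: "v \<in> B" "B \<noteq> {v}"
    and sym: "\<And>x y. m x y = m y x" and m0: "m v v = 0"
    and le2: "\<And>w. w \<in> B \<Longrightarrow> m v w \<le> 2"
    and one: "\<And>w w'. w \<in> B \<Longrightarrow> w' \<in> B \<Longrightarrow> m v w = 2 \<Longrightarrow> m v w' = 2 \<Longrightarrow> w = w'"
  shows "\<exists>S l. load_cut B m S l"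
proof -
  define l where "l x y = (if x = v \<and> m v y = 2 then 1 else if y = v \<and> m v x \<ge> 1 then 1 else 0 :: nat)" for x y
  have e: "l x y + l y x = (if x \<in> {v} \<longleftrightarrow> y \<in> {v} then 0 else m x y)" if "x \<in> B" "y \<in> B" for x y
    using le2[OF that(1)] le2[OF that(2)] m0 sym unfolding l_def by (auto split: if_splits)
  have "sum (l x) B \<le> 1" if x: "x \<in> B" for x
  proof (cases "x = v")
    case True
    have "sum (l v) B = card {w \<in> B. m v w = 2}"
      using fin m0 unfolding l_def by (simp add: sum.If_cases Int_def)
    also have "\<dots> \<le> 1" using one fin by (auto simp: card_le_Suc0_iff_eq)
    finally show ?thesis using True by simp
  next
    case False
    then have "sum (l x) B = (\<Sum>y\<in>B. if y = v then (if m v x \<ge> 1 then 1 else 0) else 0)"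
      unfolding l_def by (intro sum.cong) auto
    also have "\<dots> \<le> 1" using fin by (simp add: sum.delta')
    finally show ?thesis .
  qed
  then show ?thesis using e v unfolding load_cut_def by (intro exI[of _ "{v}"] exI[of _ l]) auto
qed

text \<open>Deleting \<open>v\<close> is compensated by \<open>k\<close> extra units between its two
  double neighbours. If the given cut keeps \<open>w1\<close> and \<open>w2\<close> together,
  \<open>v\<close> joins them and bears its remaining weight, at most 1, itself. If it separates
  them, the \<open>k\<close> extra units disappear from their loads, which makes room for cutting
  \<open>v\<close> off from one of them.\<close>

lemma load_cut_suppress:
  fixes m :: "'a \<Rightarrow> 'a \<Rightarrow> nat"
  assumes fin: "finite B" and v: "v \<in> B" and w: "w1 \<in> B" "w2 \<in> B" "w1 \<noteq> w2" "w1 \<noteq> v" "w2 \<noteq> v"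
    and sym: "\<And>x y. m x y = m y x" and m0: "\<And>x. m x x = 0"
    and mw: "m v w1 = 2" "m v w2 = 2"
    and rest: "(\<Sum>y\<in>B - {w1, w2}. m v y) = k - 1" and k: "k = 1 \<or> k = 2"
    and m': "\<And>x y. m' x y = (if {x, y} = {w1, w2} then m x y + k else m x y)"
    and cut: "load_cut (B - {v}) m' S' l'"
  shows "\<exists>S l. load_cut B m S l"
proof -
  define B' where "B' = B - {v}"
  have B: "B = insert v B'" "v \<notin> B'" "finite B'" "w1 \<in> B'" "w2 \<in> B'" using w v fin unfolding B'_def by auto
  have S': "S' \<subseteq> B'" "S' \<noteq> {}" "S' \<noteq> B'"
    and l': "\<And>x y. x \<in> B' \<Longrightarrow> y \<in> B' \<Longrightarrow> l' x y + l' y x = (if x \<in> S' \<longleftrightarrow> y \<in> S' then 0 else m' x y)"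
    and s': "\<And>x. x \<in> B' \<Longrightarrow> sum (l' x) B' \<le> 1"
    using cut unfolding load_cut_def B'_def by auto
  have lle: "l' x y \<le> 1" if "x \<in> B'" "y \<in> B'" for x y
    using member_le_sum[of y B' "l' x"] s'[OF that(1)] that B(3) by (meson le0 le_trans)
  have restle: "m v y \<le> k - 1" if "y \<in> B - {w1, w2}" for y
    using member_le_sum[of y "B - {w1, w2}" "m v"] rest that fin by simp
  have rest1: "(\<Sum>y\<in>Y. m v y) \<le> 1" if "Y \<subseteq> B - {w1, w2}" for Y
  proof -
    have "(\<Sum>y\<in>Y. m v y) \<le> (\<Sum>y\<in>B - {w1, w2}. m v y)" using that fin by (intro sum_mono2) auto
    then show ?thesis using rest k by auto
  qed
  show ?thesis
  proof (cases "w1 \<in> S' \<longleftrightarrow> w2 \<in> S'")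
    case same: True
    define S where "S = (if w1 \<in> S' then insert v S' else S')"
    have Sx: "x \<in> S \<longleftrightarrow> x \<in> S'" if "x \<in> B'" for x using that B unfolding S_def by auto
    have Sv: "v \<in> S \<longleftrightarrow> w1 \<in> S'" using S' B unfolding S_def by auto
    define l where "l x y = (if y = v then 0 else if x = v then (if v \<in> S \<longleftrightarrow> y \<in> S then 0 else m v y) else l' x y)" for x y
    have e: "l x y + l y x = (if x \<in> S \<longleftrightarrow> y \<in> S then 0 else m x y)" if x: "x \<in> B" and y: "y \<in> B" for x y
    proof -
      have "m' x y = m x y" if "(x \<in> S') \<noteq> (y \<in> S')" using that same m' by (auto simp: doubleton_eq_iff)
      then show ?thesis using x y B l'[of x y] Sx sym m0 unfolding l_def by auto
    qed
    have su: "sum (l x) B \<le> 1" if x: "x \<in> B" for x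
    proof (cases "x = v")
      case True
      have "sum (l v) B = sum (m v) {y \<in> B. y \<noteq> v \<and> (v \<in> S) \<noteq> (y \<in> S)}"
        using fin unfolding l_def by (intro sum.mono_neutral_cong_right) auto
      also have "\<dots> \<le> 1" using Sx Sv same B by (intro rest1) auto
      finally show ?thesis using True by simp
    next
      case False
      then have "x \<in> B'" using x B by auto
      moreover have "sum (l x) B' = sum (l' x) B'" using False B by (intro sum.cong) (auto simp: l_def)
      moreover have "sum (l x) B = sum (l x) B'" using B by (simp add: l_def)
      ultimately show ?thesis using s' by simp
    qed
    have "S \<subseteq> B" "S \<noteq> {}" "S \<noteq> B" using S' B unfolding S_def by (auto split: if_splits)
    then show ?thesis unfolding load_cut_def using e su by blast
  next
    case diff: False
    have tot: "l' w1 w2 + l' w2 w1 = m w1 w2 + k" using l'[of w1 w2] B diff m' by simp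
    have le1: "l' w1 w2 \<le> 1" "l' w2 w1 \<le> 1" using lle B by auto
    \<comment> \<open>\<open>wi\<close> is the double neighbour whose side \<open>v\<close> will
      join, and \<open>wo\<close> the one it is cut off from. For \<open>k = 1\<close> there is no
      further neighbour and a positive load decides. For \<open>k = 2\<close> both loads equal 1, so
      the only further neighbour of \<open>v\<close> may decide.\<close>
    obtain wo wi where wo: "{wo, wi} = {w1, w2}" "wo \<noteq> wi" "l' wo wi \<ge> 1" "l' wi wo \<ge> k - 1"
      "\<And>y. y \<in> B - {w1, w2} \<Longrightarrow> m v y \<noteq> 0 \<Longrightarrow> (y \<in> S') \<longleftrightarrow> (wi \<in> S')"
    proof (cases "k = 1")
      case True
      then have *: "m v y = 0" if "y \<in> B - {w1, w2}" for y using restle that by simp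
      have "l' w1 w2 \<ge> 1 \<or> l' w2 w1 \<ge> 1" using tot True by auto
      then show ?thesis
      proof
        assume "l' w1 w2 \<ge> 1"
        then show ?thesis using True * w by (intro that[of w1 w2]) auto
      next
        assume "l' w2 w1 \<ge> 1"
        then show ?thesis using True * w by (intro that[of w2 w1]) auto
      qed
    next
      case False
      then have k2: "k = 2" using k by simp
      then have ge: "l' w1 w2 \<ge> 1" "l' w2 w1 \<ge> 1" using tot le1 by auto
      have uniq: "y = y'" if "y \<in> B - {w1, w2}" "m v y \<noteq> 0" "y' \<in> B - {w1, w2}" "m v y' \<noteq> 0" for y y'
      proof (rule ccontr)
        assume "y \<noteq> y'"
        then have "(\<Sum>z\<in>{y, y'}. m v z) = m v y + m v y'" by simp
        moreover have "(\<Sum>z\<in>{y, y'}. m v z) \<le> 1" using that by (intro rest1) auto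
        ultimately show False using that by simp
      qed
      show ?thesis
      proof (cases "\<forall>y\<in>B - {w1, w2}. m v y \<noteq> 0 \<longrightarrow> ((y \<in> S') \<longleftrightarrow> (w1 \<in> S'))")
        case True
        then show ?thesis using ge k2 w by (intro that[of w2 w1]) auto
      next
        case False
        then have "\<forall>y\<in>B - {w1, w2}. m v y \<noteq> 0 \<longrightarrow> ((y \<in> S') \<longleftrightarrow> (w2 \<in> S'))"
          using uniq diff by metis
        then show ?thesis using ge k2 w by (intro that[of w1 w2]) auto
      qed
    qed
    have wc: "(wo = w1 \<and> wi = w2) \<or> (wo = w2 \<and> wi = w1)" using wo(1) by (auto simp: doubleton_eq_iff)
    then have wB: "wo \<in> B'" "wi \<in> B'" "wo \<noteq> v" "wi \<noteq> v" and wmem: "wo \<in> {w1, w2}" "wi \<in> {w1, w2}"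
      using B by auto
    have wdiff: "(wo \<in> S') \<noteq> (wi \<in> S')" using wc diff by metis
    have tot': "l' wo wi + l' wi wo = m wo wi + k"
      using wc tot sym[of w1 w2] by (metis add.commute)
    define S where "S = (if wi \<in> S' then insert v S' else S')"
    have Sx: "x \<in> S \<longleftrightarrow> x \<in> S'" if "x \<in> B'" for x using that B unfolding S_def by auto
    have Sv: "v \<in> S \<longleftrightarrow> wi \<in> S'" using S' B unfolding S_def by auto
    \<comment> \<open>The cut pair of \<open>v\<close> and \<open>wo\<close> costs each of them one
      unit. \<open>wo\<close> saves this unit on its load towards \<open>wi\<close>; the other
      \<open>k - 1\<close> extra units are taken off the load of \<open>wi\<close>.\<close>
    define l where "l x y = (if x = v then (if y = wo then 1 else 0) else if y = v then (if x = wo then 1 else 0)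
       else if x = wo \<and> y = wi then l' wo wi - 1 else if x = wi \<and> y = wo then l' wi wo - (k - 1) else l' x y)" for x y
    have mvy: "(if v \<in> S \<longleftrightarrow> y \<in> S then 0 else m v y) = (if y = wo then 2 else 0)" if "y \<in> B" for y
    proof -
      consider "y = v" | "y = wo" | "y = wi" | "y \<in> B - {w1, w2}" "y \<noteq> v" using wc \<open>y \<in> B\<close> by blast
      then show ?thesis
      proof cases
        case 4
        then have "y \<in> B'" "y \<noteq> wo" using B that wmem by auto
        then show ?thesis using wo(5)[OF 4(1)] Sx Sv by auto
      next
        case 1
        then show ?thesis using wB by auto
      next
        case 2
        then show ?thesis using Sx[OF wB(1)] Sv wdiff wmem(1) mw by auto
      next
        case 3
        then show ?thesis using Sx[OF wB(2)] Sv wo(2) by auto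
      qed
    qed
    have e: "l x y + l y x = (if x \<in> S \<longleftrightarrow> y \<in> S then 0 else m x y)" if x: "x \<in> B" and y: "y \<in> B" for x y
    proof -
      consider "x = v" | "y = v" | "x \<in> B'" "y \<in> B'" "{x, y} = {wo, wi}" | "x \<in> B'" "y \<in> B'" "{x, y} \<noteq> {wo, wi}"
        using x y B by auto
      then show ?thesis
      proof cases
        case 1
        have "l v y + l y v = (if y = wo then 2 else 0)" using wB unfolding l_def by auto
        then show ?thesis using mvy[OF y] 1 by (simp only:)
      next
        case 2
        have "l x v + l v x = (if x = wo then 2 else 0)" using wB unfolding l_def by auto
        then show ?thesis using mvy[OF x] 2 sym[of x v] by (simp only: eq_commute[of "x \<in> S"])
      next
        case 3
        then have "(x = wo \<and> y = wi) \<or> (x = wi \<and> y = wo)" by (auto simp: doubleton_eq_iff)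
        moreover have "l wo wi + l wi wo = m wo wi" using wB wo(2-4) tot' k unfolding l_def by auto
        ultimately show ?thesis using Sx wB wdiff sym[of wo wi] by auto
      next
        case 4
        then have mm: "m' x y = m x y" using m'[of x y] wo(1) by (simp only: if_False)
        have "x \<noteq> v" "y \<noteq> v" using 4 B by auto
        moreover have "\<not> (x = wo \<and> y = wi)" "\<not> (x = wi \<and> y = wo)"
          "\<not> (y = wo \<and> x = wi)" "\<not> (y = wi \<and> x = wo)" using 4(3) by auto
        ultimately have "l x y = l' x y" "l y x = l' y x" by (simp_all only: l_def if_False)
        then show ?thesis using l'[OF 4(1,2)] unfolding Sx[OF 4(1)] Sx[OF 4(2)] mm by (simp only:)
      qed
    qed
    have su: "sum (l x) B \<le> 1" if x: "x \<in> B" for x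
    proof -
      have sp: "sum (l x) B = l x v + sum (l x) B'" using B by simp
      consider "x = v" | "x = wo" | "x \<in> B'" "x \<noteq> wo" using x B by auto
      then show ?thesis
      proof cases
        case 1
        then have "sum (l x) B' = (\<Sum>y\<in>B'. if y = wo then 1 else 0)" unfolding l_def by simp
        also have "\<dots> = 1" using wB B by simp
        finally show ?thesis using sp 1 wB unfolding l_def by simp
      next
        case 2
        have "sum (l wo) B' = l wo wi + sum (l wo) (B' - {wi})" by (rule sum.remove[OF B(3) wB(2)])
        moreover have "sum (l' wo) B' = l' wo wi + sum (l' wo) (B' - {wi})" by (rule sum.remove[OF B(3) wB(2)])
        moreover have "sum (l wo) (B' - {wi}) = sum (l' wo) (B' - {wi})"
          using B wB wo(2) by (intro sum.cong) (auto simp: l_def)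
        moreover have "l wo wi = l' wo wi - 1" "l wo v = 1" using wB wo(2) unfolding l_def by auto
        ultimately show ?thesis using sp 2 s'[OF wB(1)] wo(3) by simp
      next
        case 3
        then have xv: "x \<noteq> v" using B by auto
        have "sum (l x) B' \<le> sum (l' x) B'" using 3 xv B by (intro sum_mono) (auto simp: l_def)
        moreover have "l x v = 0" using 3 xv unfolding l_def by simp
        ultimately show ?thesis using sp s'[OF 3(1)] by simp
      qed
    qed
    have "S \<subseteq> B" "S \<noteq> {}" "S \<noteq> B" using S' B unfolding S_def by (auto split: if_splits)
    then show ?thesis unfolding load_cut_def using e su by blast
  qed
qed

text \<open>Contracting a pair of multiplicity at least 3, or replacing a vertex that sees two vertices doubly
  and at most one further vertex simply by an edge between these two, lowers the number of vertices
  by one and twice the number of edges by at least 6; every other vertex of degree at most 5 is cut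
  off by its star.\<close>

theorem load_cut_exists:
  fixes m :: "'a \<Rightarrow> 'a \<Rightarrow> nat"
  assumes "finite B" "card B \<ge> 2" "\<And>x y. m x y = m y x" "\<And>x. m x x = 0"
    and "(\<Sum>x\<in>B. \<Sum>y\<in>B. m x y) + 6 < 6 * card B"
  shows "\<exists>S l. load_cut B m S l"
  using assms
proof (induction "card B" arbitrary: B m rule: less_induct)
  case less
  note fin = less.prems(1) and sym = less.prems(3) and m0 = less.prems(4)
  have split: "(\<Sum>x\<in>B. \<Sum>y\<in>B. m x y) = (\<Sum>x\<in>B - {v}. \<Sum>y\<in>B - {v}. m x y) + 2 * (\<Sum>y\<in>B - {v}. m v y)"
    if v: "v \<in> B" for v
  proof -
    have "(\<Sum>x\<in>B. \<Sum>y\<in>B. m x y) = (\<Sum>y\<in>B. m v y) + (\<Sum>x\<in>B - {v}. \<Sum>y\<in>B. m x y)"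
      using sum.remove[OF fin v] by blast
    moreover have "(\<Sum>y\<in>B. m x y) = m x v + (\<Sum>y\<in>B - {v}. m x y)" for x
      using sum.remove[OF fin v] by blast
    ultimately show ?thesis using m0 sym[of _ v] by (simp add: sum.distrib)
  qed
  have card': "card (B - {v}) = card B - 1" if "v \<in> B" for v using fin that by simp
  show ?case
  proof (cases "\<exists>u\<in>B. \<exists>v\<in>B. m u v \<ge> 3")
    case True
    then obtain u v where uv: "u \<in> B" "v \<in> B" "m u v \<ge> 3" by blast
    then have ne: "u \<noteq> v" using m0 by auto
    define m' where "m' x y = (if x = y then 0 else if x = u then m u y + m v y else if y = u then m x u + m x v else m x y)" for x y
    have uB: "u \<in> B - {v}" using uv ne by simp
    have fB: "finite (B - {v})" using fin by simp
    have rowu: "(\<Sum>y\<in>B - {v}. m' u y) = (\<Sum>y\<in>B - {v}. m u y) + (\<Sum>y\<in>B - {v} - {u}. m v y)"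
    proof -
      have "(\<Sum>y\<in>B - {v} - {u}. m' u y) = (\<Sum>y\<in>B - {v} - {u}. m u y + m v y)"
        by (intro sum.cong) (auto simp: m'_def)
      then have "(\<Sum>y\<in>B - {v}. m' u y) = (\<Sum>y\<in>B - {v} - {u}. m u y + m v y)"
        using sum.remove[OF fB uB, of "m' u"] by (simp add: m'_def)
      moreover have "(\<Sum>y\<in>B - {v}. m u y) = (\<Sum>y\<in>B - {v} - {u}. m u y)"
        using sum.remove[OF fB uB, of "m u"] m0 by simp
      ultimately show ?thesis by (simp add: sum.distrib)
    qed
    have rowx: "(\<Sum>y\<in>B - {v}. m' x y) = (\<Sum>y\<in>B - {v}. m x y) + m v x" if "x \<in> B - {v} - {u}" for x
    proof -
      have "(\<Sum>y\<in>B - {v} - {u}. m' x y) = (\<Sum>y\<in>B - {v} - {u}. m x y)"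
        using that m0 by (intro sum.cong) (auto simp: m'_def)
      moreover have "m' x u = m x u + m x v" using that by (auto simp: m'_def)
      ultimately show ?thesis
        using sum.remove[OF fB uB, of "m' x"] sum.remove[OF fB uB, of "m x"] sym[of x v] by simp
    qed
    have "(\<Sum>x\<in>B - {v}. \<Sum>y\<in>B - {v}. m' x y) =
        (\<Sum>y\<in>B - {v}. m' u y) + (\<Sum>x\<in>B - {v} - {u}. \<Sum>y\<in>B - {v}. m' x y)"
      using sum.remove[OF fB uB] by blast
    also have "\<dots> = (\<Sum>x\<in>B - {v}. \<Sum>y\<in>B - {v}. m x y) + 2 * (\<Sum>y\<in>B - {v} - {u}. m v y)"
      using rowu rowx sum.remove[OF fB uB, of "\<lambda>x. \<Sum>y\<in>B - {v}. m x y"] by (simp add: sum.distrib)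
    finally have T: "(\<Sum>x\<in>B - {v}. \<Sum>y\<in>B - {v}. m' x y) + 2 * m v u = (\<Sum>x\<in>B. \<Sum>y\<in>B. m x y)"
      using split[OF uv(2)] sum.remove[OF fB uB, of "m v"] by simp
    \<comment> \<open>A pair of weight at least 3 contributes 6 over its two orders, which the
      strict bound forbids for two vertices. So at least two vertices remain after
      contraction.\<close>
    have big: "card B \<noteq> 2"
    proof
      assume "card B = 2"
      moreover have "(\<Sum>x\<in>B. \<Sum>y\<in>B. m x y) \<ge> 6" using T uv(3) sym[of v u] by simp
      ultimately show False using less.prems(5) by simp
    qed
    have "\<exists>S l. load_cut (B - {v}) m' S l"
    proof (rule less.hyps)
      show "card (B - {v}) < card B" using card'[OF uv(2)] less.prems(2) by simp
      show "2 \<le> card (B - {v})" using card'[OF uv(2)] less.prems(2) big by simp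
      show "(\<Sum>x\<in>B - {v}. \<Sum>y\<in>B - {v}. m' x y) + 6 < 6 * card (B - {v})"
        using T less.prems(5) card'[OF uv(2)] uv(3) sym[of v u] by simp
    qed (use fin sym m0 in \<open>auto simp: m'_def add.commute\<close>)
    then obtain S' l' where c: "load_cut (B - {v}) m' S' l'" by blast
    show ?thesis by (rule load_cut_contract[OF fin uv(1,2) ne sym m'_def c])
  next
    case False
    then have le2: "m x y \<le> 2" if "x \<in> B" "y \<in> B" for x y
    proof -
      have "\<not> 3 \<le> m x y" using False that by blast
      then show ?thesis by simp
    qed
    have "\<exists>v\<in>B. (\<Sum>y\<in>B. m v y) \<le> 5"
    proof (rule ccontr)
      assume "\<not> ?thesis"
      then have "(\<Sum>x\<in>B. 6) \<le> (\<Sum>x\<in>B. \<Sum>y\<in>B. m x y)" by (intro sum_mono) auto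
      then show False using less.prems(5) by simp
    qed
    then obtain v where v: "v \<in> B" "(\<Sum>y\<in>B. m v y) \<le> 5" by blast
    have B1: "B \<noteq> {v}" using less.prems(2) by auto
    show ?thesis
    proof (cases "\<exists>w1\<in>B. \<exists>w2\<in>B. w1 \<noteq> w2 \<and> m v w1 = 2 \<and> m v w2 = 2")
      case False
      then have one: "w = w'" if "w \<in> B" "w' \<in> B" "m v w = 2" "m v w' = 2" for w w' using that by blast
      show ?thesis by (rule load_cut_star[of B v m]) (fact fin v(1) B1 sym m0 le2[OF v(1)] one)+
    next
      case True
      then obtain w1 w2 where w: "w1 \<in> B" "w2 \<in> B" "w1 \<noteq> w2" "m v w1 = 2" "m v w2 = 2" by blast
      have wv: "w1 \<noteq> v" "w2 \<noteq> v" using w m0 by auto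
      \<comment> \<open>The degree of \<open>v\<close> is 4 or 5, so \<open>k\<close> is 1 or 2.
        Deleting \<open>v\<close> takes \<open>2 * (k + 3)\<close> from the double sum and the new
        weight returns \<open>2 * k\<close>: a loss of exactly 6.\<close>
      define k where "k = (\<Sum>y\<in>B. m v y) - 3"
      have "(\<Sum>y\<in>B. m v y) = m v w1 + (m v w2 + (\<Sum>y\<in>B - {w1} - {w2}. m v y))"
        using sum.remove[OF fin w(1), of "m v"] sum.remove[of "B - {w1}" w2 "m v"] fin w by simp
      then have deg: "(\<Sum>y\<in>B. m v y) = 4 + (\<Sum>y\<in>B - {w1, w2}. m v y)"
        using w by (simp add: Diff_insert2[of B w1 "{w2}"])
      then have rest: "(\<Sum>y\<in>B - {w1, w2}. m v y) = k - 1" and k: "k = 1 \<or> k = 2" and kd: "(\<Sum>y\<in>B. m v y) = k + 3"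
        using v(2) unfolding k_def by auto
      define m' where "m' x y = (if {x, y} = {w1, w2} then m x y + k else m x y)" for x y
      have wB: "w1 \<in> B - {v}" "w2 \<in> B - {v}" using w wv by auto
      have fB: "finite (B - {v})" using fin by simp
      have "(\<Sum>x\<in>B - {v}. \<Sum>y\<in>B - {v}. m' x y) =
        (\<Sum>x\<in>B - {v}. (\<Sum>y\<in>B - {v}. m x y) + ((if x = w1 then k else 0) + (if x = w2 then k else 0)))"
      proof (rule sum.cong[OF refl])
        fix x assume "x \<in> B - {v}"
        have "(\<Sum>y\<in>B - {v}. m' x y) = (\<Sum>y\<in>B - {v}. m x y + ((if y = w2 then if x = w1 then k else 0 else 0) + (if y = w1 then if x = w2 then k else 0 else 0)))"
          using w(3) by (intro sum.cong) (auto simp: m'_def doubleton_eq_iff)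
        also have "\<dots> = (\<Sum>y\<in>B - {v}. m x y) + ((if x = w1 then k else 0) + (if x = w2 then k else 0))"
          using wB fB by (simp add: sum.distrib)
        finally show "(\<Sum>y\<in>B - {v}. m' x y) = (\<Sum>y\<in>B - {v}. m x y) + ((if x = w1 then k else 0) + (if x = w2 then k else 0))" .
      qed
      also have "\<dots> = (\<Sum>x\<in>B - {v}. \<Sum>y\<in>B - {v}. m x y) + 2 * k"
        using wB fB by (simp add: sum.distrib)
      finally have T: "(\<Sum>x\<in>B - {v}. \<Sum>y\<in>B - {v}. m' x y) + 6 = (\<Sum>x\<in>B. \<Sum>y\<in>B. m x y)"
        using split[OF v(1)] kd sum.remove[OF fin v(1), of "m v"] m0 by simp
      have "card {v, w1, w2} \<le> card B" using v w fin by (intro card_mono) auto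
      then have c3: "3 \<le> card B" using w(3) wv by simp
      have "\<exists>S l. load_cut (B - {v}) m' S l"
      proof (rule less.hyps)
        show "card (B - {v}) < card B" using card'[OF v(1)] less.prems(2) by simp
        show "2 \<le> card (B - {v})" using card'[OF v(1)] c3 by simp
        show "(\<Sum>x\<in>B - {v}. \<Sum>y\<in>B - {v}. m' x y) + 6 < 6 * card (B - {v})"
          using T less.prems(5) card'[OF v(1)] by simp
        show "m' x y = m' y x" for x y using sym[of x y] by (simp add: m'_def insert_commute)
        show "m' x x = 0" for x using m0 w(3) by (auto simp: m'_def)
      qed (use fin in auto)
      then obtain S' l' where c: "load_cut (B - {v}) m' S' l'" by blast
      show ?thesis by (rule load_cut_suppress[OF fin v(1) w(1-3) wv sym m0 w(4,5) rest k m'_def c])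
    qed
  qed
qed

section \<open>Vertices of degree 2 in critical graphs\<close>

text \<open>Girth enters through the absence of cycles of length 3 and 4, criticality through good
  labelings of the induced subgraphs on fewer vertices.\<close>

locale bad_graph = simple_graph V E for V :: "'a set" and E :: "'a set set" +
  assumes no_C3: "{u, v} \<in> E \<Longrightarrow> {v, w} \<in> E \<Longrightarrow> {u, w} \<in> E \<Longrightarrow> False"
    and no_C4: "{a, b} \<in> E \<Longrightarrow> {b, c} \<in> E \<Longrightarrow> {c, d} \<in> E \<Longrightarrow> {d, a} \<in> E \<Longrightarrow> a \<noteq> c \<Longrightarrow> b \<noteq> d \<Longrightarrow> False"
    and sub_good: "X \<subset> V \<Longrightarrow> \<exists>\<phi>. good_on E \<phi> X"
    and not_good: "\<not> good_on E \<phi> V"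
begin

abbreviation adj :: "'a \<Rightarrow> 'a \<Rightarrow> bool" where "adj u v \<equiv> {u, v} \<in> E"

definition N :: "'a \<Rightarrow> 'a set" where "N v = {u. adj v u}"

lemma adj_sym: "adj u v \<longleftrightarrow> adj v u" by (simp add: insert_commute)

lemma adj_irrefl: "\<not> adj u u" using edge_card[of "{u}"] by auto

lemma adj_neq: "adj u v \<Longrightarrow> u \<noteq> v" using adj_irrefl by auto

lemma adj_V: "adj u v \<Longrightarrow> u \<in> V \<and> v \<in> V" using edge_verts[of "{u, v}"] by auto

lemma N_iff: "u \<in> N v \<longleftrightarrow> adj v u" unfolding N_def by simp

lemma finite_N: "finite (N v)"
  by (rule finite_subset[OF _ finite_verts]) (use adj_V in \<open>auto simp: N_def\<close>)

lemma two_common: "adj u a \<Longrightarrow> adj u b \<Longrightarrow> adj v a \<Longrightarrow> adj v b \<Longrightarrow> u \<noteq> v \<Longrightarrow> a = b"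
  using no_C4[of u a v b] by (metis insert_commute)

lemma no_tri: "adj u v \<Longrightarrow> adj u w \<Longrightarrow> \<not> adj v w"
  using no_C3[of v u w] by (metis insert_commute)

text \<open>As soon as two parts are nonempty, each part is a proper subset of \<open>V\<close> and
  is labeled by criticality.\<close>

lemma parts_False:
  fixes \<pi> :: "'a \<Rightarrow> 'b" and Q :: "'a \<Rightarrow> 'a \<Rightarrow> 'b set" and \<rho> :: "'a set \<Rightarrow> real"
  assumes two: "s \<in> V" "t \<in> V" "\<pi> s \<noteq> \<pi> t"
    and cr_def: "\<And>u v. cr u v \<longleftrightarrow> adj u v \<and> \<pi> u \<noteq> \<pi> v"
    and neg: "\<And>u v. cr u v \<Longrightarrow> \<rho> {u, v} < 0"
    and Q1: "\<And>u a. cr u a \<Longrightarrow> \<pi> a \<in> Q u a"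
    and Q2: "\<And>u a b. cr u a \<Longrightarrow> cr a b \<Longrightarrow> b \<noteq> u \<Longrightarrow> \<rho> {u, a} \<le> \<rho> {a, b} \<Longrightarrow> Q a b \<subseteq> Q u a"
    and Q3: "\<And>u a. cr u a \<Longrightarrow> \<pi> u \<notin> Q u a"
    and Q4: "\<And>u a b. cr u a \<Longrightarrow> cr u b \<Longrightarrow> a \<noteq> b \<Longrightarrow> Q u a \<inter> Q u b = {}"
  shows False
proof (rule good_on_parts[of E \<pi> V cr \<rho> Q False])
  show "\<And>e. e \<in> E \<Longrightarrow> e \<noteq> {}" using edge_card by fastforce
  fix c
  have "s \<notin> {v \<in> V. \<pi> v = c} \<or> t \<notin> {v \<in> V. \<pi> v = c}" using two by auto
  then have "{v \<in> V. \<pi> v = c} \<subset> V" using two(1,2) by blast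
  then show "\<exists>\<psi>. good_on E \<psi> {v \<in> V. \<pi> v = c}" by (rule sub_good)
next
  show "cr u v \<longleftrightarrow> u \<in> V \<and> v \<in> V \<and> adj u v \<and> \<pi> u \<noteq> \<pi> v" for u v
    unfolding cr_def using adj_V by blast
  show False if "good_on E \<Phi> V" for \<Phi> using that not_good by blast
qed (fact neg Q1 Q2 Q3 Q4)+

text \<open>All cut edges get the label -1, below everything else. They form a matching, so a path
  that has just crossed continues inside a side, where labels are positive, and never crosses
  again.\<close>

lemma matching_cut_False:
  assumes S: "S \<subseteq> V" "S \<noteq> {}" "S \<noteq> V"
    and one: "\<And>u a b. adj u a \<Longrightarrow> adj u b \<Longrightarrow> (a \<in> S) \<noteq> (u \<in> S) \<Longrightarrow> (b \<in> S) \<noteq> (u \<in> S) \<Longrightarrow> a = b"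
  shows False
proof -
  obtain s t where st: "s \<in> S" "t \<in> V" "t \<notin> S" using S by blast
  have bk: False if "adj u a" "(u \<in> S) \<noteq> (a \<in> S)" "adj a b" "(a \<in> S) \<noteq> (b \<in> S)" "b \<noteq> u" for u a b
    using one[of a u b] that adj_sym by metis
  show False
  proof (rule parts_False[of s t "\<lambda>v. v \<in> S" "\<lambda>u v. adj u v \<and> (u \<in> S) \<noteq> (v \<in> S)" "\<lambda>_. -1" "\<lambda>u a. {a \<in> S}"])
    show "s \<in> V" "t \<in> V" "(s \<in> S) \<noteq> (t \<in> S)" using st S by auto
    show "{b \<in> S} \<subseteq> {a \<in> S}" if "adj u a \<and> (u \<in> S) \<noteq> (a \<in> S)" "adj a b \<and> (a \<in> S) \<noteq> (b \<in> S)" "b \<noteq> u" for u a b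
      using bk[of u a b] that by blast
    show "{a \<in> S} \<inter> {b \<in> S} = {}" if "adj u a \<and> (u \<in> S) \<noteq> (a \<in> S)" "adj u b \<and> (u \<in> S) \<noteq> (b \<in> S)" "a \<noteq> b" for u a b
      using one[of u a b] that by blast
    show "(u \<in> S) \<notin> {a \<in> S}" if "adj u a \<and> (u \<in> S) \<noteq> (a \<in> S)" for u a using that by blast
  qed auto
qed

text \<open>Cutting off a vertex with at most one neighbour is a matching cut; the graph with a
  single vertex is labeled directly.\<close>

lemma deg_ge_2: assumes v: "v \<in> V" shows "card (N v) \<ge> 2"
proof (rule ccontr)
  assume "\<not> ?thesis"
  then have one: "a = b" if "adj v a" "adj v b" for a b
    using that finite_N[of v] card_le_Suc0_iff_eq[of "N v"] by (auto simp: N_iff)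
  have "\<exists>u. adj v u"
  proof (rule ccontr)
    assume no: "\<not> ?thesis"
    show False
    proof (cases "V = {v}")
      case True
      have "nondec E \<phi> V p \<Longrightarrow> p = [v]" for \<phi> p
        unfolding nondec_def True by (cases p; cases "tl p") auto
      then have "good_on E \<phi> V" for \<phi> unfolding good_on_def by metis
      then show False using not_good by blast
    next
      case False
      then show False using no v adj_sym by (intro matching_cut_False[of "{v}"]) auto
    qed
  qed
  then have "V \<noteq> {v}" using adj_V adj_neq by blast
  then show False using one v adj_sym
    by (intro matching_cut_False[of "{v}"]) (auto dest: adj_neq)
qed

definition V2 :: "'a set" where "V2 = {v \<in> V. card (N v) = 2}"
definition B :: "'a set" where "B = V - V2"

lemma V2_N: assumes "c \<in> V2" "adj c p" shows "\<exists>q. q \<noteq> p \<and> adj c q \<and> N c = {p, q}"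
proof -
  obtain x y where xy: "N c = {x, y}" "x \<noteq> y" using assms(1) unfolding V2_def by (auto simp: card_2_iff)
  moreover have "p \<in> N c" using assms(2) by (simp add: N_iff)
  moreover have "adj c x" "adj c y" using xy N_iff[of _ c] by blast+
  ultimately show ?thesis by (metis doubleton_eq_iff insertE singletonD)
qed

lemma V2_third: "c \<in> V2 \<Longrightarrow> adj c p \<Longrightarrow> adj c q \<Longrightarrow> p \<noteq> q \<Longrightarrow> adj c x \<Longrightarrow> x = p \<or> x = q"
  using V2_N[of c p] N_iff[of q c] N_iff[of x c] by auto

text \<open>Each of two adjacent vertices of degree 2 has one further edge, and without triangles
  the far ends of these edges differ; so the pair is cut off by a matching.\<close>

lemma V2_indep: assumes "a \<in> V2" "b \<in> V2" shows "\<not> adj a b"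
proof
  assume ab: "adj a b"
  obtain y where y: "y \<noteq> b" "adj a y" "N a = {b, y}" using V2_N[OF assms(1) ab] by blast
  obtain z where z: "z \<noteq> a" "adj b z" "N b = {a, z}" using V2_N[OF assms(2)] ab adj_sym by metis
  have ny: "adj a x \<longleftrightarrow> x = b \<or> x = y" for x using y(3) by (metis N_iff insert_iff singletonD)
  have nz: "adj b x \<longleftrightarrow> x = a \<or> x = z" for x using z(3) by (metis N_iff insert_iff singletonD)
  have "y \<noteq> z" "y \<noteq> a" using no_tri[OF ab] y(2) z(2) adj_sym[of a b] adj_neq[of a y] no_tri[of a b y] by auto
  show False
  proof (rule matching_cut_False[of "{a, b}"])
    show "{a, b} \<subseteq> V" using ab adj_V by blast
    show "{a, b} \<noteq> V" using y(1,2) adj_V[of a y] \<open>y \<noteq> a\<close> by auto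
    fix u c d assume u: "adj u c" "adj u d" "(c \<in> {a, b}) \<noteq> (u \<in> {a, b})" "(d \<in> {a, b}) \<noteq> (u \<in> {a, b})"
    consider "u = a" | "u = b" | "u \<notin> {a, b}" by blast
    then show "c = d"
    proof cases
      case 1
      then show ?thesis using u ny by auto
    next
      case 2
      then show ?thesis using u nz by auto
    next
      case 3
      then have "c \<in> {a, b}" "d \<in> {a, b}" using u by auto
      moreover have "\<not> (adj u a \<and> adj u b)" using no_tri[of u a b] ab by blast
      ultimately show ?thesis using u(1,2) by auto
    qed
  qed simp
qed

lemma B_deg: "v \<in> B \<Longrightarrow> card (N v) \<ge> 3"
  using deg_ge_2[of v] unfolding B_def V2_def by auto

lemma V2_B: "c \<in> V2 \<Longrightarrow> adj c p \<Longrightarrow> p \<in> B"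
  using V2_indep[of c p] adj_V[of c p] unfolding B_def by blast

lemma V_split: "V = B \<union> V2" "B \<inter> V2 = {}" unfolding B_def V2_def by auto

lemma finite_B: "finite B" and finite_V2: "finite V2"
  using finite_verts unfolding B_def V2_def by auto

definition d0 :: "'a \<Rightarrow> nat" where "d0 v = card (N v \<inter> B)"
definition d1 :: "'a \<Rightarrow> nat" where "d1 v = card (N v \<inter> V2)"

lemma deg_split: "card (N v) = d0 v + d1 v"
proof -
  have "N v = (N v \<inter> B) \<union> (N v \<inter> V2)" using V_split adj_V by (auto simp: N_iff)
  then show ?thesis unfolding d0_def d1_def
    using card_Un_disjoint[of "N v \<inter> B" "N v \<inter> V2"] finite_N V_split(2) by (metis Int_assoc Int_empty_right Int_left_commute finite_Int)
qed

text \<open>Otherwise \<open>v\<close> and its neighbours of degree 2 are cut off by a matching: at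
  most one edge from \<open>v\<close> to \<open>B\<close>, and one edge from each of these
  neighbours, whose far ends are distinct and not adjacent to \<open>v\<close> as there are no
  triangles and 4-cycles.\<close>

lemma d0_ge_2: assumes v: "v \<in> B" shows "d0 v \<ge> 2"
proof (rule ccontr)
  assume "\<not> ?thesis"
  then have one: "a = b" if "adj v a" "adj v b" "a \<in> B" "b \<in> B" for a b
    using that finite_N[of v] card_le_Suc0_iff_eq[of "N v \<inter> B"] unfolding d0_def by (auto simp: N_iff)
  define S where "S = insert v (N v \<inter> V2)"
  have S: "S \<subseteq> V" "S \<noteq> {}" using v V_split unfolding S_def by auto
  have inS: "x \<in> S \<longleftrightarrow> x = v \<or> (adj v x \<and> x \<in> V2)" for x unfolding S_def by (auto simp: N_iff)
  have "S \<noteq> V"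
  proof
    assume SV: "S = V"
    obtain u where u: "adj v u" using deg_ge_2[of v] v V_split
      by (metis N_iff UnI1 card.empty ex_in_conv not_numeral_le_zero)
    then have uV2: "u \<in> V2" using SV inS adj_V adj_neq by metis
    then obtain q where "q \<noteq> v" "adj u q" using V2_N u adj_sym by metis
    then show False using SV inS adj_V V2_indep uV2 by metis
  qed
  then show False
  proof (rule matching_cut_False[OF S])
    fix u a b assume ua: "adj u a" "adj u b" "(a \<in> S) \<noteq> (u \<in> S)" "(b \<in> S) \<noteq> (u \<in> S)"
    consider "u = v" | "u \<noteq> v" "u \<in> S" | "u \<notin> S" by blast
    then show "a = b"
    proof cases
      case 1
      then show ?thesis using ua inS one adj_V V_split by (metis Un_iff)
    next
      case 2
      then show ?thesis using ua inS V2_third adj_sym by metis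
    next
      case 3
      then show ?thesis using ua inS no_tri two_common adj_sym by metis
    qed
  qed
qed

definition D :: "'a set" where "D = {v \<in> B. d0 v = 2}"

text \<open>\<open>y\<close> and \<open>z\<close>, each with its neighbours of degree 2, form two
  parts and everything else a third. Apart from the edge between them, \<open>y\<close> and
  \<open>z\<close> have at most one crossing edge each. The edge between them is labeled above the
  other crossing edges, so a path from outside may pass through one of them to the other, but after
  using that edge no path can leave again.\<close>

lemma D_indep: assumes y: "y \<in> D" and z: "z \<in> D" shows "\<not> adj y z"
proof
  assume yz: "adj y z"
  have B: "y \<in> B" "z \<in> B" "y \<notin> V2" "z \<notin> V2" using y z V_split unfolding D_def by auto
  have yz': "y \<noteq> z" "adj z y" using yz adj_neq adj_sym by auto
  have uy: "a = b" if "adj y a" "adj y b" "a \<in> B" "b \<in> B" "a \<noteq> z" "b \<noteq> z" for a b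
  proof (rule ccontr)
    assume "a \<noteq> b"
    then have "card {a, b, z} \<le> d0 y" unfolding d0_def
      using that yz B by (intro card_mono) (auto simp: N_iff finite_N)
    then show False using \<open>a \<noteq> b\<close> that y unfolding D_def by auto
  qed
  have uz: "a = b" if "adj z a" "adj z b" "a \<in> B" "b \<in> B" "a \<noteq> y" "b \<noteq> y" for a b
  proof (rule ccontr)
    assume "a \<noteq> b"
    then have "card {a, b, y} \<le> d0 z" unfolding d0_def
      using that yz' B by (intro card_mono) (auto simp: N_iff finite_N)
    then show False using \<open>a \<noteq> b\<close> that z unfolding D_def by auto
  qed
  define \<pi> where "\<pi> v = (if v = y \<or> (adj y v \<and> v \<in> V2) then 1 else if v = z \<or> (adj z v \<and> v \<in> V2) then 2 else (0::nat))" for v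
  have py: "\<pi> y = 1" and pz: "\<pi> z = 2" using yz' B unfolding \<pi>_def by auto
  have ntri: "\<not> (adj y v \<and> adj z v)" for v using no_tri yz adj_sym by metis
  have p1: "\<pi> v = 1 \<longleftrightarrow> v = y \<or> (adj y v \<and> v \<in> V2)" for v unfolding \<pi>_def by auto
  have p2: "\<pi> v = 2 \<longleftrightarrow> v = z \<or> (adj z v \<and> v \<in> V2)" for v
    using yz' B ntri unfolding \<pi>_def by auto
  have p012: "\<pi> v = 0 \<or> \<pi> v = 1 \<or> \<pi> v = 2" for v unfolding \<pi>_def by auto
  define cr where "cr u v \<longleftrightarrow> adj u v \<and> \<pi> u \<noteq> \<pi> v" for u v
  have crs: "cr u v \<longleftrightarrow> cr v u" for u v unfolding cr_def using adj_sym by metis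
  define \<rho> where "\<rho> e = (if e = {y, z} then -1 else -2 :: real)" for e
  \<comment> \<open>The set \<open>{1, 2}\<close> records the passage from outside through one of
    \<open>y\<close> and \<open>z\<close> to the other. Otherwise two crossing edges in a row occur
    only at an outside vertex adjacent to a vertex of degree 2 from each of the two parts, which
    gives \<open>{0, 2}\<close> and \<open>{0, 1}\<close>.\<close>
  define Q where "Q u a = (if \<pi> u = 0 \<and> a \<in> {y, z} then {1, 2} else if \<pi> a \<noteq> 0 then {\<pi> a}
     else if u \<in> V2 \<and> \<pi> u = 1 then {0, 2} else if u \<in> V2 \<and> \<pi> u = 2 then {0, 1} else {0})" for u a
  have out_y: False if "adj t y" "adj t a" "a \<noteq> y" "\<pi> a \<noteq> 0" "\<pi> t = 0" for t a
  proof -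
    have "a = z \<or> (adj y a \<and> a \<in> V2) \<or> (adj z a \<and> a \<in> V2)" using that p1 p2 p012 by metis
    moreover have "t \<noteq> z" using that pz by auto
    ultimately show False using that no_tri two_common[of t a y z] yz adj_sym B by metis
  qed
  have out_z: False if "adj t z" "adj t a" "a \<noteq> z" "\<pi> a \<noteq> 0" "\<pi> t = 0" for t a
  proof -
    have "a = y \<or> (adj y a \<and> a \<in> V2) \<or> (adj z a \<and> a \<in> V2)" using that p1 p2 p012 by metis
    moreover have "t \<noteq> y" using that py by auto
    ultimately show False using that no_tri two_common[of t a z y] yz adj_sym B by metis
  qed
  have out: "a \<in> V2 \<and> b \<in> V2 \<and> \<pi> a \<noteq> \<pi> b" if "cr t a" "cr t b" "a \<noteq> b" "\<pi> t = 0" for t a b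
  proof -
    have ab: "adj t a" "adj t b" "\<pi> a \<noteq> 0" "\<pi> b \<noteq> 0" using that unfolding cr_def by auto
    then have ne: "a \<noteq> y" "a \<noteq> z" "b \<noteq> y" "b \<noteq> z" using out_y out_z that by metis+
    then have "(adj y a \<and> a \<in> V2 \<and> \<pi> a = 1) \<or> (adj z a \<and> a \<in> V2 \<and> \<pi> a = 2)"
      "(adj y b \<and> b \<in> V2 \<and> \<pi> b = 1) \<or> (adj z b \<and> b \<in> V2 \<and> \<pi> b = 2)"
      using ab p1 p2 p012 by metis+
    moreover have "t \<noteq> y" "t \<noteq> z" using that py pz by auto
    ultimately show ?thesis using two_common[of t a b y] two_common[of t a b z] ab(1,2) that(3) by auto
  qed
  have mid: "{u, a} = {y, z}" if "cr u a" "\<pi> u \<noteq> 0" "\<pi> a \<noteq> 0" for u a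
  proof -
    have "(\<pi> u = 1 \<and> \<pi> a = 2) \<or> (\<pi> u = 2 \<and> \<pi> a = 1)" using that p012 unfolding cr_def by metis
    then have "(u = y \<or> (adj y u \<and> u \<in> V2)) \<and> (a = z \<or> (adj z a \<and> a \<in> V2)) \<or>
       (u = z \<or> (adj z u \<and> u \<in> V2)) \<and> (a = y \<or> (adj y a \<and> a \<in> V2))"
      using p1 p2 by blast
    moreover have ad: "adj u a" "adj a u" "\<pi> u \<noteq> \<pi> a" using that adj_sym unfolding cr_def by metis+
    moreover have "a = z" if "u = y" using that calculation py p1[of a] p2[of a] by metis
    moreover have "a = y" if "u = z" using that calculation pz p1[of a] p2[of a] by metis
    moreover have "u = y" if "a = z" using that calculation pz p1[of u] p2[of u] by metis
    moreover have "u = z" if "a = y" using that calculation py p1[of u] p2[of u] by metis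
    ultimately show ?thesis using V2_indep[of u a] by blast
  qed
  have in_y: "a = b" if "cr y a" "cr y b" "\<pi> a = 0" "\<pi> b = 0" for a b
  proof -
    have "a \<notin> V2" "b \<notin> V2" "a \<noteq> z" "b \<noteq> z" using that p1 pz unfolding cr_def by force+
    then show ?thesis using that uy adj_V V_split unfolding cr_def by (metis Un_iff)
  qed
  have in_z: "a = b" if "cr z a" "cr z b" "\<pi> a = 0" "\<pi> b = 0" for a b
  proof -
    have "a \<notin> V2" "b \<notin> V2" "a \<noteq> y" "b \<noteq> y" using that p2 py unfolding cr_def by force+
    then show ?thesis using that uz adj_V V_split unfolding cr_def by (metis Un_iff)
  qed
  have in_V2: "a = b" if u: "cr u a" "cr u b" "u \<in> V2" "\<pi> u \<noteq> 0" for u a b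
  proof -
    have "\<exists>w. adj u w \<and> \<pi> w = \<pi> u"
    proof (cases "\<pi> u = 1")
      case True
      then have "adj u y" using p1[of u] u(3) B(3) adj_sym by metis
      then show ?thesis using py True by metis
    next
      case False
      then have "\<pi> u = 2" using p012[of u] u(4) by metis
      moreover then have "adj u z" using p2[of u] u(3) B(4) adj_sym by metis
      ultimately show ?thesis using pz by metis
    qed
    then obtain w where "adj u w" "\<pi> w = \<pi> u" by blast
    then show ?thesis using V2_third[OF u(3), of w a b] u(1,2) unfolding cr_def by metis
  qed
  have nz: "u = y \<or> u = z \<or> u \<in> V2" if "\<pi> u \<noteq> 0" for u using that p1 p2 p012 by metis
  show False
  proof (rule parts_False[of y z \<pi> cr \<rho> Q])
    show "y \<in> V" "z \<in> V" "\<pi> y \<noteq> \<pi> z" using B V_split py pz by auto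
    show "cr u v \<longleftrightarrow> adj u v \<and> \<pi> u \<noteq> \<pi> v" for u v unfolding cr_def ..
    show "\<rho> {u, v} < 0" for u v unfolding \<rho>_def by auto
    show "\<pi> a \<in> Q u a" if "cr u a" for u a using that py pz p012[of a] unfolding Q_def by auto
    show "\<pi> u \<notin> Q u a" if "cr u a" for u a using that unfolding Q_def cr_def by auto
    show "Q u a \<inter> Q u b = {}" if "cr u a" "cr u b" "a \<noteq> b" for u a b
    proof (cases "\<pi> u = 0")
      case True
      then show ?thesis using out[OF that True] that B unfolding Q_def cr_def by auto
    next
      case False
      then have "u \<in> {y, z}" using in_V2[OF that(1,2)] nz that(3) by blast
      moreover then have "u \<notin> V2" using B by auto
      moreover have "\<not> (\<pi> a = 0 \<and> \<pi> b = 0)" "\<not> (\<pi> a \<noteq> 0 \<and> \<pi> b \<noteq> 0)"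
        using that False in_y in_z mid[of u a] mid[of u b] calculation(1) by (auto simp: doubleton_eq_iff)
      ultimately show ?thesis using False unfolding Q_def by auto
    qed
    show "Q a b \<subseteq> Q u a" if "cr u a" "cr a b" "b \<noteq> u" "\<rho> {u, a} \<le> \<rho> {a, b}" for u a b
    proof (cases "\<pi> a = 0")
      case True
      have "cr a u" using crs that(1) by blast
      moreover have "\<pi> u \<noteq> 0" "\<pi> b \<noteq> 0" using that(1,2) True unfolding cr_def by auto
      moreover have "u \<in> V2 \<and> b \<in> V2 \<and> \<pi> u \<noteq> \<pi> b" using out[OF \<open>cr a u\<close> that(2) that(3)[symmetric] True] .
      ultimately show ?thesis using True B(3,4) p012[of u] p012[of b] unfolding Q_def by auto
    next
      case a0: False
      have au: "cr a u" using that(1) crs by blast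
      have ayz: "a \<in> {y, z}" using in_V2[OF au that(2)] nz a0 that(3) by blast
      show ?thesis
      proof (cases "\<pi> u = 0")
        case True
        then have "\<pi> b \<noteq> 0" using in_y[of u b] in_z[of u b] au that ayz by blast
        then show ?thesis using True ayz a0 p012[of b] unfolding Q_def by auto
      next
        case False
        then have "{u, a} = {y, z}" using mid that(1) a0 by blast
        moreover then have "{a, b} \<noteq> {y, z}" using that(3) by (metis doubleton_eq_iff)
        ultimately show ?thesis using that(4) unfolding \<rho>_def by simp
      qed
    qed
  qed
qed

end

section \<open>Tokens\<close>

text \<open>Paths into a token are examined backwards from their end, where every earlier label
  bounds the later ones from below.\<close>

lemma nondec_last3:
  assumes "nondec E \<phi> X (q @ [a, b, c])"
  shows "{a, b} \<in> E" "{b, c} \<in> E" "\<phi> {a, b} \<le> \<phi> {b, c}" "a \<noteq> b" "b \<noteq> c" "a \<noteq> c" "a \<in> X" "b \<in> X" "c \<in> X"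
    "nondec E \<phi> X (q @ [a, b])"
proof -
  have *: "nondec E \<phi> X [a, b, c]" using nondec_appendD(2)[of E \<phi> X q a "[b, c]"] assms by simp
  then show "{a, b} \<in> E" "{b, c} \<in> E" "\<phi> {a, b} \<le> \<phi> {b, c}" "a \<noteq> b" "b \<noteq> c" "a \<noteq> c" "a \<in> X" "b \<in> X" "c \<in> X"
    unfolding nondec_def by auto
  show "nondec E \<phi> X (q @ [a, b])" using nondec_appendD(1)[of E \<phi> X "q @ [a]" b "[c]"] assms by simp
qed

context bad_graph
begin

text \<open>Vertices of \<open>Z\<close> whose two neighbours outside \<open>A\<close> are separated by the cut form parts of their own;
  the remaining vertices of \<open>A\<close> are then added as ears whose two labels are extreme.\<close>

lemma token_False:
  fixes r :: "'a \<Rightarrow> nat"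
  assumes A: "A \<subseteq> V2" and st: "s \<in> S" "s \<in> V - A" "t \<notin> S" "t \<in> V - A"
    and match: "\<And>u a b. u \<in> V - A \<Longrightarrow> a \<in> V - A \<Longrightarrow> b \<in> V - A \<Longrightarrow> adj u a \<Longrightarrow> adj u b \<Longrightarrow>
      (a \<in> S) \<noteq> (u \<in> S) \<Longrightarrow> (b \<in> S) \<noteq> (u \<in> S) \<Longrightarrow> a = b"
    and Z: "Z \<subseteq> D" and zz: "\<And>z c. z \<in> Z \<Longrightarrow> c \<in> V2 \<Longrightarrow> adj z c \<Longrightarrow> c \<in> A"
    and ends: "\<And>a. a \<in> A \<Longrightarrow> \<exists>z x. N a = {z, x} \<and> z \<in> Z \<and> x \<notin> Z"
    and order: "\<And>z z' a x w. z \<in> Z \<Longrightarrow> z' \<in> Z \<Longrightarrow> z \<noteq> z' \<Longrightarrow> a \<in> A \<Longrightarrow> adj a z \<Longrightarrow> adj a x \<Longrightarrow> x \<noteq> z \<Longrightarrow>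
      adj x z' \<Longrightarrow> adj w z \<Longrightarrow> adj w z' \<Longrightarrow> r z < r z'"
  shows False
proof -
  have ZB: "z \<in> B" "z \<in> V" "z \<notin> V2" "z \<notin> A" "d0 z = 2" if "z \<in> Z" for z
    using that Z A V_split unfolding D_def by auto
  obtain zt xt where zx: "\<And>a. a \<in> A \<Longrightarrow> N a = {zt a, xt a} \<and> zt a \<in> Z \<and> xt a \<notin> Z"
    using ends by metis
  have zxa: "adj a (zt a)" "adj a (xt a)" "zt a \<noteq> xt a" "adj a v \<Longrightarrow> v = zt a \<or> v = xt a"
    "zt a \<in> B" "xt a \<in> B" "xt a \<notin> A" "zt a \<notin> A" "zt a \<in> Z" "xt a \<notin> Z" if a: "a \<in> A" for a v
  proof -
    note * = zx[OF a]
    show 1: "adj a (zt a)" "adj a (xt a)" using * N_iff[of _ a] by blast+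
    show "zt a \<noteq> xt a" "zt a \<in> Z" "xt a \<notin> Z" using * by auto
    show "v = zt a \<or> v = xt a" if "adj a v" using * that N_iff[of v a] by blast
    show "zt a \<in> B" "xt a \<in> B" using V2_B[of a] 1 a A by blast+
    then show "xt a \<notin> A" "zt a \<notin> A" using A V_split(2) by blast+
  qed
  have ZN: "c \<in> B \<and> c \<notin> D \<and> c \<notin> Z" if "z \<in> Z" "adj z c" "c \<notin> A" for z c
    using zz[OF that(1) _ that(2)] that adj_V[OF that(2)] D_indep[of z c] Z V_split unfolding B_def by blast
  \<comment> \<open>Of the two neighbours of such a token in \<open>B\<close> one lies across the
    cut and, the cut being a matching, the other does not. The token will be a part of its own, so
    both of these edges cross between parts.\<close>
  define Zl where "Zl = {z \<in> Z. \<exists>w. adj z w \<and> w \<notin> A \<and> (w \<in> S) \<noteq> (z \<in> S)}"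
  have ZlZ: "Zl \<subseteq> Z" unfolding Zl_def by blast
  define side where "side v = (if v \<in> A then zt v \<in> S else v \<in> S)" for v
  \<comment> \<open>The other vertices of \<open>A\<close> have both ends on one side and no end in
    \<open>Zl\<close>, so they stay in the part of their ends. Those in \<open>A'\<close> become
    ears.\<close>
  define A' where "A' = {a \<in> A. zt a \<in> Zl \<or> (zt a \<in> S) \<noteq> (xt a \<in> S)}"
  define X where "X = V - A'"
  define \<pi> where "\<pi> v = (if v \<in> Zl then (Some v, False) else (None, side v))" for v
  have pZ: "\<pi> v = (Some v, False)" if "v \<in> Zl" for v using that unfolding \<pi>_def by simp
  have pN: "\<pi> v = (None, v \<in> S)" if "v \<notin> Zl" "v \<notin> A" for v using that unfolding \<pi>_def side_def by simp
  define cr where "cr u v \<longleftrightarrow> u \<in> X \<and> v \<in> X \<and> adj u v \<and> \<pi> u \<noteq> \<pi> v" for u v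
  have crs: "cr u v \<Longrightarrow> cr v u" for u v unfolding cr_def using adj_sym[of u v] by auto
  have crA1: "u \<notin> A" if c: "cr u v" for u v
  proof
    assume u: "u \<in> A"
    then have "u \<notin> A'" using c unfolding cr_def X_def by blast
    then have 1: "zt u \<notin> Zl" "(zt u \<in> S) = (xt u \<in> S)" using u unfolding A'_def by auto
    have "u \<notin> Zl" using u ZlZ ZB(4) by blast
    then have pu: "\<pi> u = (None, zt u \<in> S)" using u unfolding \<pi>_def side_def by simp
    have "xt u \<notin> Zl" using zxa(10)[OF u] ZlZ by blast
    then have "\<pi> (zt u) = \<pi> u" "\<pi> (xt u) = \<pi> u" using pN 1 zxa(7,8)[OF u] pu by auto
    moreover have "v = zt u \<or> v = xt u" using zxa(4)[OF u] c unfolding cr_def by blast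
    ultimately show False using c unfolding cr_def by auto
  qed
  have crA: "u \<notin> A" "v \<notin> A" "u \<in> V - A" "v \<in> V - A" "adj u v" "\<pi> u \<noteq> \<pi> v" if "cr u v" for u v
    using crA1[OF that] crA1[OF crs[OF that]] that unfolding cr_def X_def by auto
  have m1: "a = b" if "cr u a" "cr u b" "(a \<in> S) \<noteq> (u \<in> S)" "(b \<in> S) \<noteq> (u \<in> S)" for u a b
    using match[of u a b] crA[OF that(1)] crA[OF that(2)] that by blast
  have Zl2: "v \<notin> Zl" if "cr u v" "u \<in> Zl" for u v
    using ZN[of u v] crA[OF that(1)] that(2) ZlZ by blast
  have same: "u \<in> Zl \<or> v \<in> Zl" if "cr u v" "(u \<in> S) = (v \<in> S)" for u v
  proof (rule ccontr)
    assume "\<not> ?thesis"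
    then have "\<pi> u = (None, u \<in> S)" "\<pi> v = (None, v \<in> S)" using pN crA(1,2)[OF that(1)] by auto
    then show False using crA(6)[OF that(1)] that(2) by simp
  qed
  have m2: "a = b" if z: "z \<in> Zl" and c: "cr z a" "cr z b" "(a \<in> S) = (z \<in> S)" "(b \<in> S) = (z \<in> S)" for z a b
  proof (rule ccontr)
    assume ab: "a \<noteq> b"
    have zZ: "z \<in> Z" using z ZlZ by blast
    obtain w where w: "adj z w" "w \<notin> A" "(w \<in> S) \<noteq> (z \<in> S)" using z unfolding Zl_def by blast
    have "a \<in> B" "b \<in> B" "w \<in> B" using ZN[OF zZ] crA[OF c(1)] crA[OF c(2)] w by auto
    moreover have "w \<noteq> a" "w \<noteq> b" using w c by auto
    ultimately have "card {w, a, b} \<le> d0 z" unfolding d0_def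
      using w crA(5)[OF c(1)] crA(5)[OF c(2)] by (intro card_mono) (auto simp: N_iff finite_N)
    then show False using ab \<open>w \<noteq> a\<close> \<open>w \<noteq> b\<close> ZB(5)[OF zZ] by simp
  qed
  \<comment> \<open>These are the labels of the same-side edges at tokens in \<open>Zl\<close>:
    above the label -1 of the cut edges, below 0, and increasing with the rank.\<close>
  define low where "low z = - inverse (2 + real (r z))" for z
  have low: "-1 < low z" "low z < 0" "low z \<le> low z' \<longleftrightarrow> r z \<le> r z'" for z z'
    unfolding low_def by (auto simp: field_simps)
  define \<rho> where "\<rho> e = (if \<exists>z w. e = {z, w} \<and> z \<in> Zl \<and> w \<notin> Zl \<and> (z \<in> S) = (w \<in> S)
     then low (SOME z. z \<in> e \<and> z \<in> Zl) else - 1)" for e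
  have r2: "\<rho> {z, w} = low z" "\<rho> {w, z} = low z" if "z \<in> Zl" "w \<notin> Zl" "(z \<in> S) = (w \<in> S)" for z w
  proof -
    have "(SOME z'. z' \<in> {z, w} \<and> z' \<in> Zl) = z" using that by (intro some_equality) auto
    then show "\<rho> {z, w} = low z" using that unfolding \<rho>_def by auto
    then show "\<rho> {w, z} = low z" by (simp add: insert_commute)
  qed
  have r1: "\<rho> {u, v} = - 1" if "(u \<in> S) \<noteq> (v \<in> S)" for u v
    using that unfolding \<rho>_def by (auto simp: doubleton_eq_iff)
  have rneg: "\<rho> e < 0" for e unfolding \<rho>_def using low by auto
  have rle: "(u \<in> S) \<noteq> (v \<in> S)" if "cr u v" "\<rho> {u, v} \<le> - 1" for u v
  proof
    assume sm: "(u \<in> S) = (v \<in> S)"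
    then have "u \<in> Zl \<or> v \<in> Zl" using same that by blast
    then have "\<rho> {u, v} = low u \<or> \<rho> {u, v} = low v"
      using r2[of u v] r2[of v u] sm Zl2[OF that(1)] Zl2[OF crs[OF that(1)]] by blast
    then show False using low(1) that(2) by (metis less_le_not_le)
  qed
  define P where "P b = (\<lambda>z. (Some z, False)) ` {z \<in> Zl. (z \<in> S) = b}" for b
  have Pi1: "(Some z, c) \<in> P b \<longleftrightarrow> c = False \<and> z \<in> Zl \<and> (z \<in> S) = b" for z b c unfolding P_def by auto
  have Pi2: "(None, c) \<notin> P b" for b c unfolding P_def by auto
  \<comment> \<open>After a cut edge a path may end in the main part of the new side or in any token
    of that side. Entering a token along a same-side edge ends there, since the remaining crossing
    edge has the lower label -1. Leaving a token along a same-side edge leads to the main part and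
    possibly on into another token.\<close>
  define Q where "Q u a = (if (u \<in> S) \<noteq> (a \<in> S) then {(None, u \<notin> S)} \<union> P (u \<notin> S)
     else if a \<in> Zl then {(Some a, False)} else insert (None, u \<in> S) (P (u \<in> S)) - {(Some u, False)})" for u a
  have Q1: "\<pi> a \<in> Q u a" if c: "cr u a" for u a
    using pZ[of a] pN[of a] crA(2)[OF c] Pi1 unfolding Q_def by (cases "a \<in> Zl") auto
  have Q3: "\<pi> u \<notin> Q u a" if c: "cr u a" for u a
  proof (cases "u \<in> Zl")
    case True
    then show ?thesis using pZ[OF True] Zl2[OF c True] Pi1 unfolding Q_def by auto
  next
    case False
    then have "a \<in> Zl" if "(u \<in> S) = (a \<in> S)" using same[OF c that] by blast
    then show ?thesis using pN[OF False crA(1)[OF c]] Pi2 unfolding Q_def by auto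
  qed
  have Q4: "Q u a \<inter> Q u b = {}" if c: "cr u a" "cr u b" "a \<noteq> b" for u a b
  proof -
    have one: "Q u a \<inter> Q u b = {}" if c: "cr u a" "cr u b" "a \<noteq> b" "(u \<in> S) \<noteq> (a \<in> S)" for a b
    proof -
      have "(u \<in> S) = (b \<in> S)" using m1[OF c(1,2)] c by blast
      moreover have "Pair None (u \<notin> S) \<notin> P (u \<in> S)" using Pi2 by blast
      moreover have "P (u \<in> S) \<inter> P (u \<notin> S) = {}" unfolding P_def by auto
      ultimately show ?thesis using c(4) Pi1 Pi2 unfolding Q_def by auto
    qed
    consider "(u \<in> S) \<noteq> (a \<in> S)" | "(u \<in> S) \<noteq> (b \<in> S)" | "(u \<in> S) = (a \<in> S)" "(u \<in> S) = (b \<in> S)" by blast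
    then show ?thesis
    proof cases
      case 1
      then show ?thesis using one[OF c] by blast
    next
      case 2
      then show ?thesis using one[OF c(2,1)] c(3) by blast
    next
      case 3
      have "u \<notin> Zl" using m2[OF _ c(1,2)] 3 c(3) by blast
      then have "a \<in> Zl" "b \<in> Zl" using same[OF c(1)] same[OF c(2)] 3 by blast+
      then show ?thesis using 3 c(3) unfolding Q_def by auto
    qed
  qed
  have Q2: "Q a b \<subseteq> Q u a" if c: "cr u a" "cr a b" "b \<noteq> u" and le: "\<rho> {u, a} \<le> \<rho> {a, b}" for u a b
  proof (cases "(u \<in> S) = (a \<in> S)")
    case False
    then have ab: "(a \<in> S) = (b \<in> S)" using m1[OF crs[OF c(1)] c(2)] c(3) by blast
    show ?thesis
    proof (cases "b \<in> Zl")
      case True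
      then show ?thesis using False ab Pi1 unfolding Q_def by auto
    next
      case bZ: False
      have "(u \<notin> S) = (a \<in> S)" using False by blast
      then show ?thesis using False ab bZ unfolding Q_def by auto
    qed
  next
    case True
    have sab: "(a \<in> S) = (b \<in> S)"
    proof (rule ccontr)
      assume "\<not> ?thesis"
      then have "\<rho> {u, a} \<le> - 1" using r1[of a b] le by simp
      then show False using rle[OF c(1)] True by blast
    qed
    have aZ: "a \<notin> Zl" using m2[OF _ crs[OF c(1)] c(2)] True sab c(3) by blast
    have uZ: "u \<in> Zl" and bZ: "b \<in> Zl" using same[OF c(1) True] same[OF c(2) sab] aZ by blast+
    have "Q a b = {(Some b, False)}" using sab bZ unfolding Q_def by simp
    moreover have "(Some b, False) \<in> P (u \<in> S)" using Pi1 bZ True sab by simp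
    moreover have "Q u a = insert (None, u \<in> S) (P (u \<in> S)) - {(Some u, False)}" using True aZ unfolding Q_def by simp
    ultimately show ?thesis using c(3) by simp
  qed
  have edges: "e \<noteq> {}" if "e \<in> E" for e using edge_card[OF that] by auto
  have part: "\<exists>\<psi>. good_on E \<psi> {v \<in> X. \<pi> v = c}" for c
  proof (rule sub_good)
    have "s \<in> X" "t \<in> X" using st unfolding X_def A'_def by auto
    moreover have "\<pi> s \<noteq> \<pi> t"
    proof -
      have "s \<noteq> t" using st by auto
      then show ?thesis using pZ[of s] pZ[of t] pN[of s] pN[of t] st by (cases "s \<in> Zl"; cases "t \<in> Zl") auto
    qed
    ultimately have "\<not> (s \<in> {v \<in> X. \<pi> v = c} \<and> t \<in> {v \<in> X. \<pi> v = c})" by auto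
    then show "{v \<in> X. \<pi> v = c} \<subset> V" using st unfolding X_def by blast
  qed
  obtain \<Phi> where \<Phi>: "good_on E \<Phi> X" "\<And>u v. cr u v \<Longrightarrow> \<Phi> {u, v} = \<rho> {u, v}"
    "\<And>u v. u \<in> X \<Longrightarrow> v \<in> X \<Longrightarrow> adj u v \<Longrightarrow> \<not> cr u v \<Longrightarrow> \<Phi> {u, v} > 0"
    "\<And>u a q. nondec E \<Phi> X (u # a # q) \<Longrightarrow> \<not> cr u a \<Longrightarrow> \<pi> (last (a # q)) = \<pi> u"
  proof (rule good_on_parts[of E \<pi> X cr \<rho> Q, OF edges part cr_def rneg Q1 Q2 Q3 Q4])
    fix \<Phi>
    assume "good_on E \<Phi> X" "\<And>u v. cr u v \<Longrightarrow> \<Phi> {u, v} = \<rho> {u, v}"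
      "\<And>u v. u \<in> X \<Longrightarrow> v \<in> X \<Longrightarrow> adj u v \<Longrightarrow> \<not> cr u v \<Longrightarrow> \<Phi> {u, v} > 0"
      "\<And>u a q. nondec E \<Phi> X (u # a # q) \<Longrightarrow> \<not> cr u a \<Longrightarrow> \<pi> (last (a # q)) = \<pi> u"
    then show thesis by (rule that)
  qed
  have neg_cr: "cr u v" if "u \<in> X" "v \<in> X" "adj u v" "\<Phi> {u, v} < 0" for u v
    using \<Phi>(3)[of u v] that by force
  \<comment> \<open>At a token in \<open>Zl\<close> the highest label of the ear is next to the
    token, at any other token the lowest. So what has to be excluded is a path from the far end into
    a token of \<open>Zl\<close>, or from another token to its far end.\<close>
  define lo where "lo a = (if zt a \<in> Zl then xt a else zt a)" for a
  define hi where "hi a = (if zt a \<in> Zl then zt a else xt a)" for a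
  have BX: "v \<in> X" if "v \<in> B" for v using that A V_split unfolding X_def A'_def by blast
  have A'A: "a \<in> A" if "a \<in> A'" for a using that unfolding A'_def by blast
  have "\<exists>\<Psi>. good_on E \<Psi> (X \<union> A')"
  proof (rule good_on_ears[of A' X lo hi E \<Phi>])
    show "finite A'" using finite_V2 A unfolding A'_def by (auto intro: finite_subset)
    show "A' \<inter> X = {}" unfolding X_def by blast
    show "lo a \<in> X \<and> hi a \<in> X \<and> lo a \<noteq> hi a" if "a \<in> A'" for a
      using zxa(3,5,6)[OF A'A[OF that]] BX unfolding lo_def hi_def by auto
    show "v = lo a \<or> v = hi a" if "a \<in> A'" "adj a v" for a v
      using zxa(4)[OF A'A[OF that(1)] that(2)] unfolding lo_def hi_def by auto
    show "(lo a, hi a) \<noteq> (lo a', hi a')" if aa: "a \<in> A'" "a' \<in> A'" "a \<noteq> a'" for a a'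
    proof
      assume "(lo a, hi a) = (lo a', hi a')"
      then have "{zt a, xt a} = {zt a', xt a'}" unfolding lo_def hi_def by (auto split: if_splits)
      then have "adj a' (zt a)" "adj a' (xt a)" using zxa(1,2)[OF A'A[OF aa(2)]] by (auto simp: doubleton_eq_iff)
      then show False using two_common[of a "zt a" "xt a" a'] zxa(1-3)[OF A'A[OF aa(1)]] aa(3) by blast
    qed
    show "good_on E \<Phi> X" by (rule \<Phi>(1))
    show False if aA': "a \<in> A'" and p: "nondec E \<Phi> X p" "hd p = lo a" "last p = hi a" for a p
    proof -
      have aA: "a \<in> A" using A'A aA' .
      note za = zxa[OF aA]
      define z where "z = zt a"
      define x where "x = xt a"
      have z: "adj a z" "adj a x" "z \<noteq> x" "z \<in> Z" "x \<notin> Z" "x \<notin> A" "z \<notin> A" "x \<notin> Zl"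
        using za ZlZ unfolding z_def x_def by auto
      have nxz: "\<not> adj x z" using no_tri z(1,2) adj_sym by metis
      show False
      \<comment> \<open>No crossing edge starts at a token outside \<open>Zl\<close>, so a path from
        it stays in its part, while \<open>x\<close> is across the cut. A path into a token of
        \<open>Zl\<close> ends with a crossing edge, hence has only negative labels and only
        crossing edges. A few steps backwards lead to two cut edges at one vertex, to a 4-cycle, or
        to a case excluded by \<open>order\<close>.\<close>
      proof (cases "z \<in> Zl")
        case False
        then have h: "hd p = z" "last p = x" using p unfolding lo_def hi_def z_def x_def by auto
        obtain c q where pq: "p = z # c # q"
          using p(1) h z(3) unfolding nondec_def by (cases p; cases "tl p") auto
        have zc: "adj z c" "c \<in> X" using p(1) unfolding pq nondec_def by auto
        have "\<not> cr z c"
        proof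
          assume c: "cr z c"
          have "(z \<in> S) = (c \<in> S)" using False z(4) crA(2)[OF c] zc(1) unfolding Zl_def by auto
          then have "c \<in> Zl" using same[OF c] False by blast
          then show False using ZN[OF z(4) zc(1) crA(2)[OF c]] ZlZ by blast
        qed
        then have "\<pi> x = \<pi> z" using \<Phi>(4)[of z c q] p(1) h(2) unfolding pq by simp
        then have "(x \<in> S) = (z \<in> S)" using pN[of x] pN[of z] z False by simp
        then show False using aA' False unfolding A'_def z_def x_def by auto
      next
        case True
        then have h: "hd p = x" "last p = z" using p unfolding lo_def hi_def z_def x_def by auto
        have pne: "p \<noteq> []" using p(1) unfolding nondec_def by blast
        obtain p1 where p1: "p = p1 @ [z]" using pne h(2) append_butlast_last_id by metis
        have "p1 \<noteq> []" using p1 h z(3) by auto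
        then obtain p2 y where p2: "p1 = p2 @ [y]" using rev_exhaust by blast
        have yz: "adj y z" "y \<in> X" "z \<in> X" "y \<noteq> z"
          using nondec_appendD(2)[of E \<Phi> X p2 y "[z]"] p(1) p1 p2 by (auto simp: nondec_def)
        have "\<pi> y \<noteq> \<pi> z" using pZ[OF True] yz(4) unfolding \<pi>_def by auto
        then have cyz: "cr y z" using yz unfolding cr_def by blast
        have "p2 \<noteq> []" using p1 p2 h nxz yz(1) by auto
        then obtain p3 y1 where p3: "p2 = p3 @ [y1]" using rev_exhaust by blast
        note t1 = nondec_last3[of E \<Phi> X p3 y1 y z]
        have t1': "nondec E \<Phi> X (p3 @ [y1, y, z])" using p(1) p1 p2 p3 by simp
        note t1 = t1[OF t1']
        have c1: "cr y1 y" using neg_cr[OF t1(7,8,1)] t1(3) \<Phi>(2)[OF cyz] rneg[of "{y, z}"] by simp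
        have le1: "\<rho> {y1, y} \<le> \<rho> {y, z}" using t1(3) \<Phi>(2)[OF cyz] \<Phi>(2)[OF c1] by simp
        have step: "\<exists>p4 y2. p3 = p4 @ [y2] \<and> cr y2 y1 \<and> \<rho> {y2, y1} \<le> \<rho> {y1, y} \<and> y2 \<noteq> y \<and> nondec E \<Phi> X (p4 @ [y2, y1])"
          if "y1 \<noteq> x"
        proof -
          have "p3 \<noteq> []" using p1 p2 p3 h that by auto
          then obtain p4 y2 where p4: "p3 = p4 @ [y2]" using rev_exhaust by blast
          have "nondec E \<Phi> X (p4 @ [y2, y1, y])" using t1(10) p4 by simp
          note t2 = nondec_last3[OF this]
          have c2: "cr y2 y1" using neg_cr[OF t2(7,8,1)] t2(3) \<Phi>(2)[OF c1] rneg[of "{y1, y}"] by simp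
          then show ?thesis using p4 t2 \<Phi>(2)[OF c2] \<Phi>(2)[OF c1] by auto
        qed
        show False
        proof (cases "(y \<in> S) = (z \<in> S)")
          case False
          then have "\<rho> {y1, y} \<le> - 1" using le1 r1[of y z] by simp
          then have "(y1 \<in> S) \<noteq> (y \<in> S)" using rle[OF c1] by blast
          then have "y1 = z" using m1[OF crs[OF c1] cyz] False by blast
          then show False using t1(6) by blast
        next
          case syz: True
          have yZ: "y \<notin> Zl" using Zl2[OF crs[OF cyz] True] .
          show False
          proof (cases "(y1 \<in> S) = (y \<in> S)")
            case False
            have "y1 \<noteq> x" using no_C4[of x y z a] t1(1) yz(1) z(1-3) nxz adj_sym adj_neq t1(4) yz zxa(8)[OF aA]
              by (metis crA(1) crs cyz aA)
            from step[OF this] obtain y2 where y2: "cr y2 y1" "\<rho> {y2, y1} \<le> \<rho> {y1, y}" "y2 \<noteq> y" by blast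
            then have "(y2 \<in> S) \<noteq> (y1 \<in> S)" using rle[OF y2(1)] r1[OF False] by simp
            then show False using m1[OF crs[OF y2(1)] c1] y2(3) False by blast
          next
            case same1: True
            then have y1Z: "y1 \<in> Zl" using same[OF c1] yZ by blast
            then have "y1 \<noteq> x" using z(8) by blast
            from step[OF this] obtain p4 y2 where y2: "p3 = p4 @ [y2]" "cr y2 y1" "\<rho> {y2, y1} \<le> \<rho> {y1, y}" "y2 \<noteq> y"
              "nondec E \<Phi> X (p4 @ [y2, y1])" by blast
            have d2: "(y2 \<in> S) \<noteq> (y1 \<in> S)" using m2[OF y1Z crs[OF y2(2)] c1] same1 y2(4) by blast
            show False
            proof (cases "y2 = x")
              case True
              \<comment> \<open>The tokens \<open>z\<close> and \<open>y1\<close> have the common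
                neighbour \<open>y\<close>, and \<open>x\<close> is adjacent to \<open>y1\<close>.
                The rank forces the label at \<open>y1\<close> above the one at \<open>z\<close>,
                but the path runs from \<open>y1\<close> to \<open>z\<close>.\<close>
              have "r z < r y1"
                by (rule order[of z y1 a x y])
                  (use z y1Z ZlZ t1 aA crA(5)[OF y2(2)] True adj_sym[of y y1] in auto)
              moreover have "low y1 \<le> low z"
                using le1 r2(1)[OF y1Z yZ same1] r2(2)[OF \<open>z \<in> Zl\<close> yZ] syz by simp
              ultimately show False using low(3) by simp
            next
              case False
              then have "p4 \<noteq> []" using p1 p2 p3 y2(1) h by auto
              then obtain p5 y3 where p5: "p4 = p5 @ [y3]" using rev_exhaust by blast
              have "nondec E \<Phi> X (p5 @ [y3, y2, y1])" using y2(5) p5 by simp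
              note t3 = nondec_last3[OF this]
              have c3: "cr y3 y2" using neg_cr[OF t3(7,8,1)] t3(3) \<Phi>(2)[OF y2(2)] rneg[of "{y2, y1}"] by simp
              have "\<rho> {y3, y2} \<le> - 1" using t3(3) \<Phi>(2)[OF y2(2)] \<Phi>(2)[OF c3] r1[OF d2] by simp
              then have "(y3 \<in> S) \<noteq> (y2 \<in> S)" using rle[OF c3] by blast
              then have "y3 = y1" using m1[OF crs[OF c3] y2(2)] d2 by blast
              then show False using t3(6) by blast
            qed
          qed
        qed
      qed
    qed
  qed
  moreover have "X \<union> A' = V" using A V_split unfolding X_def A'_def by blast
  ultimately show False using not_good by auto
qed

text \<open>An edge between two vertices of \<open>B\<close> weighs 2 and a path through a vertex of degree 2 weighs 1, so
  that a cut of \<open>B\<close> with loads at most 1 extends to a matching cut.\<close>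

definition mult :: "'a set \<Rightarrow> 'a \<Rightarrow> 'a \<Rightarrow> nat" where
  "mult A u v = (if u = v then 0 else if adj u v then 2 else if \<exists>c\<in>V2 - A. adj u c \<and> adj c v then 1 else 0)"

lemma mult_sym: "mult A u v = mult A v u"
proof -
  have "(\<exists>c\<in>V2 - A. adj u c \<and> adj c v) \<longleftrightarrow> (\<exists>c\<in>V2 - A. adj v c \<and> adj c u)" using adj_sym by metis
  then show ?thesis unfolding mult_def using adj_sym[of u v] by simp
qed

text \<open>Vertices of degree 2 follow a neighbour, so that the cut edge at such a vertex is incident with
  the neighbour that carries the load.\<close>

lemma load_cut_matching:
  assumes B': "B' \<subseteq> B" and U: "U \<subseteq> V2 - A" and UN: "\<And>c p. c \<in> U \<Longrightarrow> adj c p \<Longrightarrow> p \<in> B'"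
    and cut: "load_cut B' (mult A) S0 l"
  obtains S where "\<And>x. x \<in> B' \<Longrightarrow> x \<in> S \<longleftrightarrow> x \<in> S0" "S \<subseteq> B' \<union> U"
    "\<And>u a b. u \<in> B' \<union> U \<Longrightarrow> a \<in> B' \<union> U \<Longrightarrow> b \<in> B' \<union> U \<Longrightarrow> adj u a \<Longrightarrow> adj u b \<Longrightarrow>
      (a \<in> S) \<noteq> (u \<in> S) \<Longrightarrow> (b \<in> S) \<noteq> (u \<in> S) \<Longrightarrow> a = b"
proof -
  have fB: "finite B'" using B' finite_B finite_subset by blast
  have UV2: "c \<in> V2" if "c \<in> U" for c using U that by blast
  have dis: "B' \<inter> U = {}" using B' U V_split by blast
  have S0: "S0 \<subseteq> B'"
    and lsum: "\<And>u v. u \<in> B' \<Longrightarrow> v \<in> B' \<Longrightarrow> (u \<in> S0) \<noteq> (v \<in> S0) \<Longrightarrow> l u v + l v u = mult A u v"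
    and l1: "\<And>u. u \<in> B' \<Longrightarrow> sum (l u) B' \<le> 1"
    using cut unfolding load_cut_def by auto
  have lle: "l u v \<le> 1" if "u \<in> B'" "v \<in> B'" for u v
    using member_le_sum[of v B' "l u"] l1[OF that(1)] that fB by simp
  have l2: "x = y" if "u \<in> B'" "x \<in> B'" "y \<in> B'" "l u x \<ge> 1" "l u y \<ge> 1" for u x y
  proof (rule ccontr)
    assume "x \<noteq> y"
    then have "l u x + l u y = sum (l u) {x, y}" by simp
    also have "\<dots> \<le> sum (l u) B'" using that fB by (intro sum_mono2) auto
    finally show False using l1[OF that(1)] that by simp
  qed
  define S where "S = S0 \<union> {c \<in> U. \<exists>p q. p \<noteq> q \<and> adj c p \<and> adj c q \<and> q \<in> S0 \<and> (p \<in> S0 \<or> l p q = 1)}"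
  have SB: "x \<in> S \<longleftrightarrow> x \<in> S0" if "x \<in> B'" for x using that dis S0 unfolding S_def by auto
  have SV2: "c \<in> S \<longleftrightarrow> (\<exists>p q. p \<noteq> q \<and> adj c p \<and> adj c q \<and> q \<in> S0 \<and> (p \<in> S0 \<or> l p q = 1))" if "c \<in> U" for c
    using that dis S0 unfolding S_def by auto
  \<comment> \<open>An edge inside \<open>B\<close> weighs 2 and no load exceeds 1, so both ends of
    a cut edge carry load 1.\<close>
  have crossB: "l p x \<ge> 1" if "p \<in> B'" "x \<in> B'" "adj p x" "(x \<in> S) \<noteq> (p \<in> S)" for p x
  proof -
    have "l p x + l x p = 2" using lsum[of p x] that SB adj_neq[of p x] unfolding mult_def by auto
    then show ?thesis using lle[OF that(2,1)] by simp
  qed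
  have crossV2: "l p q \<ge> 1" if "p \<in> B'" "c \<in> U" "adj c p" "adj c q" "p \<noteq> q" "(c \<in> S) \<noteq> (p \<in> S)" for p q c
  proof -
    have q: "q \<in> B'" using UN[of c q] that by blast
    have nb: "x = p \<or> x = q" if "adj c x" for x
      using V2_third[OF UV2, of c p q x] that \<open>c \<in> U\<close> \<open>adj c p\<close> \<open>adj c q\<close> \<open>p \<noteq> q\<close> by blast
    have npq: "\<not> adj p q" using no_tri[of c p q] that by blast
    have sm: "(p \<in> S0) \<noteq> (q \<in> S0) \<Longrightarrow> l p q + l q p = 1"
    proof -
      assume d: "(p \<in> S0) \<noteq> (q \<in> S0)"
      have "adj p c" using that(3) adj_sym by metis
      then have "mult A p q = 1" unfolding mult_def using npq that U by auto
      then show "l p q + l q p = 1" using lsum[OF that(1) q d] by simp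
    qed
    show ?thesis
    proof (cases "p \<in> S0")
      case True
      then have cS: "c \<notin> S" using that SB by blast
      have "q \<notin> S0 \<and> l q p \<noteq> 1"
      proof (rule ccontr)
        assume "\<not> ?thesis"
        then have "q \<noteq> p \<and> adj c q \<and> adj c p \<and> p \<in> S0 \<and> (q \<in> S0 \<or> l q p = 1)" using that(3-5) True by auto
        then show False using SV2[OF that(2)] cS by blast
      qed
      then show ?thesis using sm True by auto
    next
      case False
      then have "c \<in> S" using that SB by blast
      then obtain p' q' where "p' \<noteq> q'" "adj c p'" "adj c q'" "q' \<in> S0" "p' \<in> S0 \<or> l p' q' = 1"
        using SV2[OF \<open>c \<in> U\<close>] by blast
      moreover then have "q' = q" "p' = p" using nb[of p'] nb[of q'] False by blast+
      ultimately show ?thesis using False by simp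
    qed
  qed
  show thesis
  proof (rule that[of S])
    show "x \<in> S \<longleftrightarrow> x \<in> S0" if "x \<in> B'" for x using SB[OF that] .
    show "S \<subseteq> B' \<union> U" using S0 unfolding S_def by blast
    fix u a b assume u: "u \<in> B' \<union> U" "a \<in> B' \<union> U" "b \<in> B' \<union> U" "adj u a" "adj u b"
      "(a \<in> S) \<noteq> (u \<in> S)" "(b \<in> S) \<noteq> (u \<in> S)"
    show "a = b"
    proof (cases "u \<in> B'")
      case True
      have cr: "\<exists>q. q \<in> B' \<and> l u q \<ge> 1 \<and> (x = q \<and> x \<in> B' \<or> x \<in> V2 \<and> adj x q \<and> q \<noteq> u)"
        if x: "x \<in> B' \<union> U" "adj u x" "(x \<in> S) \<noteq> (u \<in> S)" for x
      proof (cases "x \<in> B'")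
        case True
        then show ?thesis using crossB[OF \<open>u \<in> B'\<close> True x(2,3)] by blast
      next
        case False
        then have xU: "x \<in> U" using x(1) by blast
        have xu: "adj x u" using x(2) adj_sym by metis
        then obtain q where q: "q \<noteq> u" "adj x q" using V2_N[OF UV2[OF xU]] by blast
        then have "l u q \<ge> 1" using crossV2[OF \<open>u \<in> B'\<close> xU xu q(2)] x by blast
        then show ?thesis using q xU UV2 UN by blast
      qed
      obtain qa where qa: "qa \<in> B'" "l u qa \<ge> 1" "a = qa \<and> a \<in> B' \<or> a \<in> V2 \<and> adj a qa \<and> qa \<noteq> u"
        using cr[OF u(2,4,6)] by blast
      obtain qb where qb: "qb \<in> B'" "l u qb \<ge> 1" "b = qb \<and> b \<in> B' \<or> b \<in> V2 \<and> adj b qb \<and> qb \<noteq> u"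
        using cr[OF u(3,5,7)] by blast
      \<comment> \<open>Every cut edge at \<open>u\<close> uses the load of \<open>u\<close> towards
        some \<open>q\<close>, and there is room for only one \<open>q\<close>. Two cut edges
        belonging to the same \<open>q\<close> would close a triangle or a 4-cycle.\<close>
      have "qa = qb" using l2[OF True qa(1) qb(1) qa(2) qb(2)] .
      moreover have "adj a u" "adj b u" using u(4,5) adj_sym by metis+
      ultimately show ?thesis using qa(3) qb(3) no_tri[OF u(4,5)] two_common[of u a b qa] u(4,5) adj_sym by metis
    next
      case False
      then have uU: "u \<in> U" using u(1) by blast
      show ?thesis
      proof (rule ccontr)
        assume ab: "a \<noteq> b"
        have B: "a \<in> B'" "b \<in> B'" using uU u UN by blast+
        have nb: "x = a \<or> x = b" if "adj u x" for x using V2_third[OF UV2[OF uU] u(4,5) ab that] .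
        show False
        proof (cases "a \<in> S")
          case True
          then have "b \<in> S0" "a \<in> S0" "u \<notin> S" using u SB B by auto
          then show False using SV2[OF uU] u(4,5) ab by blast
        next
          case False
          then have "b \<notin> S0" "a \<notin> S0" "u \<in> S" using u SB B by auto
          then show False using SV2[OF uU] nb by blast
        qed
      qed
    qed
  qed
qed

text \<open>A load cut that ignores the vertices of \<open>A\<close> gives a matching cut of
  \<open>V - A\<close>, and the tokens in \<open>Z\<close> allow \<open>A\<close> to be
  reinserted.\<close>

lemma load_cut_False:
  fixes r :: "'a \<Rightarrow> nat"
  assumes A: "A \<subseteq> V2" and cut: "load_cut B (mult A) S0 l"
    and Z: "Z \<subseteq> D" and zz: "\<And>z c. z \<in> Z \<Longrightarrow> c \<in> V2 \<Longrightarrow> adj z c \<Longrightarrow> c \<in> A"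
    and ends: "\<And>a. a \<in> A \<Longrightarrow> \<exists>z x. N a = {z, x} \<and> z \<in> Z \<and> x \<notin> Z"
    and order: "\<And>z z' a x w. z \<in> Z \<Longrightarrow> z' \<in> Z \<Longrightarrow> z \<noteq> z' \<Longrightarrow> a \<in> A \<Longrightarrow> adj a z \<Longrightarrow> adj a x \<Longrightarrow> x \<noteq> z \<Longrightarrow>
      adj x z' \<Longrightarrow> adj w z \<Longrightarrow> adj w z' \<Longrightarrow> r z < r z'"
  shows False
proof (rule load_cut_matching[OF subset_refl subset_refl V2_B cut])
  show "c \<in> V2" if "c \<in> V2 - A" for c using that by blast
  fix S assume SB: "\<And>x. x \<in> B \<Longrightarrow> x \<in> S \<longleftrightarrow> x \<in> S0"
    and match: "\<And>u a b. u \<in> B \<union> (V2 - A) \<Longrightarrow> a \<in> B \<union> (V2 - A) \<Longrightarrow> b \<in> B \<union> (V2 - A) \<Longrightarrow> adj u a \<Longrightarrow> adj u b \<Longrightarrow>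
      (a \<in> S) \<noteq> (u \<in> S) \<Longrightarrow> (b \<in> S) \<noteq> (u \<in> S) \<Longrightarrow> a = b"
  have VA: "V - A = B \<union> (V2 - A)" using V_split A by blast
  have "S0 \<subseteq> B" "S0 \<noteq> {}" "S0 \<noteq> B" using cut unfolding load_cut_def by auto
  then obtain s t where st: "s \<in> S0" "s \<in> B" "t \<in> B" "t \<notin> S0" by blast
  show False
  proof (rule token_False[OF A _ _ _ _ _ Z zz ends, where r = r])
    show "s \<in> S" "s \<in> V - A" "t \<notin> S" "t \<in> V - A" unfolding VA using st SB by blast+
    show "a = b" if "u \<in> V - A" "a \<in> V - A" "b \<in> V - A" "adj u a" "adj u b"
      "(a \<in> S) \<noteq> (u \<in> S)" "(b \<in> S) \<noteq> (u \<in> S)" for u a b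
      using match[OF that[unfolded VA]] .
    show "r z < r z'" if "z \<in> Z" "z' \<in> Z" "z \<noteq> z'" "a \<in> A" "adj a z" "adj a x" "x \<noteq> z" "adj x z'" "adj w z" "adj w z'" for z z' a x w
      using order[OF that] .
  qed auto
qed

text \<open>Each neighbour of degree 2 outside \<open>A\<close> leads on to one vertex of
  \<open>B\<close>. Without 4-cycles different ones lead to different vertices, and without
  triangles none leads to a neighbour of \<open>x\<close>, so no two weights overlap.\<close>

lemma sum_mult_row:
  assumes x: "x \<in> B"
  shows "(\<Sum>y\<in>B. mult A x y) = 2 * d0 x + card (N x \<inter> (V2 - A))"
proof -
  define O' where "O' = {y \<in> B. y \<noteq> x \<and> (\<exists>c\<in>V2 - A. adj x c \<and> adj c y)}"
  have nadj: "\<not> adj x y" if "y \<in> O'" for y using that no_tri unfolding O'_def by blast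
  have "(\<Sum>y\<in>B. mult A x y) = (\<Sum>y\<in>B. (if y \<in> N x then 2 else 0) + (if y \<in> O' then 1 else 0))"
  proof (rule sum.cong[OF refl])
    fix y assume "y \<in> B"
    then show "mult A x y = (if y \<in> N x then 2 else 0) + (if y \<in> O' then 1 else 0)"
      using nadj[of y] adj_irrefl[of x] unfolding mult_def N_iff by (auto simp: O'_def)
  qed
  also have "\<dots> = (\<Sum>y\<in>B. if y \<in> N x then 2 else 0) + (\<Sum>y\<in>B. if y \<in> O' then 1 else 0)"
    by (simp add: sum.distrib)
  also have "(\<Sum>y\<in>B. if y \<in> N x then 2 else 0) = 2 * d0 x"
    using finite_B by (simp add: sum.If_cases d0_def Int_commute)
  also have "(\<Sum>y\<in>B. if y \<in> O' then 1 else 0) = card O'"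
    using finite_B by (simp add: sum.If_cases) (rule arg_cong[of _ _ card], auto simp: O'_def)
  also have "card O' = card (N x \<inter> (V2 - A))"
  proof (rule sym, rule bij_betw_same_card)
    define f where "f c = (THE q. adj c q \<and> q \<noteq> x)" for c
    have f: "adj c (f c) \<and> f c \<noteq> x" if c: "c \<in> V2" "adj x c" for c
    proof -
      have cx: "adj c x" using c adj_sym by metis
      then obtain q where "q \<noteq> x" "adj c q" using V2_N[OF c(1)] by blast
      then have "\<exists>!q. adj c q \<and> q \<noteq> x" using V2_third[OF c(1) cx] by blast
      then show ?thesis unfolding f_def by (rule theI')
    qed
    show "bij_betw f (N x \<inter> (V2 - A)) O'"
    proof (rule bij_betwI')
      fix c c' assume cc: "c \<in> N x \<inter> (V2 - A)" "c' \<in> N x \<inter> (V2 - A)"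
      then have "adj x c" "adj x c'" "c \<in> V2" "c' \<in> V2" by (auto simp: N_iff)
      then show "f c = f c' \<longleftrightarrow> c = c'"
        using f two_common[of x c c' "f c"] adj_sym by metis
    next
      fix c assume "c \<in> N x \<inter> (V2 - A)"
      then show "f c \<in> O'" using f[of c] V2_B[of c "f c"] by (auto simp: N_iff O'_def)
    next
      fix y assume "y \<in> O'"
      then obtain c where c: "c \<in> V2 - A" "adj x c" "adj c y" "y \<noteq> x" unfolding O'_def by blast
      moreover have "adj c x" using c(2) adj_sym by metis
      ultimately have "y = f c" using f[of c] V2_third[of c x y "f c"] by blast
      then show "\<exists>c\<in>N x \<inter> (V2 - A). y = f c" using c by (auto simp: N_iff)
    qed
  qed
  finally show ?thesis .
qed

lemma double_count:
  assumes A: "A \<subseteq> V2"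
  shows "(\<Sum>x\<in>B. card (N x \<inter> A)) = 2 * card A"
proof -
  have fA: "finite A" using A finite_V2 finite_subset by blast
  have "(\<Sum>x\<in>B. card (N x \<inter> A)) = (\<Sum>x\<in>B. \<Sum>a\<in>A. if adj x a then 1 else 0)"
    using fA by (intro sum.cong) (simp_all add: sum.If_cases N_def Int_commute Collect_conj_eq)
  also have "\<dots> = (\<Sum>a\<in>A. \<Sum>x\<in>B. if adj x a then 1 else 0)" by (rule sum.swap)
  also have "\<dots> = (\<Sum>a\<in>A. 2)"
  proof (rule sum.cong[OF refl])
    fix a assume a: "a \<in> A"
    have "B \<inter> {x. adj x a} = N a" using V2_B[of a] a A adj_sym[of a] by (auto simp: N_iff)
    then show "(\<Sum>x\<in>B. if adj x a then 1 else 0) = (2::nat)"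
      using finite_B a A by (simp add: sum.If_cases) (auto simp: V2_def)
  qed
  finally show ?thesis by simp
qed

text \<open>A deleted vertex of degree 2 lowers the double sum by 2, once for each of its ends. This
  is what a token pays for.\<close>

lemma sum_mult:
  assumes A: "A \<subseteq> V2"
  shows "(\<Sum>x\<in>B. \<Sum>y\<in>B. mult A x y) + 2 * card A = (\<Sum>x\<in>B. 2 * d0 x + d1 x)"
proof -
  have "d1 x = card (N x \<inter> (V2 - A)) + card (N x \<inter> A)" for x
  proof -
    have "N x \<inter> V2 = (N x \<inter> (V2 - A)) \<union> (N x \<inter> A)" using A by blast
    then show ?thesis unfolding d1_def
      using card_Un_disjoint[of "N x \<inter> (V2 - A)" "N x \<inter> A"] finite_N by auto
  qed
  then have "(\<Sum>x\<in>B. 2 * d0 x + d1 x) = (\<Sum>x\<in>B. \<Sum>y\<in>B. mult A x y) + (\<Sum>x\<in>B. card (N x \<inter> A))"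
    by (simp add: sum_mult_row sum.distrib)
  then show ?thesis using double_count[OF A] by simp
qed

lemma card_B: "card B \<ge> 2"
proof -
  have "V \<noteq> {}"
  proof
    assume V: "V = {}"
    have "good_on E (\<lambda>_. 0) V" unfolding good_on_def nondec_def V by auto
    then show False using not_good by blast
  qed
  then obtain v where v: "v \<in> V" by blast
  have "B \<noteq> {}"
  proof
    assume "B = {}"
    then have "v \<in> V2" using v V_split by blast
    moreover obtain u where "adj v u" using deg_ge_2[OF v] by (metis N_iff card.empty ex_in_conv not_numeral_le_zero)
    ultimately show False using V2_B \<open>B = {}\<close> by blast
  qed
  then obtain v where "v \<in> B" by blast
  then have "2 \<le> card (N v \<inter> B)" using d0_ge_2 unfolding d0_def by blast
  also have "\<dots> \<le> card B" using finite_B by (intro card_mono) auto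
  finally show ?thesis .
qed

text \<open>All neighbours of degree 2 of the tokens are deleted, and each of them counts 2 towards
  the 6 demanded by \<open>load_cut_exists\<close>.\<close>

lemma token_set_False:
  fixes r :: "'a \<Rightarrow> nat"
  assumes Z: "Z \<subseteq> D"
    and uniq: "\<And>a z z'. a \<in> V2 \<Longrightarrow> z \<in> Z \<Longrightarrow> z' \<in> Z \<Longrightarrow> adj a z \<Longrightarrow> adj a z' \<Longrightarrow> z = z'"
    and order: "\<And>z z' a x w. z \<in> Z \<Longrightarrow> z' \<in> Z \<Longrightarrow> z \<noteq> z' \<Longrightarrow> a \<in> V2 \<Longrightarrow> adj a z \<Longrightarrow> adj a x \<Longrightarrow> x \<noteq> z \<Longrightarrow>
      adj x z' \<Longrightarrow> adj w z \<Longrightarrow> adj w z' \<Longrightarrow> r z < r z'"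
    and big: "(\<Sum>x\<in>B. 2 * d0 x + d1 x) + 6 < 6 * card B + 2 * card {a \<in> V2. \<exists>z\<in>Z. adj z a}"
  shows False
proof -
  define A where "A = {a \<in> V2. \<exists>z\<in>Z. adj z a}"
  have A: "A \<subseteq> V2" unfolding A_def by blast
  have "\<exists>S l. load_cut B (mult A) S l"
  proof (rule load_cut_exists[OF finite_B card_B mult_sym])
    show "mult A x x = 0" for x unfolding mult_def by simp
    show "(\<Sum>x\<in>B. \<Sum>y\<in>B. mult A x y) + 6 < 6 * card B"
      using sum_mult[OF A] big unfolding A_def by simp
  qed
  then obtain S l where "load_cut B (mult A) S l" by blast
  then show False
  proof (rule load_cut_False[OF A _ Z])
    show "c \<in> A" if "z \<in> Z" "c \<in> V2" "adj z c" for z c using that unfolding A_def by blast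
    show "\<exists>z x. N a = {z, x} \<and> z \<in> Z \<and> x \<notin> Z" if aA: "a \<in> A" for a
    proof -
      obtain z where "z \<in> Z" "adj z a" "a \<in> V2" using aA unfolding A_def by blast
      then have z: "z \<in> Z" "adj a z" "a \<in> V2" using adj_sym[of z a] by auto
      obtain q where q: "q \<noteq> z" "adj a q" "N a = {z, q}" using V2_N[OF z(3,2)] by blast
      then have "q \<notin> Z" using uniq[of a z q] z by blast
      then show ?thesis using q z by blast
    qed
    show "r z < r z'" if "z \<in> Z" "z' \<in> Z" "z \<noteq> z'" "a \<in> A" "adj a z" "adj a x" "x \<noteq> z" "adj x z'" "adj w z" "adj w z'" for z z' a x w
      using order[of z z' a x w] that A by blast
  qed
qed

section \<open>Stars around a shortest cycle\<close>

text \<open>Expressed by \<open>successively\<close>, because cycles are cut open, rotated and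
  shortened below.\<close>

definition cyc :: "'a list \<Rightarrow> bool" where
  "cyc c \<longleftrightarrow> length c \<ge> 3 \<and> distinct c \<and> successively adj c \<and> adj (last c) (hd c)"

lemma cyc_rotate: assumes "cyc (p @ q)" "p \<noteq> []" "q \<noteq> []" shows "cyc (q @ p)"
  using assms unfolding cyc_def by (auto simp: successively_append_iff)

text \<open>All neighbours in \<open>W\<close> of the first vertex of a longest path lie on that
  path, and one of them other than the second vertex closes a cycle.\<close>

lemma cyc_exists:
  assumes W: "W \<subseteq> V" "W \<noteq> {}"
    and two: "\<And>v. v \<in> W \<Longrightarrow> \<exists>x y. x \<noteq> y \<and> x \<in> W \<and> y \<in> W \<and> adj v x \<and> adj v y"
  shows "\<exists>c. cyc c \<and> set c \<subseteq> W"
proof -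
  define PP where "PP p \<longleftrightarrow> p \<noteq> [] \<and> distinct p \<and> successively adj p \<and> set p \<subseteq> W" for p
  have fW: "finite W" using W finite_verts finite_subset by blast
  have bd: "length p \<le> card W" if "PP p" for p
    using that fW distinct_card[of p] card_mono[of W "set p"] unfolding PP_def by auto
  obtain w where "w \<in> W" using W by blast
  then have "PP [w]" unfolding PP_def by simp
  then obtain p where p: "PP p" "\<And>q. PP q \<Longrightarrow> length q \<le> length p"
    using ex_has_greatest_nat[of PP "[w]" length "Suc (card W)"] bd by (metis less_Suc_eq_le)
  obtain v p' where pv: "p = v # p'" using p(1) unfolding PP_def by (cases p) auto
  have inp: "x \<in> set p'" if "x \<in> W" "adj v x" for x
  proof (rule ccontr)
    assume "x \<notin> set p'"
    then have "PP (x # p)" using that p(1) adj_neq[of v x] adj_sym[of v x] unfolding PP_def pv by auto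
    then show False using p(2) by fastforce
  qed
  have "v \<in> W" using p(1) unfolding PP_def pv by auto
  then obtain x y where xy: "x \<noteq> y" "x \<in> set p'" "y \<in> set p'" "adj v x" "adj v y" using two inp by metis
  have "\<exists>x\<in>set p'. adj v x \<and> x \<noteq> hd p'" using xy by metis
  then obtain x where x: "x \<in> set p'" "adj v x" "x \<noteq> hd p'" by blast
  then obtain as bs where p': "p' = as @ x # bs" using split_list by metis
  then have "as \<noteq> []" using x by auto
  then have "cyc (v # as @ [x])" using p(1) x(2) adj_sym[of v x]
    unfolding cyc_def PP_def pv p' by (cases as) (auto simp: successively_append_iff successively_Cons hd_append split: if_splits)
  moreover have "set (v # as @ [x]) \<subseteq> W" using p(1) unfolding PP_def pv p' by auto
  ultimately show ?thesis by blast
qed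

text \<open>For a shortest cycle \<open>C\<close> avoiding \<open>h\<close>, a chord or an outer vertex with two neighbours on it would
  give a shorter one.\<close>

lemma short_cycle:
  assumes W: "W \<subseteq> V" "W \<noteq> {}" "h \<notin> W"
    and two: "\<And>v. v \<in> W \<Longrightarrow> \<exists>x y. x \<noteq> y \<and> x \<in> W \<and> y \<in> W \<and> adj v x \<and> adj v y"
  obtains C where "C \<subseteq> V" "C \<noteq> {}" "h \<notin> C"
    "\<And>v. v \<in> C \<Longrightarrow> card (N v \<inter> C) = 2"
    "\<And>u x y. u \<notin> C \<Longrightarrow> u \<noteq> h \<Longrightarrow> adj u x \<Longrightarrow> adj u y \<Longrightarrow> x \<in> C \<Longrightarrow> y \<in> C \<Longrightarrow> x = y"
proof -
  obtain c0 where "cyc c0 \<and> set c0 \<subseteq> W" using cyc_exists[OF W(1,2) two] by blast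
  then have "cyc c0 \<and> h \<notin> set c0" using W by auto
  then obtain c where c: "cyc c" "h \<notin> set c" and least: "\<And>d. cyc d \<Longrightarrow> h \<notin> set d \<Longrightarrow> length c \<le> length d"
    using ex_has_least_nat[of "\<lambda>c. cyc c \<and> h \<notin> set c" c0 length] by blast
  have n3: "length c \<noteq> 3"
  proof
    assume "length c = 3"
    then obtain x y z where "c = [x, y, z]" by (auto simp: length_Suc_conv numeral_3_eq_3)
    then show False using c no_C3[of x y z] adj_sym[of x z] unfolding cyc_def by auto
  qed
  have n4: "length c \<noteq> 4"
  proof
    assume "length c = 4"
    then obtain x y z w where "c = [x, y, z, w]" by (auto simp: length_Suc_conv eval_nat_numeral)
    then show False using c no_C4[of x y z w] unfolding cyc_def by auto
  qed
  have n5: "length c \<ge> 5" using n3 n4 c unfolding cyc_def by auto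
  have deg: "card (N v \<inter> set c) = 2" if v: "v \<in> set c" for v
  proof -
    obtain as bs where ab: "c = as @ v # bs" using split_list[OF v] by blast
    define d where "d = bs @ as"
    have cv: "cyc (v # d)"
    proof (cases "as = []")
      case True
      then show ?thesis using c ab d_def by simp
    next
      case False
      then show ?thesis using cyc_rotate[of as "v # bs"] c ab d_def by simp
    qed
    have sd: "set c = insert v (set d)" "length c = Suc (length d)" using ab d_def by auto
    have dn: "d \<noteq> []" "hd d \<noteq> last d" "distinct d" "v \<notin> set d"
    proof -
      show *: "d \<noteq> []" using sd n5 by auto
      show "distinct d" "v \<notin> set d" using cv unfolding cyc_def by auto
      then show "hd d \<noteq> last d" using * sd n5 by (cases d) auto
    qed
    have "adj v (hd d)" "adj v (last d)" using cv dn adj_sym[of v "last d"] unfolding cyc_def by (auto simp: successively_Cons)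
    moreover have "x = hd d \<or> x = last d" if x: "x \<in> set d" "adj v x" for x
    proof (rule ccontr)
      assume no: "\<not> ?thesis"
      obtain e f where ef: "d = e @ x # f" using split_list[OF x(1)] by blast
      have "e \<noteq> []" "f \<noteq> []" using no ef by auto
      then have "cyc (v # e @ [x])" using cv x(2) adj_sym[of v x]
        unfolding cyc_def ef by (cases e) (auto simp: successively_append_iff successively_Cons hd_append split: if_splits)
      moreover have "h \<notin> set (v # e @ [x])" using c sd ef by auto
      ultimately have "length c \<le> length (v # e @ [x])" using least by blast
      then show False using sd(2) ef \<open>f \<noteq> []\<close> by simp
    qed
    moreover have "\<not> adj v v" by (rule adj_irrefl)
    ultimately have "x \<in> N v \<inter> set c \<longleftrightarrow> x = hd d \<or> x = last d" for x
      unfolding sd(1) Int_iff insert_iff N_iff using hd_in_set[OF dn(1)] last_in_set[OF dn(1)] by metis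
    then have "N v \<inter> set c = {hd d, last d}" by blast
    then show ?thesis using dn(2) by simp
  qed
  have ext: "x = y" if u: "u \<notin> set c" "u \<noteq> h" "adj u x" "adj u y" "x \<in> set c" "y \<in> set c" for u x y
  proof (rule ccontr)
    assume "x \<noteq> y"
    have main: False if xy: "adj u x" "adj u y" "c = as @ x # bs @ y # ds" for x y as bs ds
    proof -
      have yu: "adj y u" "adj x u" using xy adj_sym[of y u] adj_sym[of x u] by auto
      have 1: "cyc (u # x # bs @ [y])" using c(1) xy yu u(1) unfolding cyc_def
        by (cases bs) (auto simp: successively_append_iff successively_Cons hd_append split: if_splits)
      have 2: "cyc (u # y # ds @ as @ [x])" using c(1) xy yu u(1) unfolding cyc_def
        by (cases as; cases ds; cases bs) (auto simp: successively_append_iff successively_Cons hd_append split: if_splits)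
      \<comment> \<open>The two cycles through \<open>u\<close> have total length
        \<open>length c + 4\<close>, so for \<open>length c\<close> at least 5 they cannot both be
        as long as \<open>c\<close>.\<close>
      have "length c \<le> length (u # x # bs @ [y])" by (rule least[OF 1]) (use c u xy in auto)
      moreover have "length c \<le> length (u # y # ds @ as @ [x])" by (rule least[OF 2]) (use c u xy in auto)
      ultimately show False using n5 xy(3) by simp
    qed
    obtain as bs where ab: "c = as @ x # bs" using split_list[OF u(5)] by blast
    show False
    proof (cases "y \<in> set bs")
      case True
      then show False using main[OF u(3,4)] ab split_list by metis
    next
      case False
      then have "y \<in> set as" using ab u(6) \<open>x \<noteq> y\<close> by auto
      then obtain e f where "as = e @ y # f" using split_list by metis
      then show False using main[OF u(4,3), of e f bs] ab by simp
    qed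
  qed
  have cV: "set c \<subseteq> V"
  proof
    fix v assume "v \<in> set c"
    then have "N v \<noteq> {}" using deg[of v] by auto
    then show "v \<in> V" using adj_V N_iff by blast
  qed
  have "set c \<noteq> {}" using n5 by auto
  then show thesis using that[of "set c"] cV c(2) deg ext by blast
qed

text \<open>Deleting \<open>h\<close> and its neighbours of degree 2 leaves minimum degree 2: a
  remaining vertex of degree 2 is not adjacent to \<open>h\<close>, and a neighbour of
  \<open>h\<close> in \<open>B\<close> keeps a neighbour in \<open>B\<close> and a third one, which
  without triangles is not adjacent to \<open>h\<close>.\<close>

lemma star_cycle:
  assumes h: "h \<in> V"
  obtains C where "C \<subseteq> V" "C \<noteq> {}" "h \<notin> C"
    "\<And>v. v \<in> C \<Longrightarrow> card (N v \<inter> C) = 2"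
    "\<And>u x y. u \<notin> C \<Longrightarrow> u \<noteq> h \<Longrightarrow> adj u x \<Longrightarrow> adj u y \<Longrightarrow> x \<in> C \<Longrightarrow> y \<in> C \<Longrightarrow> x = y"
proof -
  define W where "W = V - {h} - (V2 \<inter> N h)"
  have BW: "x \<in> W" if "x \<in> B" "x \<noteq> h" for x using that V_split unfolding W_def by auto
  have W: "W \<subseteq> V" "h \<notin> W" unfolding W_def by auto
  have "W \<noteq> {}"
  proof -
    have "\<not> B \<subseteq> {h}" using card_B card_mono[of "{h}" B] by auto
    then show ?thesis using BW by blast
  qed
  have two: "\<exists>x y. x \<noteq> y \<and> x \<in> W \<and> y \<in> W \<and> adj v x \<and> adj v y" if v: "v \<in> W" for v
  proof (cases "v \<in> V2")
    case True
    then have nh: "\<not> adj v h" using v True unfolding W_def by (simp add: N_iff insert_commute)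
    obtain x where x: "adj v x" using deg_ge_2[of v] v W N_iff[of _ v] by fastforce
    then obtain y where y: "y \<noteq> x" "adj v y" using V2_N[OF True] by blast
    then show ?thesis using V2_B[OF True] x BW nh by metis
  next
    case False
    then have vB: "v \<in> B" using v W V_split by auto
    note d0_ge_2[OF vB]
    then obtain x y where xy: "x \<noteq> y" "x \<in> N v \<inter> B" "y \<in> N v \<inter> B"
      using finite_N[of v] card_le_Suc0_iff_eq[of "N v \<inter> B"] unfolding d0_def by fastforce
    show ?thesis
    proof (cases "h = x \<or> h = y")
      case False
      then show ?thesis using xy BW by (metis IntE N_iff)
    next
      case True
      define z where "z = (if h = x then y else x)"
      have z: "z \<noteq> h" "z \<in> B" "adj v z" "adj v h" using True xy unfolding z_def by (auto simp: N_iff)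
      have "\<exists>w. adj v w \<and> w \<noteq> h \<and> w \<noteq> z"
      proof (rule ccontr)
        assume "\<not> ?thesis"
        then have "N v \<subseteq> {h, z}" by (auto simp: N_iff)
        then have "card (N v) \<le> 2" using card_mono[of "{h, z}" "N v"] z(1) by auto
        then show False using B_deg[OF vB] by simp
      qed
      then obtain w where w: "adj v w" "w \<noteq> h" "w \<noteq> z" by blast
      have "\<not> adj h w" using no_tri z(4) w(1) by blast
      then have "w \<in> W" using w adj_V unfolding W_def by (auto simp: N_iff)
      then show ?thesis using w z BW by metis
    qed
  qed
  show thesis by (rule short_cycle[OF W(1) \<open>W \<noteq> {}\<close> W(2) two]) (use that in blast)+
qed

text \<open>Let \<open>C\<close> be a shortest cycle avoiding \<open>h\<close>. Only \<open>h\<close> has several neighbours on it; each of them forms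
  a part together with its neighbours on \<open>C\<close>, the rest of \<open>C\<close> is another part, and so is the outside,
  whose crossing edges get the lowest labels.\<close>

lemma star_False:
  assumes h: "h \<in> V"
    and deg: "\<And>v. v \<in> V \<Longrightarrow> v \<noteq> h \<Longrightarrow>
      card (N v) \<le> 3 \<or> v = t \<and> card (N v) = 4 \<and> (\<exists>a\<in>V2. adj h a \<and> adj a t)"
  shows False
proof (rule star_cycle[OF h])
  fix C assume C: "C \<subseteq> V" "C \<noteq> {}" "h \<notin> C"
    and C2: "\<And>v. v \<in> C \<Longrightarrow> card (N v \<inter> C) = 2"
    and Cout: "\<And>u x y. u \<notin> C \<Longrightarrow> u \<noteq> h \<Longrightarrow> adj u x \<Longrightarrow> adj u y \<Longrightarrow> x \<in> C \<Longrightarrow> y \<in> C \<Longrightarrow> x = y"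
  have C3: "y = z" if "v \<in> C" "x \<in> C" "y \<in> C" "z \<in> C" "adj v x" "adj v y" "adj v z" "y \<noteq> x" "z \<noteq> x" for v x y z
  proof (rule ccontr)
    assume "y \<noteq> z"
    then have "card {x, y, z} \<le> card (N v \<inter> C)"
      using that by (intro card_mono) (auto simp: N_iff finite_N)
    then show False using that \<open>y \<noteq> z\<close> C2 by simp
  qed
  \<comment> \<open>If the exceptional vertex \<open>t\<close> of degree 4 lies on \<open>C\<close>,
    two edges leave \<open>C\<close> at \<open>t\<close>. Adding its common neighbour with
    \<open>h\<close> to \<open>S\<close> leaves only one of them crossing.\<close>
  define T4 where "T4 \<longleftrightarrow> t \<in> C \<and> card (N t) = 4 \<and> (\<exists>a\<in>V2. adj h a \<and> adj a t)"
  define AA where "AA = {a \<in> V2. T4 \<and> adj h a \<and> adj a t}"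
  have AA: "adj h a" "adj a h" "adj a t" "adj t a" "t \<in> C" "a \<notin> C" "a \<noteq> h" "adj a x \<Longrightarrow> x = h \<or> x = t" if "a \<in> AA" for a x
  proof -
    have a: "a \<in> V2" "adj h a" "adj a t" "t \<in> C" using that unfolding AA_def T4_def by auto
    then show "adj h a" "adj a t" "t \<in> C" by blast+
    show s: "adj a h" "adj t a" using a adj_sym[of a h] adj_sym[of t a] by simp_all
    show "a \<noteq> h" using a adj_neq by blast
    have ht: "h \<noteq> t" using a C by blast
    show nb: "x = h \<or> x = t" if "adj a x" for x using V2_third[OF a(1) s(1) a(3) ht that] .
    show "a \<notin> C"
    proof
      assume "a \<in> C"
      have "N a \<inter> C \<subseteq> {t}" using nb C(3) N_iff by blast
      then have "card (N a \<inter> C) \<le> 1" using card_mono[of "{t}"] by fastforce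
      then show False using C2[OF \<open>a \<in> C\<close>] by simp
    qed
  qed
  have AA1: "a = b" if "a \<in> AA" "b \<in> AA" for a b
    using two_common[of h a b t] AA[OF that(1)] AA[OF that(2)] C by blast
  define S where "S = C \<union> AA"
  have hS: "h \<notin> S" using C AA(7) unfolding S_def by blast
  have out1: "x = y" if v: "v \<in> S" "adj v x" "adj v y" "x \<notin> S" "y \<notin> S" for v x y
  proof (cases "v \<in> AA")
    case True
    then show ?thesis using AA[OF True] v unfolding S_def by blast
  next
    case False
    then have vC: "v \<in> C" using v unfolding S_def by blast
    show ?thesis
    proof (rule ccontr)
      assume xy: "x \<noteq> y"
      have nC: "x \<notin> C" "y \<notin> C" using v unfolding S_def by auto
      have "card (N v \<inter> C \<union> {x, y}) = card (N v \<inter> C) + card {x, y}"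
        using nC by (intro card_Un_disjoint) (auto simp: finite_N)
      then have c4: "card (N v \<inter> C \<union> {x, y}) = 4" using C2[OF vC] xy by simp
      have sub: "N v \<inter> C \<union> {x, y} \<subseteq> N v" using v by (auto simp: N_iff)
      then have "4 \<le> card (N v)" using c4 card_mono[OF finite_N sub] by simp
      moreover have "v \<in> V" "v \<noteq> h" using vC C by auto
      ultimately have t: "v = t" "card (N v) = 4" "\<exists>a\<in>V2. adj h a \<and> adj a t" using deg[of v] by auto
      then obtain a where a: "a \<in> AA" using vC unfolding AA_def T4_def by blast
      have "N v = N v \<inter> C \<union> {x, y}" using card_subset_eq[OF finite_N sub] c4 t(2) by simp
      then have "a \<in> {x, y} \<or> a \<in> C" using AA(4)[OF a] t(1) N_iff[of a v] by blast
      then show False using v a AA(6)[OF a] unfolding S_def by auto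
    qed
  qed
  have in1: "x = y" if "u \<notin> S" "u \<noteq> h" "adj u x" "adj u y" "x \<in> S" "y \<in> S" for u x y
  proof -
    have nA: "z \<in> C" if "z \<in> S" "adj u z" for z
    proof (rule ccontr)
      assume "z \<notin> C"
      then have "z \<in> AA" using that unfolding S_def by blast
      moreover have "adj z u" using that(2) by (simp add: insert_commute)
      ultimately show False using AA(5)[of z] AA(8)[of z u] \<open>u \<notin> S\<close> \<open>u \<noteq> h\<close> unfolding S_def by blast
    qed
    have "u \<notin> C" using that unfolding S_def by blast
    then show ?thesis using Cout[of u x y] nA that by blast
  qed
  define In where "In c v \<longleftrightarrow> c \<in> C \<and> adj h c \<and> (v = c \<or> v \<in> C \<and> adj c v)" for c v
  have In1: "c = c'" if "In c v" "In c' v" for c c' v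
  proof (rule ccontr)
    assume ne: "c \<noteq> c'"
    have c: "adj h c" "adj h c'" "v = c \<or> v \<in> C \<and> adj c v" "v = c' \<or> v \<in> C \<and> adj c' v" using that unfolding In_def by auto
    have nn: "\<not> adj c c'" "\<not> adj c' c" using no_tri c by blast+
    then have "adj c v" "adj c' v" "v \<in> C" using c ne by auto
    moreover have "adj c h" "adj c' h" using c(1,2) by (simp_all add: insert_commute)
    ultimately show False using two_common[of c v h c'] ne C(3) by blast
  qed
  define \<sigma> where "\<sigma> v = (if \<exists>c. In c v then Some (SOME c. In c v) else None)" for v
  have s1: "\<sigma> v = Some c \<longleftrightarrow> In c v" for v c
  proof -
    have "In c v \<Longrightarrow> (SOME c. In c v) = c" using In1 by blast
    moreover have "\<exists>c. In c v \<Longrightarrow> In (SOME c. In c v) v" by (rule someI_ex)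
    ultimately show ?thesis unfolding \<sigma>_def by auto
  qed
  have s0: "\<sigma> v = None \<longleftrightarrow> (\<forall>c. \<not> In c v)" for v using s1 by (metis not_None_eq)
  have sc: "\<sigma> c = Some c" if "c \<in> C" "adj h c" for c using that unfolding s1 In_def by blast
  have sa: "\<sigma> a = None" if "a \<in> AA" for a using AA(6)[OF that] unfolding s0 In_def by blast
  have st: "\<sigma> t = None" if a: "a \<in> AA" for a
  proof -
    have "\<not> In c t" for c
    proof
      assume c: "In c t"
      then have hc: "adj h c" "c \<in> C" "c = t \<or> adj c t" unfolding In_def by auto
      show False
      proof (cases "c = t")
        case True
        then show False using no_tri[of h a t] AA[OF a] hc by blast
      next
        case False
        then have "adj t c" using hc by (simp add: insert_commute)
        then have "a = c" using two_common[of h a c t] AA[OF a] hc C(3) by blast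
        then show False using AA(6)[OF a] hc by blast
      qed
    qed
    then show ?thesis unfolding s0 by blast
  qed
  \<comment> \<open>\<open>None\<close> is the outside, \<open>Some (Some c)\<close> the star with
    centre \<open>c\<close>, and \<open>Some None\<close> the rest of \<open>S\<close>.\<close>
  define \<pi> where "\<pi> v = (if v \<in> S then Some (\<sigma> v) else None)" for v
  have pS: "\<pi> v = Some (\<sigma> v)" if "v \<in> S" for v using that unfolding \<pi>_def by simp
  have pT: "\<pi> v = None" if "v \<notin> S" for v using that unfolding \<pi>_def by simp
  define cr where "cr u v \<longleftrightarrow> adj u v \<and> \<pi> u \<noteq> \<pi> v" for u v
  have crad: "adj u v" "adj v u" "cr v u" if "cr u v" for u v
    using that unfolding cr_def by (auto simp: insert_commute)
  define \<rho> where "\<rho> e = (if e \<subseteq> S then -1 else -2 :: real)" for e :: "'a set"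
  have inner: "u \<in> C \<and> v \<in> C \<and> \<sigma> u \<noteq> \<sigma> v" if c: "cr u v" "u \<in> S" "v \<in> S" for u v
  proof -
    have ne: "\<sigma> u \<noteq> \<sigma> v" using c pS unfolding cr_def by auto
    have "False" if a: "w \<in> AA" "adj w z" "z \<in> S" "\<sigma> w \<noteq> \<sigma> z" for w z
      using AA(8)[OF a(1,2)] a hS sa st by metis
    then show ?thesis using ne c crad[OF c(1)] unfolding S_def by (metis Un_iff S_def)
  qed
  \<comment> \<open>Both cycle neighbours of a centre belong to its star. So a path that enters a
    star from \<open>h\<close> cannot go on to another part.\<close>
  have cen: "\<not> (cr c v \<and> v \<in> S)" if "c \<in> C" "adj h c" for c v
  proof
    assume *: "cr c v \<and> v \<in> S"
    then have "v \<in> C" "\<sigma> c \<noteq> \<sigma> v" "adj c v" using inner[of c v] that crad unfolding S_def by blast+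
    then have "In c v" using that unfolding In_def by blast
    then show False using \<open>\<sigma> c \<noteq> \<sigma> v\<close> s1 sc[OF that] by metis
  qed
  \<comment> \<open>One cycle neighbour of \<open>f\<close> is the centre and the other is
    \<open>v\<close>, so a path that enters a star along the cycle continues to the centre and stays
    in the star.\<close>
  have key: "g = c" if "cr v f" "v \<in> S" "f \<in> S" "\<sigma> f = Some c" "g \<in> C" "adj f g" "g \<noteq> v" for v f c g
  proof -
    have i: "v \<in> C" "f \<in> C" "\<sigma> v \<noteq> \<sigma> f" using inner[OF that(1-3)] by auto
    have c: "In c f" using that(4) s1 by blast
    have "f \<noteq> c" using cen[of f v] crad(3)[OF that(1)] that(2) c i(2) unfolding In_def by blast
    then have fc: "adj f c" "c \<in> C" using c unfolding In_def by (auto simp: insert_commute)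
    have "c \<noteq> v" using cen[of v f] that(1,3) c unfolding In_def by blast
    then show ?thesis using C3[of f v g c] i fc that crad[OF that(1)] by metis
  qed
  \<comment> \<open>From an outer vertex other than \<open>h\<close> a path may run through several
    parts of \<open>S\<close> but not out again, since labels inside \<open>S\<close> are higher.
    From \<open>S\<close> to \<open>h\<close> it may continue into the part of another neighbour of
    \<open>h\<close>. After crossing inside \<open>S\<close> it may enter one more part.\<close>
  define Q where "Q u a = (if u \<notin> S then (if u = h then {\<pi> a} else - {None})
     else if a \<notin> S then (if a = h then insert None (\<pi> ` (S \<inter> N h - {u})) else {None})
     else insert (\<pi> a) (\<pi> ` (N a \<inter> C - {u})))" for u a
  have QT: "Q u a = (if u = h then {\<pi> a} else - {None})" if "u \<notin> S" for u a using that unfolding Q_def by simp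
  have QS: "Q u a = (if a = h then insert None (\<pi> ` (S \<inter> N h - {u})) else {None})" if "u \<in> S" "a \<notin> S" for u a
    using that unfolding Q_def by simp
  have QI: "Q u a = insert (\<pi> a) (\<pi> ` (N a \<inter> C - {u}))" if "u \<in> S" "a \<in> S" for u a
    using that unfolding Q_def by simp
  have CS: "x \<in> S" if "x \<in> C" for x using that unfolding S_def by blast
  have hinj: "x = y" if "x \<in> S" "y \<in> S" "adj h x" "adj h y" "\<pi> x = \<pi> y" for x y
  proof -
    have e: "\<sigma> x = \<sigma> y" using that pS by simp
    show ?thesis
    proof (cases "x \<in> AA \<or> y \<in> AA")
      case True
      then show ?thesis using e sa sc that AA1 unfolding S_def by (metis Un_iff option.distinct(1))
    next
      case False
      then show ?thesis using e sc that unfolding S_def by (metis Un_iff option.inject)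
    qed
  qed
  obtain c0 where c0: "c0 \<in> C" using C by blast
  show False
  proof (rule parts_False[of c0 h \<pi> cr \<rho> Q])
    show "c0 \<in> V" "h \<in> V" "\<pi> c0 \<noteq> \<pi> h" using c0 C h pS[of c0] pT[OF hS] CS by auto
    show "cr u v \<longleftrightarrow> adj u v \<and> \<pi> u \<noteq> \<pi> v" for u v unfolding cr_def ..
    show "\<rho> {u, v} < 0" for u v unfolding \<rho>_def by auto
    show Q1: "\<pi> a \<in> Q u a" if c: "cr u a" for u a
      using c crad[OF c] pT[of a] pT[of u] pS[of a] unfolding Q_def cr_def by (cases "u \<in> S"; cases "a \<in> S") (auto simp: N_iff)
    show Q3: "\<pi> u \<notin> Q u a" if c: "cr u a" for u a
    proof (cases "u \<in> S")
      case False
      then show ?thesis using c pT[OF False] unfolding QT[OF False] cr_def by auto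
    next
      case uS: True
      show ?thesis
      proof (cases "a \<in> S")
        case False
        have "\<pi> u \<notin> \<pi> ` (S \<inter> N h - {u})" if "a = h"
        proof
          assume "\<pi> u \<in> \<pi> ` (S \<inter> N h - {u})"
          then obtain x where x: "x \<in> S" "adj h x" "x \<noteq> u" "\<pi> u = \<pi> x" unfolding N_def by blast
          have "adj h u" using crad(2)[OF c] that by simp
          then show False using hinj[OF uS x(1) _ x(2,4)] x(3) by simp
        qed
        moreover have "\<pi> u \<noteq> None" using pS[OF uS] by simp
        ultimately show ?thesis unfolding QS[OF uS False] by (cases "a = h") simp_all
      next
        case True
        note i = inner[OF c uS True]
        have "False" if g: "g \<in> C" "adj a g" "g \<noteq> u" "\<pi> u = \<pi> g" for g
        proof -
          have e: "\<sigma> u = \<sigma> g" using g pS uS CS by simp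
          show False
          proof (cases "\<sigma> a")
            case (Some c)
            then have "g = c" using key[OF c uS True] g by blast
            moreover have "In c a" using Some s1 by blast
            ultimately show False using e sc[of c] s1 i Some unfolding In_def by metis
          next
            case None
            then obtain c where cc: "\<sigma> u = Some c" "\<sigma> g = Some c" using i e by (metis not_None_eq)
            then have In: "In c u" "In c g" using s1 by auto
            have "c \<noteq> u" using cen[of c a] In c True unfolding In_def by blast
            moreover have "c \<noteq> g"
            proof
              assume "c = g"
              then have "In c a" using In i g unfolding In_def by (simp add: insert_commute)
              then show False using None s0 by blast
            qed
            ultimately have "adj c u" "adj c g" using In unfolding In_def by auto
            moreover have "adj a u" using crad[OF c] by blast
            moreover have "a \<noteq> c" using None sc[of c] In(1) unfolding In_def by auto
            ultimately show False using two_common[of c u g a] g by blast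
          qed
        qed
        then have "\<pi> u \<notin> \<pi> ` (N a \<inter> C - {u})" unfolding N_def by blast
        then show ?thesis using c unfolding QI[OF uS True] cr_def by simp
      qed
    qed
    show Q4: "Q u a \<inter> Q u b = {}" if c: "cr u a" "cr u b" "a \<noteq> b" for u a b
    proof (cases "u \<in> S")
      case False
      have ab: "a \<in> S" "b \<in> S" using c pT[OF False] pT[of a] pT[of b] unfolding cr_def by metis+
      show ?thesis
      proof (cases "u = h")
        case True
        then show ?thesis using hinj[OF ab] c crad[OF c(1)] crad[OF c(2)] unfolding QT[OF False] by auto
      next
        case nh: False
        then show ?thesis using in1[OF False nh _ _ ab] c crad[OF c(1)] crad[OF c(2)] by blast
      qed
    next
      case uS: True
      have mixed: "Q u a \<inter> Q u b = {}" if c: "cr u a" "cr u b" "a \<in> S" "b \<notin> S" for a b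
      proof -
        note i = inner[OF c(1) uS c(3)]
        have "b \<noteq> h" using cen[of u a] i c crad[OF c(2)] by blast
        then have "Q u b = {None}" unfolding QS[OF uS c(4)] by simp
        moreover have "None \<notin> Q u a" unfolding QI[OF uS c(3)] using pS CS c(3) by auto
        ultimately show ?thesis by simp
      qed
      consider "a \<in> S" "b \<notin> S" | "b \<in> S" "a \<notin> S" | "a \<notin> S" "b \<notin> S" | "a \<in> S" "b \<in> S" by blast
      then show ?thesis
      proof cases
        case 1
        then show ?thesis using mixed c by blast
      next
        case 2
        then show ?thesis using mixed c by blast
      next
        case 3
        then show ?thesis using out1[OF uS] c crad[OF c(1)] crad[OF c(2)] by blast
      next
        case 4
        note i = inner[OF c(1) uS 4(1)] inner[OF c(2) uS 4(2)]
        have ad: "adj u a" "adj u b" "adj a u" "adj b u" using crad[OF c(1)] crad[OF c(2)] by auto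
        have un: "\<sigma> u = None"
        proof (rule ccontr)
          assume "\<sigma> u \<noteq> None"
          then obtain c where "\<sigma> u = Some c" by auto
          note k = key[OF crad(3)[OF c(1)] 4(1) uS this, of b]
          have "In c u" using \<open>\<sigma> u = Some c\<close> s1 by blast
          moreover have "b = c" using k i ad c(3) by blast
          ultimately show False using cen[of b u] crad(3)[OF c(2)] uS unfolding In_def by blast
        qed
        have Qs: "Q u x = {\<pi> x}" if x: "cr u x" "x \<in> S" for x
        proof -
          have "\<sigma> x \<noteq> None" using inner[OF x(1) uS x(2)] un by metis
          then obtain c where sx: "\<sigma> x = Some c" by blast
          then have "In c x" using s1 by blast
          have "\<pi> g = \<pi> x" if "g \<in> N x \<inter> C - {u}" for g
          proof -
            have "g = c" using key[OF x(1) uS x(2) sx, of g] that by (auto simp: N_iff)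
            then show ?thesis using sx sc[of c] \<open>In c x\<close> pS CS x(2) unfolding In_def by auto
          qed
          then show ?thesis unfolding QI[OF uS x(2)] by auto
        qed
        have "\<pi> a \<noteq> \<pi> b"
        proof
          assume "\<pi> a = \<pi> b"
          then have e: "\<sigma> a = \<sigma> b" using pS 4 by simp
          then obtain c where cc: "In c a" "In c b" using i un s1 by (metis not_None_eq)
          have "c \<noteq> a" "c \<noteq> b" using cc cen[of c u] crad(3)[OF c(1)] crad(3)[OF c(2)] uS unfolding In_def by blast+
          then have "adj c a" "adj c b" "c \<noteq> u" using cc un s0 sc[of c] unfolding In_def by auto
          then show False using two_common[of c a b u] ad c(3) by blast
        qed
        then show ?thesis using Qs[OF c(1) 4(1)] Qs[OF c(2) 4(2)] by simp
      qed
    qed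
    show "Q a b \<subseteq> Q u a" if c: "cr u a" "cr a b" "b \<noteq> u" and le: "\<rho> {u, a} \<le> \<rho> {a, b}" for u a b
    proof (cases "u \<in> S")
      case False
      have aS: "a \<in> S" using c(1) pT[OF False] pT[of a] unfolding cr_def by metis
      have bS: "b \<in> S"
      proof (rule ccontr)
        assume "b \<notin> S"
        then show False using out1[OF aS, of u b] crad[OF c(1)] crad[OF c(2)] False c(3) by blast
      qed
      note i = inner[OF c(2) aS bS]
      have "u \<noteq> h" using cen[of a b] i c(2) bS crad[OF c(1)] by blast
      then have "Q u a = - {None}" unfolding QT[OF False] by simp
      moreover have "None \<notin> Q a b" unfolding QI[OF aS bS] using pS CS bS by auto
      ultimately show ?thesis by blast
    next
      case uS: True
      show ?thesis
      proof (cases "a \<in> S")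
        case False
        have bS: "b \<in> S" using c(2) pT[OF False] pT[of b] unfolding cr_def by metis
        have ah: "a = h" using in1[OF False _ _ _ uS bS] crad[OF c(1)] crad[OF c(2)] c(3) by blast
        have "b \<in> S \<inter> N h - {u}" using bS c(3) crad[OF c(2)] ah by (auto simp: N_iff)
        then show ?thesis unfolding QS[OF uS False] QT[OF False] using ah by auto
      next
        case aS: True
        have bS: "b \<in> S"
        proof (rule ccontr)
          assume "b \<notin> S"
          then show False using le uS aS unfolding \<rho>_def by auto
        qed
        note i = inner[OF c(1) uS aS] inner[OF c(2) aS bS]
        have bN: "\<pi> b \<in> \<pi> ` (N a \<inter> C - {u})" using i c(3) crad[OF c(2)] by (auto simp: N_iff)
        have an: "\<sigma> a = None"
        proof (rule ccontr)
          assume "\<sigma> a \<noteq> None"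
          then obtain c where sac: "\<sigma> a = Some c" by auto
          have "b = c" using key[OF c(1) uS aS sac, of b] i crad[OF c(2)] c(3) by blast
          moreover have "In c a" using sac s1 by blast
          ultimately show False using cen[of b a] crad(3)[OF c(2)] aS unfolding In_def by blast
        qed
        have "Q a b = {\<pi> b}"
        proof -
          have "\<sigma> b \<noteq> None" using i(2) an by metis
          then obtain c where sx: "\<sigma> b = Some c" by blast
          then have "In c b" using s1 by blast
          have "\<pi> g = \<pi> b" if "g \<in> N b \<inter> C - {a}" for g
          proof -
            have "g = c" using key[OF c(2) aS bS sx, of g] that by (auto simp: N_iff)
            then show ?thesis using sx sc[of c] \<open>In c b\<close> pS CS bS unfolding In_def by auto
          qed
          then show ?thesis unfolding QI[OF aS bS] by auto
        qed
        then show ?thesis using bN unfolding QI[OF uS aS] by auto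
      qed
    qed
  qed
qed

end

section \<open>Two tokens with a common neighbour\<close>

lemma load_cut_compl:
  assumes "load_cut B m S l" shows "load_cut B m (B - S) l"
proof -
  have "l u v + l v u = (if u \<in> B - S \<longleftrightarrow> v \<in> B - S then 0 else m u v)" if "u \<in> B" "v \<in> B" for u v
  proof -
    have "l u v + l v u = (if u \<in> S \<longleftrightarrow> v \<in> S then 0 else m u v)" using assms that unfolding load_cut_def by blast
    then show ?thesis using that by auto
  qed
  then show ?thesis using assms unfolding load_cut_def by auto
qed

lemma sum_remove3:
  fixes f :: "'a \<Rightarrow> nat"
  assumes "finite B" "x \<in> B" "y \<in> B" "z \<in> B" "x \<noteq> y" "x \<noteq> z" "y \<noteq> z"
  shows "sum f B = sum f (B - {x, y, z}) + (f x + f y + f z)"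
proof -
  have "sum f B = sum f (B - {x, y, z}) + sum f {x, y, z}" by (rule sum.subset_diff) (use assms in auto)
  then show ?thesis using assms(5-7) by simp
qed

context bad_graph
begin

lemma no_load_cut: "\<not> load_cut B (mult {}) S l"
proof
  assume "load_cut B (mult {}) S l"
  then show False by (rule load_cut_False[of "{}" S l "{}", OF empty_subsetI]) simp_all
qed

text \<open>Cut the graph without \<open>t1\<close>, \<open>t2\<close>, \<open>w\<close> and their neighbours of degree 2. If the cut does not extend
  to the whole graph, even with one token, then it separates \<open>oo\<close> from \<open>x1\<close> and \<open>x2\<close>, and
  \<open>{w, t1, b1}\<close> becomes a third part.\<close>

lemma twin_False:
  assumes t: "t1 \<in> D" "t2 \<in> D" and b: "b1 \<in> V2" "b2 \<in> V2"
    and Nt: "N t1 = {x2, w, b1}" "N t2 = {x1, w, b2}"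
    and Nb: "N b1 = {t1, x1}" "N b2 = {t2, x2}"
    and w: "N w = {t1, t2, oo}" "w \<in> B" "oo \<in> B"
    and x: "x1 \<in> B" "x2 \<in> B" "x1 \<noteq> x2" and t12: "t1 \<noteq> t2" and b12: "b1 \<noteq> b2"
    and sum: "(\<Sum>x\<in>B. 2 * d0 x + d1 x) < 6 * card B"
  shows False
proof -
  have tB: "t1 \<in> B" "t2 \<in> B" using t unfolding D_def by auto
  have notV2: "v \<notin> V2" if "v \<in> B" for v using that V_split by blast
  have a: "adj t1 v \<longleftrightarrow> v \<in> {x2, w, b1}" "adj t2 v \<longleftrightarrow> v \<in> {x1, w, b2}"
    "adj b1 v \<longleftrightarrow> v \<in> {t1, x1}" "adj b2 v \<longleftrightarrow> v \<in> {t2, x2}" "adj w v \<longleftrightarrow> v \<in> {t1, t2, oo}" for v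
    by (simp_all only: Nt Nb w(1) N_iff[symmetric])
  have a': "adj v t1 \<longleftrightarrow> v \<in> {x2, w, b1}" "adj v t2 \<longleftrightarrow> v \<in> {x1, w, b2}"
    "adj v b1 \<longleftrightarrow> v \<in> {t1, x1}" "adj v b2 \<longleftrightarrow> v \<in> {t2, x2}" "adj v w \<longleftrightarrow> v \<in> {t1, t2, oo}" for v
    by (subst adj_sym, rule a)+
  have e: "adj t1 x2" "adj t1 w" "adj t1 b1" "adj t2 x1" "adj t2 w" "adj t2 b2" "adj b1 x1" "adj b2 x2" "adj w oo"
    "adj w t1" "adj w t2" "adj oo w" by (simp_all add: a a')
  have tw: "t1 \<noteq> w" "t2 \<noteq> w" using adj_neq e by blast+
  have nt: "\<not> adj t1 t2" using D_indep t by blast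
  have bneB: "b1 \<notin> B" "b2 \<notin> B" using b notV2 by blast+
  have cardw: "card (N w) \<ge> 3" using B_deg w(2) .
  have ow: "oo \<noteq> t1" "oo \<noteq> t2"
    using cardw w(1) card_insert_le_m1 by (auto simp: card_insert_if split: if_splits)
  have dist: "x1 \<noteq> w" "x2 \<noteq> w" "x1 \<noteq> t1" "x2 \<noteq> t1" "x1 \<noteq> t2" "x2 \<noteq> t2" "oo \<noteq> w"
  proof -
    have c: "card (N b1) = 2" "card (N b2) = 2" using b unfolding V2_def by auto
    show "x1 \<noteq> t1" "x2 \<noteq> t2" using c Nb by auto
    show "x2 \<noteq> t1" "x1 \<noteq> t2" "oo \<noteq> w" using adj_neq e by blast+
    have "card (N t1) \<ge> 3" "card (N t2) \<ge> 3" using B_deg tB by auto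
    then show "x1 \<noteq> w" "x2 \<noteq> w" unfolding Nt by (auto simp: card_insert_if split: if_splits)
  qed
  have ox: "oo \<noteq> x1" "oo \<noteq> x2" "\<not> adj oo x1" "\<not> adj oo x2"
  proof -
    show "oo \<noteq> x1" using no_tri[OF e(5,4)] e(9) by blast
    show "oo \<noteq> x2" using no_tri[OF e(2,1)] e(9) by blast
    show "\<not> adj oo x1"
    proof
      assume "adj oo x1"
      then show False using two_common[of oo x1 w t2] e ow(2) dist(1) by blast
    qed
    show "\<not> adj oo x2"
    proof
      assume "adj oo x2"
      then show False using two_common[of oo x2 w t1] e ow(1) dist(2) by blast
    qed
  qed
  define B' where "B' = B - {t1, t2, w}"
  define m where "m = mult {}"
  have msym: "m u v = m v u" for u v unfolding m_def by (rule mult_sym)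
  have NB: "d0 t1 = 2" "d0 t2 = 2" "d0 w = 3" "d1 t1 = 1" "d1 t2 = 1" "d1 w = 0"
  proof -
    show "d0 t1 = 2" "d0 t2 = 2" using t unfolding D_def by auto
    have "N w \<inter> B = N w" "N w \<inter> V2 = {}" using w tB notV2 by auto
    moreover have "card (N w) = 3" using w(1) ow t12 by simp
    ultimately show "d0 w = 3" "d1 w = 0" unfolding d0_def d1_def by simp_all
    have "N t1 \<inter> V2 = {b1}" "N t2 \<inter> V2 = {b2}" using Nt x w b notV2 by auto
    then show "d1 t1 = 1" "d1 t2 = 1" unfolding d1_def by simp_all
  qed
  have row: "(\<Sum>y\<in>B. m u y) = 2 * d0 u + d1 u" if "u \<in> B" for u
    unfolding m_def using sum_mult_row[OF that, of "{}"] by (simp add: d1_def)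
  have rows: "(\<Sum>y\<in>B. m t1 y) = 5" "(\<Sum>y\<in>B. m t2 y) = 5" "(\<Sum>y\<in>B. m w y) = 6"
    using row[OF tB(1)] row[OF tB(2)] row[OF w(2)] NB by simp_all
  have nb12: "\<not> (\<exists>c\<in>V2. adj t1 c \<and> adj c t2)"
    unfolding a a' using b12 notV2 w x by blast
  have mv: "m t1 w = 2" "m t2 w = 2" "m t1 t2 = 0" "m u u = 0" for u
    using a tw t12 nt nb12 unfolding m_def mult_def by auto
  have B'3: "sum f B = sum f B' + (f t1 + f t2 + f w)" for f :: "'a \<Rightarrow> nat"
    unfolding B'_def using sum_remove3[OF finite_B tB w(2) t12 tw] .
  have cB: "card B = card B' + 3"
    using B'3[of "\<lambda>_. 1"] by simp
  have cols: "(\<Sum>y\<in>B'. m t1 y) = 3" "(\<Sum>y\<in>B'. m t2 y) = 3" "(\<Sum>y\<in>B'. m w y) = 2"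
    using rows B'3[of "m t1"] B'3[of "m t2"] B'3[of "m w"] mv msym[of w] msym[of t2 t1] by simp_all
  have "(\<Sum>u\<in>B. \<Sum>v\<in>B. m u v) = (\<Sum>u\<in>B'. \<Sum>v\<in>B. m u v) + 16"
    using B'3[of "\<lambda>u. \<Sum>v\<in>B. m u v"] rows by simp
  also have "(\<Sum>u\<in>B'. \<Sum>v\<in>B. m u v) = (\<Sum>u\<in>B'. \<Sum>v\<in>B'. m u v) + (\<Sum>u\<in>B'. m t1 u + m t2 u + m w u)"
    unfolding B'3 by (simp add: sum.distrib msym)
  also have "(\<Sum>u\<in>B'. m t1 u + m t2 u + m w u) = 8" by (simp add: sum.distrib cols)
  \<comment> \<open>Removing the three vertices takes 24 from the double sum but only 18 from
    \<open>6 * card B\<close>. The difference is exactly the 6 that \<open>load_cut_exists\<close>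
    demands.\<close>
  finally have tot: "(\<Sum>u\<in>B'. \<Sum>v\<in>B'. m u v) + 24 = (\<Sum>x\<in>B. 2 * d0 x + d1 x)"
    using sum_mult[of "{}"] unfolding m_def by simp
  have fB': "finite B'" unfolding B'_def using finite_B by simp
  have xB': "x1 \<in> B'" "x2 \<in> B'" "oo \<in> B'" unfolding B'_def using x w dist ow by auto
  have "card {x1, x2} \<le> card B'" using xB' fB' by (intro card_mono) auto
  then have "card B' \<ge> 2" using x(3) by simp
  then have "\<exists>S l. load_cut B' m S l"
    by (rule load_cut_exists[OF fB' _ msym mv(4)]) (use tot sum cB in simp)
  then obtain S0 l0 where "load_cut B' m S0 l0" by blast
  then have "\<exists>S l. load_cut B' m S l \<and> oo \<in> S"
    using load_cut_compl[of B' m S0 l0] xB'(3) by (cases "oo \<in> S0") auto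
  then obtain S l where cut: "load_cut B' m S l" and oS: "oo \<in> S" by blast
  have S: "S \<subseteq> B'" "S \<noteq> {}" "S \<noteq> B'"
    and lm: "\<And>u v. u \<in> B' \<Longrightarrow> v \<in> B' \<Longrightarrow> l u v + l v u = (if u \<in> S \<longleftrightarrow> v \<in> S then 0 else m u v)"
    and ls: "\<And>u. u \<in> B' \<Longrightarrow> sum (l u) B' \<le> 1"
    using cut unfolding load_cut_def by auto
  have BB': "v \<in> B' \<or> v = t1 \<or> v = t2 \<or> v = w" if "v \<in> B" for v using that unfolding B'_def by blast
  have B'B: "v \<in> B" "v \<noteq> t1" "v \<noteq> t2" "v \<noteq> w" if "v \<in> B'" for v using that unfolding B'_def by auto
  have wV2: "\<not> (\<exists>c\<in>V2. adj w c)" unfolding a using w(3) notV2 tB by blast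
  \<comment> \<open>Here \<open>xa\<close> is on the side of \<open>oo\<close> and \<open>xb\<close>
    is not. \<open>w\<close> and \<open>tb\<close> join \<open>oo\<close>, \<open>ta\<close> joins
    \<open>xb\<close>, and \<open>ba\<close> is deleted with \<open>ta\<close> as its token. The cut
    edge between \<open>ta\<close> and \<open>w\<close> loads both ends, and the cut path from
    \<open>tb\<close> to \<open>xb\<close> loads \<open>tb\<close>.\<close>
  have opp: False
    if q: "ta \<in> D" "tb \<in> D" "ta \<noteq> tb" "{ta, tb, w} = {t1, t2, w}" "N ta = {xb, w, ba}" "N tb = {xa, w, bb}" "N ba = {ta, xa}" "N bb = {tb, xb}"
      "ba \<in> V2" "bb \<in> V2" "ba \<noteq> bb" "xa \<in> S" "xb \<in> B'" "xb \<notin> S" "N w = {ta, tb, oo}"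
    for ta tb xa xb ba bb
  proof -
    have B'q: "B' = B - {ta, tb, w}" unfolding B'_def using q(4) by simp
    have Bq: "ta \<in> B" "tb \<in> B" using q(1,2) unfolding D_def by auto
    have nV2: "ta \<notin> V2" "tb \<notin> V2" "w \<notin> V2" "xa \<notin> V2" "xb \<notin> V2" "oo \<notin> V2"
      using Bq w q(12,13) S(1) B'B notV2 by blast+
    have nB: "ba \<notin> B" "bb \<notin> B" using q(9,10) notV2 by blast+
    have dq: "ta \<noteq> w" "tb \<noteq> w" "xb \<noteq> tb" "xb \<noteq> ta" "xb \<noteq> w" "xa \<noteq> ta" "xa \<noteq> tb" "xa \<noteq> w"
      "xa \<noteq> xb" "oo \<noteq> xb" "oo \<noteq> ta" "oo \<noteq> tb" "ta \<notin> S" "tb \<notin> S" "w \<notin> S"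
    proof -
      have "adj w ta" "adj w tb" unfolding N_iff[symmetric] q(15) by simp_all
      then show "ta \<noteq> w" "tb \<noteq> w" using adj_neq by blast+
      have "xa \<in> B'" "xb \<in> B'" "oo \<in> B'" using q(12,13) oS S(1) by auto
      then show "xb \<noteq> tb" "xb \<noteq> ta" "xb \<noteq> w" "xa \<noteq> ta" "xa \<noteq> tb" "xa \<noteq> w" "oo \<noteq> ta" "oo \<noteq> tb"
        unfolding B'q by auto
      show "xa \<noteq> xb" "oo \<noteq> xb" using q(12,14) oS by auto
      show "ta \<notin> S" "tb \<notin> S" "w \<notin> S" using S(1) unfolding B'q by auto
    qed
    have aq: "adj ta v \<longleftrightarrow> v \<in> {xb, w, ba}" "adj tb v \<longleftrightarrow> v \<in> {xa, w, bb}"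
      "adj ba v \<longleftrightarrow> v \<in> {ta, xa}" "adj bb v \<longleftrightarrow> v \<in> {tb, xb}" "adj w v \<longleftrightarrow> v \<in> {ta, tb, oo}" for v
      by (simp_all only: q(5-8,15) N_iff[symmetric])
    have aq': "adj v ba \<longleftrightarrow> v \<in> {ta, xa}" for v
      by (subst adj_sym, rule aq)
    have mta: "mult {ba} ta v = (if v \<in> {xb, w} then 2 else 0)" if "v \<in> B" for v
    proof -
      have "\<not> (\<exists>c\<in>V2 - {ba}. adj ta c \<and> adj c v)" unfolding aq using nV2 by blast
      then show ?thesis unfolding mult_def aq using that nB dq by auto
    qed
    have mtb: "mult {ba} tb v = (if v \<in> {xa, w} then 2 else if v = xb then 1 else 0)" if v: "v \<in> B" for v
    proof -
      have "(\<exists>c\<in>V2 - {ba}. adj tb c \<and> adj c v) \<longleftrightarrow> v = tb \<or> v = xb"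
      proof
        assume "\<exists>c\<in>V2 - {ba}. adj tb c \<and> adj c v"
        then have "adj bb v" unfolding aq(2) using nV2 by blast
        then show "v = tb \<or> v = xb" unfolding aq by blast
      next
        assume "v = tb \<or> v = xb"
        then show "\<exists>c\<in>V2 - {ba}. adj tb c \<and> adj c v" using q(10,11) aq(2)[of bb] aq(4)[of v] by blast
      qed
      then show ?thesis unfolding mult_def aq using v nB dq by auto
    qed
    have mw: "mult {ba} w v = (if v \<in> {ta, tb, oo} then 2 else 0)" for v
    proof -
      have "\<not> (\<exists>c\<in>V2 - {ba}. adj w c \<and> adj c v)" using wV2 by blast
      then show ?thesis unfolding mult_def aq using dq \<open>oo \<noteq> w\<close> by auto
    qed
    have mB: "mult {ba} u v = m u v" if uv: "u \<in> B'" "v \<in> B'" for u v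
    proof (cases "u = v")
      case False
      have "\<not> (adj u ba \<and> adj ba v)" unfolding aq aq' using uv False unfolding B'q by blast
      then have "(\<exists>c\<in>V2 - {ba}. adj u c \<and> adj c v) \<longleftrightarrow> (\<exists>c\<in>V2. adj u c \<and> adj c v)" by blast
      then show ?thesis unfolding m_def mult_def by simp
    qed (simp add: m_def mult_def)
    define l' where "l' u v = (if u \<in> B' \<and> v \<in> B' then l u v
      else if u = ta \<and> v = w \<or> u = w \<and> v = ta \<or> u = tb \<and> v = xb then 1 else 0)" for u v
    define S' where "S' = insert w (insert tb S)"
    have S': "w \<in> S'" "tb \<in> S'" "ta \<notin> S'" "xb \<notin> S'" "oo \<in> S'" "xa \<in> S'"
      unfolding S'_def using q dq oS by auto
    have S'B: "u \<in> S' \<longleftrightarrow> u \<in> S" if "u \<in> B'" for u using that unfolding S'_def B'q by auto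
    have l'n: "l' ta v = (if v = w then 1 else 0)" "l' tb v = (if v = xb then 1 else 0)" "l' w v = (if v = ta then 1 else 0)"
      "l' v ta = (if v = w then 1 else 0)" "l' v tb = 0" "l' v w = (if v = ta then 1 else 0)" for v
      unfolding l'_def B'q using dq q(3) by auto
    define Pg where "Pg u v \<longleftrightarrow> l' u v + l' v u = (if u \<in> S' \<longleftrightarrow> v \<in> S' then 0 else mult {ba} u v)" for u v
    have Pgs: "Pg u v \<longleftrightarrow> Pg v u" for u v unfolding Pg_def mult_sym[of "{ba}" u v] by auto
    have Pta: "Pg ta v" if "v \<in> B" for v unfolding Pg_def mta[OF that] l'n using S' dq by auto
    have Ptb: "Pg tb v" if "v \<in> B" for v unfolding Pg_def mtb[OF that] l'n using S' dq by auto
    have Pw: "Pg w v" for v unfolding Pg_def mw l'n using S' dq by auto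
    have PB: "Pg u v" if "u \<in> B'" "v \<in> B'" for u v
      unfolding Pg_def mB[OF that] S'B[OF that(1)] S'B[OF that(2)] using lm[OF that] that by (simp add: l'_def)
    have Pall: "Pg u v" if "u \<in> B" "v \<in> B" for u v
      using that Pta Ptb Pw PB Pgs[of u v] B'q by blast
    have s3: "sum f B = sum f B' + (f ta + f tb + f w)" for f :: "'a \<Rightarrow> nat"
      unfolding B'q using sum_remove3[OF finite_B Bq w(2) q(3) dq(1,2)] .
    have l'1: "sum (l' u) B \<le> 1" if u: "u \<in> B" for u
    proof -
      consider "u \<in> B'" | "u = ta" | "u = tb" | "u = w" using u B'q by blast
      then show ?thesis
      proof cases
        case 1
        have "sum (l' u) B' = sum (l u) B'" using 1 by (intro sum.cong) (auto simp: l'_def)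
        moreover have "u \<noteq> ta" "u \<noteq> w" using 1 unfolding B'q by auto
        ultimately show ?thesis unfolding s3 l'n using ls[OF 1] by simp
      qed (use finite_B u w(2) Bq B'B(1)[OF q(13)] in \<open>simp_all add: l'n\<close>)
    qed
    have "load_cut B (mult {ba}) S' l'"
      unfolding load_cut_def
    proof (intro conjI ballI)
      show "S' \<subseteq> B" using S(1) w(2) Bq B'q unfolding S'_def by auto
      show "S' \<noteq> {}" "S' \<noteq> B" using S' Bq by auto
      show "l' u v + l' v u = (if u \<in> S' \<longleftrightarrow> v \<in> S' then 0 else mult {ba} u v)" if "u \<in> B" "v \<in> B" for u v
        using Pall[OF that] unfolding Pg_def .
      show "sum (l' u) B \<le> 1" if "u \<in> B" for u using l'1[OF that] .
    qed
    then show False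
    proof (rule load_cut_False[of "{ba}" S' l' "{ta}", rotated])
      show "{ba} \<subseteq> V2" "{ta} \<subseteq> D" using q by auto
      show "c \<in> {ba}" if "z \<in> {ta}" "c \<in> V2" "adj z c" for z c using that nV2 aq(1)[of c] by auto
      show "\<exists>z x. N c = {z, x} \<and> z \<in> {ta} \<and> x \<notin> {ta}" if "c \<in> {ba}" for c using that q(7) dq by blast
    qed auto
  qed
  consider (same) "x1 \<in> S" "x2 \<in> S" | (o1) "x1 \<in> S" "x2 \<notin> S" | (o2) "x1 \<notin> S" "x2 \<in> S" | (parts) "x1 \<notin> S" "x2 \<notin> S" by blast
  then show False
  proof cases
    case o1
    then show False using opp[of t1 t2 x2 b1 x1 b2] t t12 Nt Nb b b12 xB' w(1) by blast
  next
    case o2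
    have "{t2, t1, w} = {t1, t2, w}" "N w = {t2, t1, oo}" using w(1) by auto
    then show False using opp[of t2 t1 x1 b2 x2 b1] o2 t t12 Nt Nb b b12 xB' by blast
  next
    case same
    \<comment> \<open>All vertices through which \<open>t1\<close>, \<open>t2\<close> and
      \<open>w\<close> are attached lie in \<open>S\<close>, so these three join \<open>S\<close>
      and the cut gains no weight.\<close>
    define S' where "S' = S \<union> {t1, t2, w}"
    define l' where "l' u v = (if u \<in> B' \<and> v \<in> B' then l u v else 0)" for u v
    have S'B: "u \<in> S' \<longleftrightarrow> u \<in> S" if "u \<in> B'" for u using that B'B unfolding S'_def by auto
    have m0: "m u v = 0" if u: "u \<in> {t1, t2, w}" and v: "v \<in> B" "v \<notin> S'" for u v
    proof -
      have vn: "v \<notin> {t1, t2, w, oo, x1, x2, b1, b2}" using v same oS bneB unfolding S'_def by auto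
      have "\<not> adj u v" using u vn a(1,2,5)[of v] by blast
      moreover have "\<not> (\<exists>c\<in>V2. adj u c \<and> adj c v)"
      proof
        assume "\<exists>c\<in>V2. adj u c \<and> adj c v"
        then obtain c where c: "c \<in> V2" "adj u c" "adj c v" by blast
        have "c \<notin> {w, x1, x2}" using c(1) notV2 w x by blast
        then have "c = b1 \<or> c = b2" using u c(1,2) wV2 a(1,2)[of c] by blast
        then show False using c(3) vn a(3,4)[of v] by blast
      qed
      ultimately show ?thesis unfolding m_def mult_def by auto
    qed
    have "load_cut B m S' l'" unfolding load_cut_def
    proof (intro conjI ballI)
      show "S' \<subseteq> B" using S(1) w(2) tB B'B(1) unfolding S'_def by blast
      show "S' \<noteq> {}" unfolding S'_def by simp
      show "S' \<noteq> B" using S S'B B'B(1) by blast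
      fix u assume u: "u \<in> B"
      show "sum (l' u) B \<le> 1"
      proof (cases "u \<in> B'")
        case True
        then have "sum (l' u) B' = sum (l u) B'" by (intro sum.cong) (auto simp: l'_def)
        then show ?thesis unfolding B'3 using ls[OF True] B'B by (auto simp: l'_def)
      next
        case False
        then show ?thesis by (simp add: l'_def)
      qed
      fix v assume v: "v \<in> B"
      show "l' u v + l' v u = (if u \<in> S' \<longleftrightarrow> v \<in> S' then 0 else m u v)"
      proof (cases "u \<in> B' \<and> v \<in> B'")
        case True
        then show ?thesis using lm[of u v] S'B by (simp add: l'_def)
      next
        case False
        then have "u \<in> {t1, t2, w} \<or> v \<in> {t1, t2, w}" using BB' u v by blast
        moreover have "{t1, t2, w} \<subseteq> S'" unfolding S'_def by blast
        ultimately have "(u \<in> S') = (v \<in> S') \<or> m u v = 0" using m0[of u v] m0[of v u] msym[of u v] u v by (metis subsetD)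
        then show ?thesis using False by (auto simp: l'_def)
      qed
    qed
    then show False using no_load_cut unfolding m_def by blast
  next
    case parts
    define U where "U = V2 - {b1, b2}"
    define G where "G = B' \<union> U"
    have UN: "p \<in> B'" if "c \<in> U" "adj c p" for c p
    proof -
      have "p \<in> B" using V2_B[of c p] that unfolding U_def by blast
      moreover have "c \<notin> B" using that(1) notV2 unfolding U_def by blast
      then have "\<not> adj c t1" "\<not> adj c t2" "\<not> adj c w"
        using that(1) x w(2,3) tB unfolding a' U_def by auto
      ultimately show ?thesis using that(2) BB' by metis
    qed
    have sub: "B' \<subseteq> B" "U \<subseteq> V2 - {}" unfolding B'_def U_def by blast+
    obtain P where PS: "\<And>v. v \<in> B' \<Longrightarrow> v \<in> P \<longleftrightarrow> v \<in> S" and PG: "P \<subseteq> G"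
      and match: "\<And>u p q. u \<in> G \<Longrightarrow> p \<in> G \<Longrightarrow> q \<in> G \<Longrightarrow> adj u p \<Longrightarrow> adj u q \<Longrightarrow>
        (p \<in> P) \<noteq> (u \<in> P) \<Longrightarrow> (q \<in> P) \<noteq> (u \<in> P) \<Longrightarrow> p = q"
    proof (rule load_cut_matching[of B' U "{}" S l, OF sub UN cut[unfolded m_def]])
      fix P
      assume "\<And>v. v \<in> B' \<Longrightarrow> v \<in> P \<longleftrightarrow> v \<in> S" "P \<subseteq> B' \<union> U"
        "\<And>u p q. u \<in> B' \<union> U \<Longrightarrow> p \<in> B' \<union> U \<Longrightarrow> q \<in> B' \<union> U \<Longrightarrow> adj u p \<Longrightarrow> adj u q \<Longrightarrow>
          (p \<in> P) \<noteq> (u \<in> P) \<Longrightarrow> (q \<in> P) \<noteq> (u \<in> P) \<Longrightarrow> p = q"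
      then show thesis unfolding G_def[symmetric] by (rule that)
    qed
    have Gn: "t1 \<notin> G" "t2 \<notin> G" "w \<notin> G" "b1 \<notin> G" "b2 \<notin> G"
      unfolding G_def U_def B'_def using tB w bneB notV2 by auto
    have Gx: "x1 \<in> G" "x2 \<in> G" "oo \<in> G" using xB' unfolding G_def by auto
    have Px: "x1 \<notin> P" "x2 \<notin> P" "oo \<in> P" using PS xB' parts oS by auto
    have Pn: "t1 \<notin> P" "t2 \<notin> P" "w \<notin> P" "b1 \<notin> P" "b2 \<notin> P" using Gn PG by auto
    have VG: "v \<in> G \<or> v \<in> {t1, t2, w, b1, b2}" if "v \<in> V" for v
      using that BB' V_split unfolding G_def U_def by blast
    have bn: "b1 \<noteq> t1" "b1 \<noteq> t2" "b1 \<noteq> w" "b2 \<noteq> t1" "b2 \<noteq> t2" "b2 \<noteq> w" using bneB tB w by auto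
    have xn: "b1 \<noteq> x1" "b1 \<noteq> x2" "b2 \<noteq> x1" "b2 \<noteq> x2" "oo \<noteq> b1" "oo \<noteq> b2" using bneB x w by auto
    define \<pi> where "\<pi> v = (if v \<in> {w, t1, b1} then 0 else if v \<in> P then 2 else (1::nat))" for v
    have pv: "\<pi> w = 0" "\<pi> t1 = 0" "\<pi> b1 = 0" "\<pi> x1 = 1" "\<pi> x2 = 1" "\<pi> t2 = 1" "\<pi> b2 = 1" "\<pi> oo = 2"
      unfolding \<pi>_def using Px Pn dist tw t12 bn xn b12 ow by auto
    have pG: "\<pi> v = (if v \<in> P then 2 else 1)" if "v \<in> G" for v
      using that Gn unfolding \<pi>_def by auto
    define cr where "cr u v \<longleftrightarrow> adj u v \<and> \<pi> u \<noteq> \<pi> v" for u v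
    define M where "M u v \<longleftrightarrow> u \<in> G \<and> v \<in> G \<and> adj u v \<and> (u \<in> P) \<noteq> (v \<in> P)" for u v
    have Ms: "M v u" if "M u v" for u v using that unfolding M_def by (auto simp: insert_commute)
    have M1: "p = q" if "M u p" "M u q" for u p q using match[of u p q] that unfolding M_def by blast
    \<comment> \<open>An old cut edge from \<open>oo\<close> to \<open>x1\<close> or
      \<open>x2\<close> would open two ways into the third part from one vertex, directly and
      through the other end.\<close>
    have Mox: "\<not> M oo x1" "\<not> M oo x2" "\<not> M x1 oo" "\<not> M x2 oo"
      using ox Ms unfolding M_def by blast+
    have half: "u = t1 \<and> v = x2 \<or> u = b1 \<and> v = x1 \<or> u = w \<and> (v = t2 \<or> v = oo)"
      if "cr u v" "\<pi> u = 0" for u v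
    proof -
      have "u = w \<or> u = t1 \<or> u = b1" "adj u v" "\<pi> v \<noteq> 0" using that unfolding cr_def \<pi>_def by (auto split: if_splits)
      then show ?thesis using a(1,3,5)[of v] pv by auto
    qed
    have crs: "cr v u" if "cr u v" for u v using that unfolding cr_def by (auto simp: insert_commute)
    have crM: "M u v" if c: "cr u v" "\<pi> u \<noteq> 0" "\<pi> v \<noteq> 0" for u v
    proof -
      have in_G: "u \<in> G" if c: "cr u v" "\<pi> u \<noteq> 0" "\<pi> v \<noteq> 0" for u v
      proof (rule ccontr)
        assume "u \<notin> G"
        moreover have "u \<in> V" "adj u v" using c adj_V unfolding cr_def by auto
        ultimately have "u = t2 \<or> u = b2" using VG[of u] c(2) pv by auto
        then show False using \<open>adj u v\<close> a(2,4)[of v] c pv unfolding cr_def by auto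
      qed
      have "u \<in> G" "v \<in> G" using in_G[OF c] in_G[OF crs[OF c(1)]] c by auto
      then show ?thesis using c(1) pG[of u] pG[of v] unfolding M_def cr_def by (auto split: if_splits)
    qed
    \<comment> \<open>Old cut edges get -3, the edges leaving the third part -2, and the edge
      between \<open>w\<close> and \<open>oo\<close> gets -1. So a path may enter the third part
      after an old cut edge but use none afterwards, and it can pass through \<open>w\<close> from
      \<open>t2\<close> to \<open>oo\<close> but not back.\<close>
    define \<rho> where "\<rho> e = (if e = {oo, w} then -1 else if e \<inter> {w, t1, b1} \<noteq> {} then -2 else -3 :: real)" for e
    have \<rho>: "\<rho> {t1, x2} = -2" "\<rho> {x2, t1} = -2" "\<rho> {b1, x1} = -2" "\<rho> {x1, b1} = -2" "\<rho> {w, t2} = -2" "\<rho> {t2, w} = -2"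
      "\<rho> {oo, w} = -1" "\<rho> {w, oo} = -1"
      unfolding \<rho>_def using tw dist ow bn xn ox by (auto simp: doubleton_eq_iff)
    have \<rho>M: "\<rho> {u, v} = -3" if "M u v" for u v
      using that Gn unfolding \<rho>_def M_def by (auto simp: doubleton_eq_iff)
    define Q where "Q u p = (if u = t2 \<and> p = w then {0, 2} else if u \<in> P \<and> (p = x1 \<or> p = x2) then {0, 1}
      else if u \<in> G - P \<and> p = oo then {0, 2} else {\<pi> p})" for u p
    have Qv: "Q t1 x2 = {1}" "Q x2 t1 = {0}" "Q b1 x1 = {1}" "Q x1 b1 = {0}" "Q w t2 = {1}" "Q t2 w = {0, 2}"
      "Q oo w = {0}" "Q w oo = {2}"
      unfolding Q_def using tw dist ow bn xn ox Pn Gn Px t12 pv by auto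
    have QM: "Q u p = (if p = oo then {0, 2} else if p \<in> P then {2} else if p = x1 \<or> p = x2 then {0, 1} else {1})"
      if "M u p" for u p
      using that Gn Gx Px Pn pG[of p] unfolding Q_def M_def by auto
    have cases: "u = t1 \<and> v = x2 \<or> u = x2 \<and> v = t1 \<or> u = b1 \<and> v = x1 \<or> u = x1 \<and> v = b1 \<or> u = w \<and> v = t2
      \<or> u = t2 \<and> v = w \<or> u = w \<and> v = oo \<or> u = oo \<and> v = w \<or> M u v" if "cr u v" for u v
      using half[of u v] half[of v u] crM[of u v] that crs by blast
    have nM: "\<not> M t1 v" "\<not> M b1 v" "\<not> M w v" "\<not> M t2 v" "\<not> M v t1" "\<not> M v b1" "\<not> M v w" "\<not> M v t2" for v
      using Gn unfolding M_def by auto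
    have MP: "(v \<in> P) \<noteq> (u \<in> P)" if "M u v" for u v using that unfolding M_def by blast
    note ds = tw dist ow bn xn ox(1,2) t12 x(3) b12 tw[symmetric] dist[symmetric] ow[symmetric] bn[symmetric]
      xn[symmetric] ox(1,2)[symmetric] t12[symmetric] x(3)[symmetric] b12[symmetric]
    show False
    proof (rule parts_False[of t1 t2 \<pi> cr \<rho> Q])
      show "t1 \<in> V" "t2 \<in> V" "\<pi> t1 \<noteq> \<pi> t2" using tB V_split pv by auto
      show "cr u v \<longleftrightarrow> adj u v \<and> \<pi> u \<noteq> \<pi> v" for u v unfolding cr_def ..
      show "\<rho> {u, v} < 0" for u v unfolding \<rho>_def by auto
      show "\<pi> p \<in> Q u p" for u p
        unfolding Q_def using pv by auto
      show "\<pi> u \<notin> Q u p" if c: "cr u p" for u p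
        using cases[OF c]
      proof (elim disjE)
        assume M: "M u p"
        then have "\<pi> u = (if p \<in> P then 1 else 2)" using pG[of u] unfolding M_def by auto
        then show ?thesis using QM[OF M] Px by (auto split: if_splits)
      qed (auto simp: Qv pv)
      show "Q u p \<inter> Q u q = {}" if c: "cr u p" "cr u q" "p \<noteq> q" for u p q
        using cases[OF c(1)]
      proof (elim disjE)
        assume M: "M u p"
        have "\<not> M u q" using M1[OF M] c(3) by blast
        then show ?thesis using cases[OF c(2)] M nM Mox QM[OF M] MP[OF M] Px Qv by auto
      qed (use cases[OF c(2)] c(3) nM Mox QM[of u q] MP[of u q] Px Qv ds in auto)
      show "Q p q \<subseteq> Q u p" if c: "cr u p" "cr p q" "q \<noteq> u" "\<rho> {u, p} \<le> \<rho> {p, q}" for u p q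
        using cases[OF c(1)]
      proof (elim disjE)
        assume M: "M u p"
        have "\<not> M p q" using M1[OF Ms[OF M], of q] c(3) by blast
        then show ?thesis using cases[OF c(2)] M nM QM[OF M] MP[OF M] Px Qv by auto
      qed (use cases[OF c(2)] c(3,4) nM Mox \<rho> \<rho>M[of p q] Px Qv ds in auto)
    qed
  qed
qed

end

section \<open>Counting\<close>

locale sparse_bad_graph = bad_graph +
  assumes sparse: "(\<Sum>v\<in>V. card (N v)) < 3 * card V"
begin

lemma sum_d1: "(\<Sum>x\<in>B. d1 x) = 2 * card V2"
  using double_count[OF subset_refl] unfolding d1_def .

text \<open>The degree sum is the sum of \<open>d0\<close> over \<open>B\<close> plus 4 for each
  vertex of degree 2. Being below \<open>3 * card V\<close>, it leaves less than
  \<open>3 * card B\<close> for the sum of \<open>d0\<close> plus \<open>card V2\<close>, and the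
  weight is twice that.\<close>

lemma weight: "(\<Sum>x\<in>B. 2 * d0 x + d1 x) < 6 * card B" "even (\<Sum>x\<in>B. 2 * d0 x + d1 x)"
proof -
  have e: "(\<Sum>x\<in>B. 2 * d0 x + d1 x) = 2 * ((\<Sum>x\<in>B. d0 x) + card V2)"
    using sum_d1 by (simp add: sum.distrib sum_distrib_left)
  then show "even (\<Sum>x\<in>B. 2 * d0 x + d1 x)" by simp
  have "(\<Sum>v\<in>V. card (N v)) = (\<Sum>v\<in>B. card (N v)) + (\<Sum>v\<in>V2. card (N v))"
    using sum.union_disjoint[OF finite_B finite_V2 V_split(2)] V_split(1) by simp
  also have "(\<Sum>v\<in>B. card (N v)) = (\<Sum>v\<in>B. d0 v) + 2 * card V2"
    using sum_d1 by (simp add: deg_split sum.distrib)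
  also have "(\<Sum>v\<in>V2. card (N v)) = 2 * card V2" by (simp add: V2_def)
  finally have "(\<Sum>v\<in>B. d0 v) + 2 * card V2 + 2 * card V2 < 3 * card V" using sparse by simp
  moreover have "card V = card B + card V2"
    using card_Un_disjoint[OF finite_B finite_V2 V_split(2)] V_split(1) by simp
  ultimately show "(\<Sum>x\<in>B. 2 * d0 x + d1 x) < 6 * card B" using e by simp
qed

text \<open>The vertices of \<open>D1\<close> are those of charge -1, and \<open>sb y\<close> is the only neighbour of degree 2 of such a
  vertex \<open>y\<close> (arbitrary for other \<open>y\<close>). It leads back to \<open>D\<close> for \<open>y \<in> P0\<close> and out of \<open>D\<close> for \<open>y \<in> TT\<close>.\<close>

definition D1 where "D1 = {y \<in> D. d1 y = 1}"
definition sb where "sb y = (THE a. a \<in> V2 \<and> adj y a)"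
definition P0 where "P0 = {y \<in> D1. \<exists>z\<in>D. z \<noteq> y \<and> adj (sb y) z}"
definition TT where "TT = D1 - P0"
text \<open>These are the vertices of degree 2 with both ends in \<open>D\<close> and at least one
  in \<open>D1\<close>; each can be deleted with an end in \<open>P0\<close> as its token.\<close>

definition U0 where "U0 = sb ` P0"

lemma DB: "y \<in> D \<Longrightarrow> y \<in> B" unfolding D_def by simp

lemma D_card: "y \<in> D \<Longrightarrow> d0 y = 2 \<and> d1 y \<ge> 1"
  using B_deg[of y] deg_split[of y] unfolding D_def by auto

lemma finites: "finite D" "finite D1" "finite P0" "finite TT" "finite U0"
proof -
  show "finite D" using finite_B unfolding D_def by simp
  then show "finite D1" unfolding D1_def by simp
  then show "finite P0" "finite TT" unfolding P0_def TT_def by simp_all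
  then show "finite U0" unfolding U0_def by simp
qed

lemma sb: assumes "y \<in> D1" shows "a \<in> V2 \<and> adj y a \<longleftrightarrow> a = sb y"
proof -
  have "card (N y \<inter> V2) = 1" using assms unfolding D1_def d1_def by simp
  then obtain b where "N y \<inter> V2 = {b}" by (auto simp: card_1_singleton_iff)
  then have b: "c \<in> V2 \<and> adj y c \<longleftrightarrow> c = b" for c using N_iff by blast
  then have "sb y = b" unfolding sb_def by simp
  then show ?thesis using b by simp
qed

lemma sbD: assumes "y \<in> D1" shows "sb y \<in> V2" "adj y (sb y)" "adj (sb y) y"
proof -
  show "sb y \<in> V2" "adj y (sb y)" using sb[OF assms, of "sb y"] by simp_all
  then show "adj (sb y) y" by (simp add: insert_commute)
qed

lemma sb_eq: "y \<in> D1 \<Longrightarrow> a \<in> V2 \<Longrightarrow> adj a y \<Longrightarrow> a = sb y"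
  using sb[of y a] by (simp add: insert_commute)

lemma P0_other: "z \<in> P0 \<Longrightarrow> a \<in> V2 \<Longrightarrow> adj a z \<Longrightarrow> adj a x \<Longrightarrow> x \<in> D"
proof -
  assume z: "z \<in> P0" and a: "a \<in> V2" "adj a z" "adj a x"
  obtain z' where z': "z \<in> D1" "z' \<in> D" "z' \<noteq> z" "adj (sb z) z'" using z unfolding P0_def by blast
  then have "a = sb z" using sb_eq a by blast
  then have "x = z \<or> x = z'" using V2_third[OF a(1,2), of z' x] z' a(3) by blast
  then show "x \<in> D" using z' unfolding D1_def by blast
qed

lemma TT_other: "t \<in> TT \<Longrightarrow> a \<in> V2 \<Longrightarrow> adj a t \<Longrightarrow> adj a x \<Longrightarrow> x \<in> D \<Longrightarrow> x = t"
  using sb_eq[of t a] unfolding TT_def P0_def by auto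

lemma P0_D: "y \<in> P0 \<Longrightarrow> y \<in> D1" and TT_D: "y \<in> TT \<Longrightarrow> y \<in> D1" and D1_D: "y \<in> D1 \<Longrightarrow> y \<in> D"
  unfolding P0_def TT_def D1_def by auto

lemma U0_D: assumes "a \<in> U0" "adj a x" shows "x \<in> D" "a \<in> V2"
proof -
  obtain y where "y \<in> P0" "a = sb y" using assms unfolding U0_def by blast
  then show "x \<in> D" "a \<in> V2" using P0_other[of y a x] sbD[OF P0_D, of y] assms by auto
qed

lemma card_P0: "card P0 \<le> 2 * card U0"
proof -
  have "P0 \<subseteq> (\<Union>a\<in>U0. N a)"
    using sbD(3) P0_D unfolding U0_def by (auto simp: N_iff)
  then have "card P0 \<le> card (\<Union>a\<in>U0. N a)" using finites finite_N by (intro card_mono) auto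
  also have "\<dots> \<le> (\<Sum>a\<in>U0. card (N a))" by (rule card_UN_le[OF finites(5)])
  also have "\<dots> = (\<Sum>a\<in>U0. 2)"
  proof (rule sum.cong[OF refl])
    fix a assume "a \<in> U0"
    then obtain y where "a = sb y" "y \<in> P0" unfolding U0_def by blast
    then show "card (N a) = 2" using sbD(1)[of y] P0_D unfolding V2_def by auto
  qed
  finally show ?thesis by simp
qed

text \<open>What remains of the charge if every vertex of \<open>TT\<close> passes its -1 to the other end of its neighbour
  of degree 2, and those of \<open>P0\<close> are counted separately.\<close>

definition excess where "excess x = (if x \<in> D1 then 0 else if x \<in> D then d1 x - 2
  else 2 * (d0 x - 3) + card (N x \<inter> (V2 - sb ` TT)))"

text \<open>Raising the charge by 1 on \<open>D1\<close> gives, vertex by vertex,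
  \<open>excess\<close> plus \<open>\<tau>\<close>. Each \<open>sb t\<close> with \<open>t\<close>
  in \<open>TT\<close> has exactly one end outside \<open>D\<close>, so \<open>\<tau>\<close> sums
  to \<open>card TT\<close>, which cancels against \<open>card D1\<close> and leaves
  \<open>card P0\<close>.\<close>

lemma sum_excess: "(\<Sum>x\<in>B. 2 * d0 x + d1 x) + card P0 = 6 * card B + (\<Sum>x\<in>B. excess x)"
proof -
  define T2 where "T2 = sb ` TT"
  define \<tau> where "\<tau> x = (if x \<in> D then 0 else card (N x \<inter> T2))" for x
  have inj: "inj_on sb TT"
  proof (rule inj_onI)
    fix t t' assume t: "t \<in> TT" "t' \<in> TT" "sb t = sb t'"
    have "adj (sb t) t'" using sbD(3)[OF TT_D[OF t(2)]] t(3) by simp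
    then show "t = t'"
      using TT_other[OF t(1) sbD(1,3)[OF TT_D[OF t(1)]] _ D1_D[OF TT_D[OF t(2)]]] by simp
  qed
  have T2: "T2 \<subseteq> V2" using sbD(1)[OF TT_D] unfolding T2_def by auto
  have cT2: "card T2 = card TT" unfolding T2_def by (rule card_image[OF inj])
  have ind: "(\<Sum>x\<in>B. if x \<in> X then 1 else 0) = card X" if "X \<subseteq> B" for X
    using that finite_B by (simp add: sum.If_cases Int_absorb1)
  have "card (N x \<inter> T2) = \<tau> x + (if x \<in> TT then 1 else 0)" for x
  proof (cases "x \<in> TT")
    case True
    have "N x \<inter> T2 = {sb x}"
    proof (intro set_eqI iffI)
      fix a assume "a \<in> N x \<inter> T2"
      then show "a \<in> {sb x}" using sb[OF TT_D[OF True], of a] T2 by (auto simp: N_iff)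
    next
      fix a assume "a \<in> {sb x}"
      then show "a \<in> N x \<inter> T2" using sbD(2)[OF TT_D[OF True]] True unfolding T2_def by (simp add: N_iff)
    qed
    then show ?thesis using True D1_D[OF TT_D] unfolding \<tau>_def by simp
  next
    case False
    have "N x \<inter> T2 = {}" if "x \<in> D"
    proof (rule ccontr)
      assume "N x \<inter> T2 \<noteq> {}"
      then obtain t where t: "t \<in> TT" "adj x (sb t)" unfolding T2_def by (auto simp: N_iff)
      then have "adj (sb t) x" by (simp add: insert_commute)
      then have "x = t" using TT_other[of t "sb t" x] sbD[OF TT_D[OF t(1)]] t(1) that by blast
      then show False using False t by blast
    qed
    then show ?thesis using False unfolding \<tau>_def by simp
  qed
  then have "2 * card TT = (\<Sum>x\<in>B. \<tau> x) + (\<Sum>x\<in>B. if x \<in> TT then 1 else 0)"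
    using double_count[OF T2] cT2 by (simp add: sum.distrib)
  moreover have "TT \<subseteq> B" "D1 \<subseteq> B" using DB D1_D TT_D by blast+
  ultimately have st: "(\<Sum>x\<in>B. \<tau> x) = card TT" using ind[of TT] by simp
  \<comment> \<open>The truncated subtractions in \<open>excess\<close> are exact:
    \<open>d1 x\<close> is at least 2 on \<open>D - D1\<close>, and \<open>d0 x\<close> is at least
    3 outside \<open>D\<close>.\<close>
  have "2 * d0 x + d1 x + (if x \<in> D1 then 1 else 0) = 6 + excess x + \<tau> x" if x: "x \<in> B" for x
  proof -
    consider "x \<in> D1" | "x \<in> D" "x \<notin> D1" | "x \<notin> D" by blast
    then show ?thesis
    proof cases
      case 1
      then show ?thesis using D1_D[OF 1] unfolding excess_def \<tau>_def D1_def D_def by simp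
    next
      case 2
      then have "d1 x \<ge> 2" using D_card[of x] unfolding D1_def by force
      then show ?thesis using 2 D_card[of x] unfolding excess_def \<tau>_def by simp
    next
      case 3
      then have "d0 x \<ge> 3" using d0_ge_2[OF x] x unfolding D_def by force
      moreover have "d1 x = card (N x \<inter> (V2 - T2)) + card (N x \<inter> T2)"
      proof -
        have "N x \<inter> V2 = (N x \<inter> (V2 - T2)) \<union> (N x \<inter> T2)" using T2 by blast
        then show ?thesis unfolding d1_def
          using card_Un_disjoint[of "N x \<inter> (V2 - T2)" "N x \<inter> T2"] finite_N by auto
      qed
      moreover have "x \<notin> D1" using 3 D1_D by blast
      ultimately show ?thesis using 3 unfolding excess_def \<tau>_def T2_def by simp
    qed
  qed
  then have "(\<Sum>x\<in>B. 2 * d0 x + d1 x + (if x \<in> D1 then 1 else 0)) = (\<Sum>x\<in>B. 6 + excess x + \<tau> x)"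
    by (rule sum.cong[OF refl])
  then have "(\<Sum>x\<in>B. 2 * d0 x + d1 x) + card D1 = 6 * card B + (\<Sum>x\<in>B. excess x) + card TT"
    using st ind[OF \<open>D1 \<subseteq> B\<close>] by (simp add: sum.distrib)
  moreover have "card D1 = card P0 + card TT"
  proof -
    have "D1 = P0 \<union> TT" "P0 \<inter> TT = {}" unfolding TT_def P0_def by auto
    then show ?thesis using card_Un_disjoint[of P0 TT] finites by simp
  qed
  ultimately show ?thesis by simp
qed

text \<open>Each vertex of \<open>U'\<close> gets one of its ends in \<open>P0\<close> as token. The
  other end lies in the independent set \<open>D\<close>, so the order condition never starts from
  such a token. Rank 2 for these tokens, above the ranks on \<open>Z\<close>, settles the mixed
  case.\<close>

lemma tokens_False:
  fixes r :: "'a \<Rightarrow> nat"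
  assumes U': "U' \<subseteq> U0" and Z: "Z \<subseteq> D"
    and uniq: "\<And>a z z'. a \<in> V2 \<Longrightarrow> z \<in> Z \<Longrightarrow> z' \<in> Z \<Longrightarrow> adj a z \<Longrightarrow> adj a z' \<Longrightarrow> z = z'"
    and sep: "\<And>a z. a \<in> U' \<Longrightarrow> z \<in> Z \<Longrightarrow> \<not> adj a z"
    and order: "\<And>z z' a x w. z \<in> Z \<Longrightarrow> z' \<in> Z \<Longrightarrow> z \<noteq> z' \<Longrightarrow> a \<in> V2 \<Longrightarrow> adj a z \<Longrightarrow> adj a x \<Longrightarrow>
      adj x z' \<Longrightarrow> adj w z \<Longrightarrow> adj w z' \<Longrightarrow> r z < r z'"
    and r2: "\<And>z. z \<in> Z \<Longrightarrow> r z < 2"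
    and big: "(\<Sum>x\<in>B. 2 * d0 x + d1 x) + 6 < 6 * card B + 2 * (card U' + card {a \<in> V2. \<exists>z\<in>Z. adj z a})"
  shows False
proof -
  obtain des where des: "\<And>a. a \<in> U' \<Longrightarrow> des a \<in> P0 \<and> sb (des a) = a"
  proof -
    have "\<forall>a\<in>U'. \<exists>y. y \<in> P0 \<and> sb y = a" using U' unfolding U0_def by auto
    then show thesis using that by metis
  qed
  define Z1 where "Z1 = des ` U'"
  have Z1: "z \<in> P0" "z \<in> D" "sb z \<in> U'" "z = des (sb z)" if "z \<in> Z1" for z
    using that des D1_D P0_D unfolding Z1_def by auto
  have Z1u: "a = sb z" if "z \<in> Z1" "a \<in> V2" "adj a z" for a z
    using sb_eq[OF P0_D[OF Z1(1)]] that by blast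
  have mixed: False if "z \<in> Z1" "z' \<in> Z" "a \<in> V2" "adj a z" "adj a z'" for z z' a
    using Z1u[OF that(1,3,4)] sep[OF Z1(3)[OF that(1)] that(2)] that(5) by simp
  define r' where "r' z = (if z \<in> Z then r z else 2)" for z
  show False
  proof (rule token_set_False[of "Z1 \<union> Z" r'])
    show "Z1 \<union> Z \<subseteq> D" using Z1(2) Z by blast
    show "z = z'" if "a \<in> V2" "z \<in> Z1 \<union> Z" "z' \<in> Z1 \<union> Z" "adj a z" "adj a z'" for a z z'
      using that Z1u[of z a] Z1u[of z' a] Z1(4)[of z] Z1(4)[of z'] mixed[of z z' a] mixed[of z' z a] uniq[of a z z']
      by (metis Un_iff)
    show "r' z < r' z'" if q: "z \<in> Z1 \<union> Z" "z' \<in> Z1 \<union> Z" "z \<noteq> z'" "a \<in> V2" "adj a z" "adj a x" "x \<noteq> z" "adj x z'" "adj w z" "adj w z'" for z z' a x w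
    proof -
      have "x \<notin> D" using D_indep[of x z'] q(2,8) Z1(2) Z by blast
      then have "z \<in> Z" using P0_other[of z a x] Z1(1) q by blast
      then show ?thesis using order[of z z' a x w] r2[of z] q unfolding r'_def by auto
    qed
    have "finite U'" using U' finites(5) finite_subset by blast
    moreover have "U' \<inter> {a \<in> V2. \<exists>z\<in>Z. adj z a} = {}"
    proof -
      have "\<not> adj z a" if "a \<in> U'" "z \<in> Z" for z a using sep[OF that] by (simp add: insert_commute)
      then show ?thesis by blast
    qed
    ultimately have "card U' + card {a \<in> V2. \<exists>z\<in>Z. adj z a} = card (U' \<union> {a \<in> V2. \<exists>z\<in>Z. adj z a})"
      using finite_V2 by (simp add: card_Un_disjoint)
    also have "\<dots> \<le> card {a \<in> V2. \<exists>z\<in>Z1 \<union> Z. adj z a}"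
    proof (rule card_mono)
      have "a \<in> V2 \<and> (\<exists>z\<in>Z1. adj z a)" if "a \<in> U'" for a
        using des[OF that] sbD[OF P0_D, of "des a"] that unfolding Z1_def by auto
      then show "U' \<union> {a \<in> V2. \<exists>z\<in>Z. adj z a} \<subseteq> {a \<in> V2. \<exists>z\<in>Z1 \<union> Z. adj z a}" by blast
    qed (use finite_V2 in simp)
    finally show "(\<Sum>x\<in>B. 2 * d0 x + d1 x) + 6 < 6 * card B + 2 * card {a \<in> V2. \<exists>z\<in>Z1 \<union> Z. adj z a}"
      using big by simp
  qed
qed

text \<open>Let the total charge be \<open>-s\<close> with \<open>s\<close> even and positive. That
  deleting \<open>U0\<close> does not help means \<open>s \<le> 6 - 2 * card U0\<close>, while
  \<open>sum_excess\<close> and \<open>card_P0\<close> give \<open>s \<le> 2 * card U0\<close>. This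
  leaves only \<open>s = 2\<close> with \<open>card U0\<close> equal to 1 or 2.\<close>

lemma tight: "(\<Sum>x\<in>B. 2 * d0 x + d1 x) + 2 = 6 * card B" "card U0 = 1 \<or> card U0 = 2"
  "(\<Sum>x\<in>B. excess x) + 2 = card P0"
proof -
  have "\<not> ((\<Sum>x\<in>B. 2 * d0 x + d1 x) + 6 < 6 * card B + 2 * card U0)"
    using tokens_False[of U0 "{}"] by auto
  moreover obtain k where "(\<Sum>x\<in>B. 2 * d0 x + d1 x) = 2 * k" using weight(2) by blast
  moreover note weight(1) sum_excess card_P0
  ultimately have "(\<Sum>x\<in>B. 2 * d0 x + d1 x) + 2 = 6 * card B \<and> (card U0 = 1 \<or> card U0 = 2) \<and>
    (\<Sum>x\<in>B. excess x) + 2 = card P0" by presburger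
  then show "(\<Sum>x\<in>B. 2 * d0 x + d1 x) + 2 = 6 * card B" "card U0 = 1 \<or> card U0 = 2"
    "(\<Sum>x\<in>B. excess x) + 2 = card P0" by blast+
qed

text \<open>Three deletions lower the total charge from -2 to -8, which is below -6.\<close>

lemma three_tokens_False:
  fixes r :: "'a \<Rightarrow> nat"
  assumes "U' \<subseteq> U0" "Z \<subseteq> D"
    and "\<And>a z z'. a \<in> V2 \<Longrightarrow> z \<in> Z \<Longrightarrow> z' \<in> Z \<Longrightarrow> adj a z \<Longrightarrow> adj a z' \<Longrightarrow> z = z'"
    and "\<And>a z. a \<in> U' \<Longrightarrow> z \<in> Z \<Longrightarrow> \<not> adj a z"
    and "\<And>z z' a x w. z \<in> Z \<Longrightarrow> z' \<in> Z \<Longrightarrow> z \<noteq> z' \<Longrightarrow> a \<in> V2 \<Longrightarrow> adj a z \<Longrightarrow> adj a x \<Longrightarrow>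
      adj x z' \<Longrightarrow> adj w z \<Longrightarrow> adj w z' \<Longrightarrow> r z < r z'"
    and "\<And>z. z \<in> Z \<Longrightarrow> r z < 2"
    and "card U' + card {a \<in> V2. \<exists>z\<in>Z. adj z a} \<ge> 3"
  shows False
proof -
  have big: "(\<Sum>x\<in>B. 2 * d0 x + d1 x) + 6 < 6 * card B + 2 * (card U' + card {a \<in> V2. \<exists>z\<in>Z. adj z a})"
    using assms(7) tight(1) by presburger
  show False by (rule tokens_False[of U' Z r]) (fact assms big)+
qed

section \<open>Excluding the configurations of total charge -2\<close>

lemma one_token_False:
  assumes U: "U' \<subseteq> U0" and z: "z \<in> D" and sep: "\<And>a. a \<in> U' \<Longrightarrow> \<not> adj z a" and c: "card U' + d1 z \<ge> 3"
  shows False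
proof (rule three_tokens_False[OF U, of "{z}" "\<lambda>_. 0"])
  show "\<not> adj a z'" if "a \<in> U'" "z' \<in> {z}" for a z' using sep that by (simp add: insert_commute)
  have "{a \<in> V2. \<exists>z'\<in>{z}. adj z' a} = N z \<inter> V2" by (auto simp: N_iff)
  then show "3 \<le> card U' + card {a \<in> V2. \<exists>z'\<in>{z}. adj z' a}" using c unfolding d1_def by simp
qed (use z in auto)

lemma U0_TT: "a \<in> U0 \<Longrightarrow> t \<in> TT \<Longrightarrow> \<not> adj a t"
proof
  assume a: "a \<in> U0" "t \<in> TT" "adj a t"
  obtain y where y: "y \<in> P0" "a = sb y" using a(1) unfolding U0_def by blast
  have "y = t" using TT_other[OF a(2) U0_D(2)[OF a(1,3)] a(3)] y sbD(3)[OF P0_D[OF y(1)]] D1_D[OF P0_D[OF y(1)]] by blast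
  then show False using y(1) a(2) unfolding TT_def by blast
qed

lemma D1_deg: "v \<in> D1 \<Longrightarrow> card (N v) = 3"
  using deg_split[of v] unfolding D1_def D_def mem_Collect_eq by presburger

lemma nonD_d0: "v \<in> B \<Longrightarrow> v \<notin> D \<Longrightarrow> d0 v \<ge> 3"
  using d0_ge_2[of v] unfolding D_def by force

lemma V2_deg: "v \<in> V2 \<Longrightarrow> card (N v) = 2" unfolding V2_def by simp

lemma excess_sum2: "x \<in> B \<Longrightarrow> y \<in> B \<Longrightarrow> x \<noteq> y \<Longrightarrow> excess x + excess y \<le> (\<Sum>v\<in>B. excess v)"
  using sum_mono2[OF finite_B, of "{x, y}" excess] by simp

lemma excess_sum3: "x \<in> B \<Longrightarrow> y \<in> B \<Longrightarrow> z \<in> B \<Longrightarrow> x \<noteq> y \<Longrightarrow> x \<noteq> z \<Longrightarrow> y \<noteq> z \<Longrightarrow> excess x + excess y + excess z \<le> (\<Sum>v\<in>B. excess v)"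
  using sum_mono2[OF finite_B, of "{x, y, z}" excess] by simp

text \<open>\<open>star_False\<close> with no exceptional vertex: the choice of \<open>h\<close> for
  \<open>t\<close> makes the exception void.\<close>

lemma star_one_False:
  assumes h: "h \<in> V" and d: "\<And>v. v \<in> B \<Longrightarrow> v \<notin> D1 \<Longrightarrow> v \<noteq> h \<Longrightarrow> card (N v) \<le> 3"
  shows False
proof (rule star_False[OF h, of h])
  fix v assume "v \<in> V" "v \<noteq> h"
  then consider "v \<in> V2" | "v \<in> D1" | "v \<in> B" "v \<notin> D1" using V_split by blast
  then have "card (N v) \<le> 3"
  proof cases
    case 3
    then show ?thesis using d \<open>v \<noteq> h\<close> by blast
  qed (use D1_deg[of v] V2_deg[of v] in simp_all)
  then show "card (N v) \<le> 3 \<or> v = h \<and> card (N v) = 4 \<and> (\<exists>a\<in>V2. adj h a \<and> adj a h)" ..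
qed

text \<open>With two vertices in \<open>U0\<close> one further deletion is too many. Hence
  \<open>TT\<close> is empty, and a vertex of \<open>D - D1\<close> is adjacent to both vertices of
  \<open>U0\<close>, so there is at most one. If there is one, the total excess is 0, otherwise it
  is at most 2. This leaves at most one vertex of degree above 3, or two of degree 4 joined through
  a vertex of degree 2, as \<open>star_False\<close> permits.\<close>

lemma card_U0: "card U0 = 1"
proof (rule ccontr)
  assume "card U0 \<noteq> 1"
  then have U2: "card U0 = 2" using tight(2) by blast
  have TT: "TT = {}"
  proof (rule ccontr)
    assume "TT \<noteq> {}"
    then obtain t where t: "t \<in> TT" by blast
    have tD: "t \<in> D" "d1 t = 1" using TT_D[OF t] unfolding D1_def by auto
    show False by (rule one_token_False[OF subset_refl tD(1)]) (use U0_TT[OF _ t] U2 tD(2) in \<open>auto simp: insert_commute\<close>)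
  qed
  then have P0: "P0 = D1" using P0_D unfolding TT_def by blast
  have exn: "excess v = 2 * (d0 v - 3) + d1 v" if "v \<notin> D" for v
    using that D1_D TT unfolding excess_def d1_def by auto
  obtain a b where ab: "U0 = {a, b}" "a \<noteq> b" using U2 by (auto simp: card_2_iff)
  have Uz: "adj z c" if z: "z \<in> D" "z \<notin> D1" "c \<in> U0" for z c
  proof (rule ccontr)
    assume "\<not> adj z c"
    have "d1 z \<ge> 2" using D_card[of z] z unfolding D1_def by force
    then show False using one_token_False[of "{c}" z] z \<open>\<not> adj z c\<close> by auto
  qed
  show False
  proof (cases "\<exists>z. z \<in> D \<and> z \<notin> D1")
    case True
    then obtain z where z: "z \<in> D" "z \<notin> D1" by blast
    have "inj_on sb P0"
    proof (rule inj_onI)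
      fix y y' assume y: "y \<in> P0" "y' \<in> P0" "sb y = sb y'"
      have ne: "z \<noteq> y" "z \<noteq> y'" using z P0 y by auto
      have s: "sb y \<in> U0" using y unfolding U0_def by blast
      have "adj (sb y) z" using Uz[OF z s] by (simp add: insert_commute)
      moreover have "adj (sb y) y'" using sbD(3)[OF P0_D[OF y(2)]] y(3) by simp
      ultimately have "y' = z \<or> y' = y"
        using V2_third[of "sb y" z y y'] sbD(1,3)[OF P0_D[OF y(1)]] ne by blast
      then show "y = y'" using ne by blast
    qed
    then have "card P0 = 2" using card_image[of sb P0] U2 unfolding U0_def by simp
    then have "(\<Sum>v\<in>B. excess v) = 0" using tight(3) by simp
    then have ex0: "excess v = 0" if "v \<in> B" for v using that finite_B by simp
    show False
    proof (rule star_one_False[of z])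
      show "z \<in> V" using DB[OF z(1)] V_split by blast
      fix v assume v: "v \<in> B" "v \<notin> D1" "v \<noteq> z"
      have "v \<notin> D" using two_common[of v a b z] Uz[of v] Uz[OF z] v ab by blast
      then show "card (N v) \<le> 3" using ex0[OF v(1)] exn[of v] deg_split[of v] by simp
    qed
  next
    case False
    have "card P0 \<le> 4" using card_P0 U2 by simp
    then have ex2: "(\<Sum>v\<in>B. excess v) \<le> 2" using tight(3) by simp
    have dex: "card (N v) \<le> 3 + excess v" "d1 v \<le> excess v" "excess v < 2 \<Longrightarrow> d0 v = 3" if "v \<in> B" "v \<notin> D1" for v
    proof -
      have nD: "v \<notin> D" using False that by blast
      show "card (N v) \<le> 3 + excess v" "d1 v \<le> excess v" "excess v < 2 \<Longrightarrow> d0 v = 3"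
        using exn[OF nD] nonD_d0[OF that(1) nD] deg_split[of v] by auto
    qed
    show False
    proof (cases "\<exists>h\<in>B. h \<notin> D1 \<and> excess h = 1")
      case True
      then obtain h where h: "h \<in> B" "h \<notin> D1" "excess h = 1" by blast
      then have hD: "h \<notin> D" using False by blast
      have "d0 h = 3" using dex(3)[OF h(1,2)] h(3) by simp
      then have "d1 h = 1" using exn[OF hD] h(3) by simp
      then have "N h \<inter> V2 \<noteq> {}" unfolding d1_def by auto
      then obtain c where c: "c \<in> V2" "adj h c" by (auto simp: N_iff)
      then have ch: "adj c h" by (simp add: insert_commute)
      obtain v2 where v2: "v2 \<noteq> h" "adj c v2" using V2_N[OF c(1) ch] by blast
      \<comment> \<open>Here \<open>D1 = P0\<close>, and a neighbour of degree 2 of a vertex in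
        \<open>P0\<close> has no end outside \<open>D\<close>. So the second end \<open>v2\<close>
        is not in \<open>D1\<close> and takes up the other unit of excess.\<close>
      have v2D: "v2 \<notin> D1" using P0_other[of v2 c h] c(1) ch v2(2) hD P0 by blast
      have v2B: "v2 \<in> B" using V2_B c(1) v2(2) by blast
      have "c \<in> N v2 \<inter> V2" using v2 c by (simp add: N_iff insert_commute)
      then have "d1 v2 \<ge> 1" unfolding d1_def using finite_N by (metis Suc_leI One_nat_def card_gt_0_iff empty_iff finite_Int)
      then have e2: "excess v2 \<ge> 1" using dex(2)[OF v2B v2D] by simp
      show False
      proof (rule star_False[of h v2])
        show "h \<in> V" using h V_split by blast
        fix v assume v: "v \<in> V" "v \<noteq> h"
        show "card (N v) \<le> 3 \<or> v = v2 \<and> card (N v) = 4 \<and> (\<exists>a\<in>V2. adj h a \<and> adj a v2)"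
        proof (cases "v \<in> B \<and> v \<notin> D1")
          case nb: True
          show ?thesis
          proof (cases "v = v2")
            case True
            have "excess v2 \<le> 1" using excess_sum2[OF h(1) v2B] v2(1) h(3) ex2 by simp
            then have "card (N v2) \<le> 3 \<or> card (N v2) = 4" using dex(1)[OF v2B v2D] by linarith
            then show ?thesis using True c v2 by blast
          next
            case neq: False
            have "excess v = 0" using excess_sum3[of h v2 v] neq nb v v2 h v2B e2 ex2 by simp
            then show ?thesis using dex(1)[of v] nb by simp
          qed
        next
          case False
          then have "v \<in> D1 \<or> v \<in> V2" using V_split v by blast
          then show ?thesis using D1_deg V2_deg by force
        qed
      qed
    next
      case no1: False
      show False
      proof (cases "\<exists>h\<in>B. h \<notin> D1 \<and> excess h > 0")
        case True
        then obtain h where h: "h \<in> B" "h \<notin> D1" "excess h \<ge> 2" using no1 by force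
        show False
        proof (rule star_one_False[of h])
          show "h \<in> V" using h V_split by blast
          show "card (N v) \<le> 3" if v: "v \<in> B" "v \<notin> D1" "v \<noteq> h" for v
            using excess_sum2[of h v] h v ex2 dex(1)[of v] by simp
        qed
      next
        case False
        obtain h where "h \<in> B" using card_B by (metis card.empty ex_in_conv not_numeral_le_zero)
        show False
        proof (rule star_one_False[of h])
          show "h \<in> V" using \<open>h \<in> B\<close> V_split by blast
          show "card (N v) \<le> 3" if "v \<in> B" "v \<notin> D1" for v
            using False that dex(1)[of v] by auto
        qed
      qed
    qed
  qed
qed

lemma card_P0_2: "card P0 = 2" and excess_0: "v \<in> B \<Longrightarrow> excess v = 0"
proof -
  show c: "card P0 = 2" using card_P0 card_U0 tight(3) by simp
  then have "(\<Sum>v\<in>B. excess v) = 0" using tight(3) by simp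
  then show "excess v = 0" if "v \<in> B" using that finite_B by simp
qed

text \<open>The two ends of the only vertex of \<open>U0\<close> are the two vertices of
  \<open>P0\<close>. So a vertex of \<open>D - D1\<close> is not adjacent to it, and its two or more
  neighbours of degree 2 complete three deletions.\<close>

lemma D_D1: "D = D1"
proof (rule ccontr)
  assume "D \<noteq> D1"
  then obtain z where z: "z \<in> D" "z \<notin> D1" using D1_D by blast
  have "d1 z \<ge> 2" using D_card[of z] z unfolding D1_def by force
  obtain a0 where a0: "U0 = {a0}" using card_U0 by (auto simp: card_1_singleton_iff)
  have sub: "P0 \<subseteq> N a0"
  proof
    fix y assume y: "y \<in> P0"
    then have "sb y = a0" using a0 unfolding U0_def by auto
    then show "y \<in> N a0" using sbD(3)[OF P0_D[OF y]] by (simp add: N_iff)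
  qed
  obtain y where "y \<in> P0" using card_P0_2 by (metis card.empty ex_in_conv zero_neq_numeral)
  then have "a0 \<in> V2" using sbD(1)[OF P0_D, of y] a0 unfolding U0_def by auto
  then have "P0 = N a0" using card_subset_eq[OF finite_N sub] card_P0_2 V2_deg by simp
  then have "\<not> adj z a0" using z P0_D N_iff[of z a0] adj_sym[of z a0] by blast
  then show False using one_token_False[of U0 z] z(1) a0 \<open>d1 z \<ge> 2\<close> by auto
qed

lemma nonD: assumes "v \<in> B" "v \<notin> D" shows "d0 v = 3" "a \<in> V2 \<Longrightarrow> adj v a \<Longrightarrow> a \<in> sb ` TT"
proof -
  have e: "2 * (d0 v - 3) + card (N v \<inter> (V2 - sb ` TT)) = 0" using excess_0[OF assms(1)] assms(2) D_D1 unfolding excess_def by simp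
  then show "d0 v = 3" using nonD_d0[OF assms] by simp
  have "N v \<inter> (V2 - sb ` TT) = {}" using e finite_N by simp
  then show "a \<in> sb ` TT" if "a \<in> V2" "adj v a" using that N_iff[of a v] by blast
qed

section \<open>The vertices of \<open>TT\<close> and the far ends of their neighbours of degree
  2\<close>

definition xo where "xo t = (THE x. x \<noteq> t \<and> adj (sb t) x)"

lemma xo:
  assumes t: "t \<in> TT"
  shows "xo t \<noteq> t" "adj (sb t) (xo t)" "adj (xo t) (sb t)" "N (sb t) = {t, xo t}" "xo t \<in> B" "xo t \<notin> D"
proof -
  note s = sbD[OF TT_D[OF t]]
  obtain q where q: "q \<noteq> t" "adj (sb t) q" "N (sb t) = {t, q}" using V2_N[OF s(1,3)] by blast
  have "xo t = q" unfolding xo_def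
  proof (rule the_equality)
    show "x = q" if "x \<noteq> t \<and> adj (sb t) x" for x using that q(3) N_iff[of x "sb t"] by blast
  qed (use q in blast)
  then show "xo t \<noteq> t" "adj (sb t) (xo t)" "N (sb t) = {t, xo t}" "xo t \<in> B"
    using q V2_B[OF s(1)] by auto
  then show "adj (xo t) (sb t)" "xo t \<notin> D" using TT_other[OF t s(1,3)] by (auto simp: insert_commute)
qed

lemma TT_props: assumes "t \<in> TT" shows "t \<in> D" "t \<in> B" "t \<in> D1" "d1 t = 1" "card (N t) = 3"
proof -
  show D1: "t \<in> D1" by (rule TT_D[OF assms])
  show D: "t \<in> D" by (rule D1_D[OF D1])
  show "t \<in> B" by (rule DB[OF D])
  show "d1 t = 1" using D1 unfolding D1_def by simp
  show "card (N t) = 3" by (rule D1_deg[OF D1])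
qed

lemma xo_not_adj: "t \<in> TT \<Longrightarrow> \<not> adj (xo t) t"
  using no_tri[OF xo(2) sbD(3)[OF TT_D]] .

text \<open>Otherwise \<open>t\<close>, \<open>t'\<close> and the vertex of \<open>U0\<close> would
  allow three deletions. Rank 1 for \<open>t\<close> and 0 for \<open>t'\<close> satisfies the order
  condition from \<open>t'\<close> to \<open>t\<close>, and from \<open>t\<close> to
  \<open>t'\<close> the condition is void unless the conclusion holds. The conclusion is not
  symmetric and is used for both orders of a pair.\<close>

lemma pair_dep:
  assumes t: "t \<in> TT" "t' \<in> TT" "t \<noteq> t'"
  shows "adj (xo t) t' \<and> (\<exists>w. adj w t \<and> adj w t')"
proof (rule ccontr)
  assume no: "\<not> ?thesis"
  show False
  proof (rule three_tokens_False[of U0 "{t, t'}" "\<lambda>z. if z = t then 1 else 0"])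
    show "{t, t'} \<subseteq> D" using t TT_props by blast
    show uq: "z = z'" if "a \<in> V2" "z \<in> {t, t'}" "z' \<in> {t, t'}" "adj a z" "adj a z'" for a z z'
      using TT_other[of z a z'] t TT_props that by blast
    show "\<not> adj a z" if "a \<in> U0" "z \<in> {t, t'}" for a z using that U0_TT t by blast
    show "(if z = t then 1 else 0) < (if z' = t then 1 else (0::nat))"
      if q: "z \<in> {t, t'}" "z' \<in> {t, t'}" "z \<noteq> z'" "a \<in> V2" "adj a z" "adj a x" "adj x z'" "adj w z" "adj w z'" for z z' a x w
    proof (cases "z = t")
      case True
      then have z': "z' = t'" using q by blast
      have "a = sb t" using sb_eq[OF TT_D[OF t(1)] q(4)] q(5) True by simp
      then have "x = t \<or> x = xo t" using q(6) xo(4)[OF t(1)] N_iff[of x "sb t"] by blast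
      moreover have "x \<noteq> t" using D_indep[of t t'] TT_props t q(7) z' by blast
      ultimately show ?thesis using no q(7-9) True z' by blast
    next
      case False
      then show ?thesis using q t by auto
    qed
    have "{a \<in> V2. \<exists>z\<in>{t, t'}. adj z a} = {sb t, sb t'}"
      using sb[OF TT_D[OF t(1)]] sb[OF TT_D[OF t(2)]] by auto
    moreover have "sb t \<noteq> sb t'"
      using uq[of "sb t" t t'] sbD[OF TT_D[OF t(1)]] sbD[OF TT_D[OF t(2)]] t(3) by auto
    ultimately show "3 \<le> card U0 + card {a \<in> V2. \<exists>z\<in>{t, t'}. adj z a}" using card_U0 by simp
  qed auto
qed

lemma xo_inj: assumes t: "t \<in> TT" "t' \<in> TT" "t \<noteq> t'" shows "xo t \<noteq> xo t'"
proof
  assume "xo t = xo t'"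
  then have "adj (xo t') t'" using pair_dep[OF t] by simp
  then show False using xo_not_adj[OF t(2)] by blast
qed

text \<open>By \<open>pair_dep\<close> the vertices \<open>t\<^sub>i\<close> and \<open>xo t\<^sub>i\<close> form a hexagon; with the \<open>sb t\<^sub>i\<close> it is one
  side of a matching cut.\<close>

lemma hexagon_False:
  assumes T: "t1 \<in> TT" "t2 \<in> TT" "t3 \<in> TT" "t1 \<noteq> t2" "t1 \<noteq> t3" "t2 \<noteq> t3"
  shows False
proof -
  define T3 where "T3 = {t1, t2, t3}"
  have T3: "t \<in> TT" if "t \<in> T3" for t using that T unfolding T3_def by auto
  have others: "\<exists>t' t''. t' \<in> T3 \<and> t'' \<in> T3 \<and> t' \<noteq> t'' \<and> t \<noteq> t' \<and> t \<noteq> t'' \<and> T3 = {t, t', t''}" if tT: "t \<in> T3" for t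
  proof -
    consider "t = t1" | "t = t2" | "t = t3" using tT unfolding T3_def by blast
    then show ?thesis
    proof cases
      case 1
      then show ?thesis using T(4-6) unfolding T3_def by blast
    next
      case 2
      then show ?thesis using T(4-6) unfolding T3_def by blast
    next
      case 3
      then show ?thesis using T(4-6) unfolding T3_def by blast
    qed
  qed
  have sbne: "sb t \<noteq> x" if "t \<in> TT" "x \<in> B" for t x using sbD(1)[OF TT_D[OF that(1)]] that(2) V_split by blast
  define S where "S = T3 \<union> xo ` T3 \<union> sb ` T3"
  have NT: "N t \<subseteq> S" if t: "t \<in> T3" for t
  proof -
    obtain t' t'' where o: "t' \<in> T3" "t'' \<in> T3" "t' \<noteq> t''" "t \<noteq> t'" "t \<noteq> t''" using others[OF t] by blast
    note TTs = T3[OF t] T3[OF o(1)] T3[OF o(2)]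
    have "adj t (xo t')" "adj t (xo t'')" using pair_dep[OF TTs(2,1)] pair_dep[OF TTs(3,1)] o by (auto simp: insert_commute)
    then have sub: "{xo t', xo t'', sb t} \<subseteq> N t" using sbD(2)[OF TT_D[OF TTs(1)]] by (simp add: N_iff)
    have "xo t' \<noteq> xo t''" "xo t' \<noteq> sb t" "xo t'' \<noteq> sb t"
      using xo_inj[OF TTs(2,3) o(3)] sbne[OF TTs(1) xo(5)[OF TTs(2)]] sbne[OF TTs(1) xo(5)[OF TTs(3)]] by auto
    then have "card {xo t', xo t'', sb t} = card (N t)" using TT_props(5)[OF TTs(1)] by simp
    then have "N t = {xo t', xo t'', sb t}" using card_subset_eq[OF finite_N sub] by simp
    then show ?thesis using o t unfolding S_def by auto
  qed
  have NS: "N (sb t) \<subseteq> S" if t: "t \<in> T3" for t using xo(4)[OF T3[OF t]] t unfolding S_def by auto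
  \<comment> \<open>The far end has \<open>d0\<close> equal to 3 and one neighbour of degree 2. Of
    these four neighbours three lie in \<open>S\<close>, so only one edge leaves \<open>S\<close>
    here, and none does at \<open>t\<close> or \<open>sb t\<close>.\<close>
  have Nx: "\<exists>F. F \<subseteq> N (xo t) \<and> F \<subseteq> S \<and> card F = 3 \<and> N (xo t) \<inter> S \<subseteq> F \<and> card (N (xo t)) = 4" if t: "t \<in> T3" for t
  proof -
    obtain t' t'' where o: "t' \<in> T3" "t'' \<in> T3" "t' \<noteq> t''" "t \<noteq> t'" "t \<noteq> t''" "T3 = {t, t', t''}" using others[OF t] by blast
    note TTs = T3[OF t] T3[OF o(1)] T3[OF o(2)]
    have ad: "adj (xo t) t'" "adj (xo t) t''" "adj (xo t) (sb t)"
      using pair_dep[OF TTs(1,2) o(4)] pair_dep[OF TTs(1,3) o(5)] xo(3)[OF TTs(1)] by auto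
    define F where "F = {t', t'', sb t}"
    have "sb t \<noteq> t'" "sb t \<noteq> t''" using sbne[OF TTs(1)] TT_props(2) TTs by blast+
    then have cF: "card F = 3" unfolding F_def using o by auto
    have nsb: "s = t" if "s \<in> TT" "adj (xo t) (sb s)" for s
    proof -
      have "adj (sb s) (xo t)" using that(2) by (simp add: insert_commute)
      then have "xo t = s \<or> xo t = xo s" using xo(4)[OF that(1)] N_iff[of "xo t" "sb s"] by blast
      moreover have "xo t \<noteq> s" using xo(6)[OF TTs(1)] TT_props(1)[OF that(1)] by blast
      ultimately show ?thesis using xo_inj[OF TTs(1) that(1)] by blast
    qed
    have "N (xo t) \<inter> V2 = {sb t}"
    proof (intro set_eqI iffI)
      fix a assume "a \<in> N (xo t) \<inter> V2"
      then show "a \<in> {sb t}" using nonD(2)[OF xo(5,6)[OF TTs(1)], of a] nsb by (auto simp: N_iff)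
    next
      fix a assume "a \<in> {sb t}"
      then show "a \<in> N (xo t) \<inter> V2" using ad(3) sbD(1)[OF TT_D[OF TTs(1)]] by (simp add: N_iff)
    qed
    then have "card (N (xo t)) = 4"
      using deg_split[of "xo t"] nonD(1)[OF xo(5,6)[OF TTs(1)]] unfolding d1_def by simp
    moreover have "N (xo t) \<inter> S \<subseteq> F"
    proof
      fix v assume "v \<in> N (xo t) \<inter> S"
      then have v: "adj (xo t) v" "v \<in> S" by (auto simp: N_iff)
      have nx: "\<not> adj (xo t) (xo s)" if "s \<in> T3" for s
      proof
        assume as: "adj (xo t) (xo s)"
        then have "s \<noteq> t" using adj_irrefl by auto
        moreover have "s \<in> {t, t', t''}" using that o(6) by simp
        ultimately have "\<exists>p\<in>T3. p \<noteq> t \<and> p \<noteq> s" using o(1-5) by (cases "s = t'") auto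
        then obtain p where p: "p \<in> T3" "p \<noteq> t" "p \<noteq> s" by blast
        have "adj (xo t) p" "adj (xo s) p" using pair_dep[of t p] pair_dep[of s p] T3 t that p by auto
        then show False using no_tri[OF as] by blast
      qed
      have "v \<in> T3 \<or> (\<exists>s\<in>T3. v = xo s) \<or> (\<exists>s\<in>T3. v = sb s)" using v(2) unfolding S_def by blast
      then show "v \<in> F"
      proof (elim disjE bexE)
        assume "v \<in> T3"
        then show ?thesis using o(6) xo_not_adj[OF TTs(1)] v(1) unfolding F_def by blast
      next
        fix s assume "s \<in> T3" "v = xo s"
        then show ?thesis using nx v(1) by blast
      next
        fix s assume "s \<in> T3" "v = sb s"
        then show ?thesis using nsb[OF T3] v(1) unfolding F_def by blast
      qed
    qed
    moreover have "F \<subseteq> N (xo t)" unfolding F_def using ad by (simp add: N_iff)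
    moreover have "F \<subseteq> S" unfolding F_def S_def using o t by blast
    ultimately show ?thesis using cF by blast
  qed
  have t1: "t1 \<in> T3" unfolding T3_def by simp
  show False
  proof (rule matching_cut_False[of S])
    have "t \<in> V \<and> xo t \<in> V \<and> sb t \<in> V" if "t \<in> T3" for t
      using TT_props(2)[OF T3[OF that]] xo(5)[OF T3[OF that]] sbD(1)[OF TT_D[OF T3[OF that]]] V_split by blast
    then show "S \<subseteq> V" unfolding S_def by auto
    show "S \<noteq> {}" using t1 unfolding S_def by blast
    show "S \<noteq> V"
    proof
      assume "S = V"
      then have "N (xo t1) \<subseteq> S" using adj_V by (auto simp: N_iff)
      moreover obtain F where F: "F \<subseteq> N (xo t1)" "card F = 3" "N (xo t1) \<inter> S \<subseteq> F" "card (N (xo t1)) = 4"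
        using Nx[OF t1] by blast
      ultimately have "N (xo t1) = F" by blast
      then show False using F by simp
    qed
    fix u a b assume u: "adj u a" "adj u b" "(a \<in> S) \<noteq> (u \<in> S)" "(b \<in> S) \<noteq> (u \<in> S)"
    have xS: "\<exists>t\<in>T3. v = xo t" if "v \<in> S" "adj v c" "c \<notin> S" for v c
      using that NT NS N_iff[of c v] unfolding S_def by blast
    show "a = b"
    proof (cases "u \<in> S")
      case True
      then have out: "a \<notin> S" "b \<notin> S" using u by auto
      obtain t where t: "t \<in> T3" "u = xo t" using xS[OF True u(1) out(1)] by blast
      obtain F where F: "F \<subseteq> N u" "F \<subseteq> S" "card F = 3" "card (N u) = 4" using Nx[OF t(1)] t(2) by blast
      have "finite F" using F(1) finite_N finite_subset by blast
      show ?thesis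
      proof (rule ccontr)
        assume "a \<noteq> b"
        moreover have "a \<notin> F" "b \<notin> F" using F(2) out by auto
        ultimately have "card (insert a (insert b F)) = 5" using F(3) \<open>finite F\<close> by simp
        moreover have "card (insert a (insert b F)) \<le> card (N u)"
          using F(1) u(1,2) by (intro card_mono) (auto simp: N_iff finite_N)
        ultimately show False using F(4) by simp
      qed
    next
      case False
      then have inS: "a \<in> S" "b \<in> S" using u by auto
      have au: "adj a u" "adj b u" using u by (simp_all add: insert_commute)
      obtain t t' where t: "t \<in> T3" "a = xo t" "t' \<in> T3" "b = xo t'"
        using xS[OF inS(1) au(1) False] xS[OF inS(2) au(2) False] by blast
      show ?thesis
      proof (rule ccontr)
        assume ab: "a \<noteq> b"
        then have "t \<noteq> t'" using t by blast
        obtain q q' where q: "q \<in> T3" "q' \<in> T3" "q \<noteq> q'" "t \<noteq> q" "t \<noteq> q'" using others[OF t(1)] by blast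
        define p where "p = (if q = t' then q' else q)"
        have p: "p \<in> T3" "p \<noteq> t" "p \<noteq> t'" using q unfolding p_def by auto
        \<comment> \<open>Two far ends have the third vertex of \<open>TT\<close> as common
          neighbour, so without 4-cycles they have none outside \<open>S\<close>.\<close>
        have "adj a p" "adj b p" using pair_dep[of t p] pair_dep[of t' p] T3 t p by auto
        then have "u = p" using two_common[OF au(1) _ au(2) _ ab] by blast
        then show False using p False unfolding S_def by blast
      qed
    qed
  qed
qed

text \<open>With at most one vertex in \<open>TT\<close>, only the far end belonging to it can have
  degree above 3. Two vertices of \<open>TT\<close> have a common neighbour \<open>w\<close> with
  \<open>d0 w = 3\<close>. If \<open>w\<close> has no neighbour of degree 2, the subgraph of
  \<open>twin_False\<close> is complete; otherwise \<open>w\<close> is the far end of a third vertex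
  of \<open>TT\<close>, and there is a hexagon.\<close>

lemma sparse_False: False
proof (cases "\<exists>t1 t2. t1 \<in> TT \<and> t2 \<in> TT \<and> t1 \<noteq> t2")
  case False
  obtain h where h: "h \<in> B" "\<And>t. t \<in> TT \<Longrightarrow> xo t = h"
  proof (cases "TT = {}")
    case True
    obtain h where "h \<in> B" using card_B by (metis card.empty ex_in_conv not_numeral_le_zero)
    then show thesis using that True by blast
  next
    case ne: False
    then obtain t where "t \<in> TT" by blast
    then show thesis using that[of "xo t"] xo(5) False by blast
  qed
  show False
  proof (rule star_one_False[of h])
    show "h \<in> V" using h V_split by blast
    fix v assume v: "v \<in> B" "v \<notin> D1" "v \<noteq> h"
    then have vD: "v \<notin> D" using D_D1 by blast
    have "N v \<inter> V2 = {}"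
    proof (rule ccontr)
      assume "N v \<inter> V2 \<noteq> {}"
      then obtain a where a: "a \<in> V2" "adj v a" by (auto simp: N_iff)
      then obtain t where t: "t \<in> TT" "a = sb t" using nonD(2)[OF v(1) vD] by blast
      have "adj (sb t) v" using a t by (simp add: insert_commute)
      then have "v = t \<or> v = xo t" using xo(4)[OF t(1)] N_iff[of v "sb t"] by blast
      then show False using t TT_props(1) vD v(3) h(2) by blast
    qed
    then show "card (N v) \<le> 3" using nonD(1)[OF v(1) vD] deg_split[of v] unfolding d1_def by simp
  qed
next
  case True
  then obtain t1 t2 where t: "t1 \<in> TT" "t2 \<in> TT" "t1 \<noteq> t2" by blast
  define x1 where "x1 = xo t1"
  define x2 where "x2 = xo t2"
  define b1 where "b1 = sb t1"
  define b2 where "b2 = sb t2"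
  note dp = pair_dep[OF t] pair_dep[OF t(2,1) t(3)[symmetric]]
  obtain w where w: "adj w t1" "adj w t2" using dp by blast
  have b: "b1 \<in> V2" "b2 \<in> V2" "adj t1 b1" "adj t2 b2"
    using sbD[OF TT_D[OF t(1)]] sbD[OF TT_D[OF t(2)]] unfolding b1_def b2_def by auto
  have wB: "w \<in> B"
  proof (rule ccontr)
    assume "w \<notin> B"
    then have "w \<in> V2" using adj_V[OF w(1)] V_split by blast
    then show False using TT_other[OF t(1) _ w] TT_props(1)[OF t(2)] t(3) by blast
  qed
  have wD: "w \<notin> D" using D_indep w(1) TT_props(1)[OF t(1)] by blast
  have x: "x1 \<in> B" "x2 \<in> B" "x1 \<noteq> x2" "adj t1 x2" "adj t2 x1" "x1 \<noteq> w" "x2 \<noteq> w"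
    using xo(5)[OF t(1)] xo(5)[OF t(2)] xo_inj[OF t] dp xo_not_adj[OF t(1)] xo_not_adj[OF t(2)] w
    unfolding x1_def x2_def by (auto simp: insert_commute)
  have ne: "b1 \<notin> B" "b2 \<notin> B" using b V_split by blast+
  have Nt: "N t1 = {x2, w, b1}" "N t2 = {x1, w, b2}"
  proof -
    have sub: "{x2, w, b1} \<subseteq> N t1" "{x1, w, b2} \<subseteq> N t2" using w x b by (auto simp: N_iff insert_commute)
    have "b1 \<noteq> x2" "b1 \<noteq> w" "b2 \<noteq> x1" "b2 \<noteq> w" using ne x wB by auto
    then have "card {x2, w, b1} = card (N t1)" "card {x1, w, b2} = card (N t2)"
      using TT_props(5)[OF t(1)] TT_props(5)[OF t(2)] x wB ne by auto
    then show "N t1 = {x2, w, b1}" "N t2 = {x1, w, b2}"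
      using card_subset_eq[OF finite_N sub(1)] card_subset_eq[OF finite_N sub(2)] by auto
  qed
  show False
  proof (cases "N w \<inter> V2 = {}")
    case True
    then have "card (N w) = 3" using nonD(1)[OF wB wD] deg_split[of w] unfolding d1_def by simp
    moreover have s: "{t1, t2} \<subseteq> N w" using w by (simp add: N_iff)
    ultimately have "card (N w - {t1, t2}) = 1" using t(3) by (simp add: card_Diff_subset)
    then obtain oo where "N w - {t1, t2} = {oo}" by (auto simp: card_1_singleton_iff)
    then have Nw: "N w = {t1, t2, oo}" using s by blast
    then have "adj w oo" "oo \<notin> V2" using True N_iff[of oo w] by auto
    then have "oo \<in> B" using adj_V V_split by blast
    moreover have "b1 \<noteq> b2" using TT_other[OF t(1) b(1), of t2] b t(3) TT_props(1)[OF t(2)] by (auto simp: insert_commute)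
    moreover have "N b1 = {t1, x1}" "N b2 = {t2, x2}" using xo(4) t unfolding b1_def b2_def x1_def x2_def by auto
    ultimately show False
      using twin_False[OF TT_props(1)[OF t(1)] TT_props(1)[OF t(2)] b(1,2) Nt _ _ Nw wB _ x(1-3) t(3)] weight(1) by blast
  next
    case False
    then obtain a where a: "a \<in> V2" "adj w a" by (auto simp: N_iff)
    then obtain t3 where t3: "t3 \<in> TT" "a = sb t3" using nonD(2)[OF wB wD] by blast
    have "adj (sb t3) w" using a t3 by (simp add: insert_commute)
    then have "w = t3 \<or> w = xo t3" using xo(4)[OF t3(1)] N_iff[of w "sb t3"] by blast
    then have "w = xo t3" using wD TT_props(1)[OF t3(1)] by blast
    then have "t1 \<noteq> t3" "t2 \<noteq> t3" using xo_not_adj[OF t3(1)] w by auto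
    then show False using hexagon_False[OF t(1,2) t3(1)] t(3) by blast
  qed
qed

end

section \<open>From critical graphs of girth at least 5 to the locales\<close>

lemma (in simple_graph) edge_neq: "{u, v} \<in> E \<Longrightarrow> u \<noteq> v"
  using edge_card[of "{u, v}"] by auto

lemma (in bad_graph) degree_eq: "degree E v = card (N v)"
proof -
  have "{e \<in> E. v \<in> e} = (\<lambda>u. {v, u}) ` N v"
  proof (intro set_eqI iffI)
    fix e assume e: "e \<in> {e \<in> E. v \<in> e}"
    then obtain x y where xy: "e = {x, y}" using edge_card[of e] by (auto simp: card_2_iff)
    then have "\<exists>u. e = {v, u}" using e by auto
    then show "e \<in> (\<lambda>u. {v, u}) ` N v" using e by (auto simp: N_iff)
  qed (auto simp: N_iff)
  moreover have "inj_on (\<lambda>u. {v, u}) (N v)" by (auto simp: inj_on_def doubleton_eq_iff)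
  ultimately show ?thesis unfolding degree_def by (simp add: card_image)
qed

theorem theorem1p2:
  shows "\<nexists>(V :: 'a set) (E :: 'a set set).
           simple_graph V E \<and> critical V E \<and> average_degree V E < 3 \<and> girth V E \<ge> 5"
proof
  assume "\<exists>(V :: 'a set) (E :: 'a set set).
           simple_graph V E \<and> critical V E \<and> average_degree V E < 3 \<and> girth V E \<ge> 5"
  then obtain V :: "'a set" and E :: "'a set set" where sg: "simple_graph V E" and crit: "critical V E"
    and avg: "average_degree V E < 3" and girth: "girth V E \<ge> 5" by blast
  interpret simple_graph V E by (rule sg)
  have cyc: "length c \<ge> 5" if "is_cycle V E c" for c
  proof -
    have "girth V E \<le> enat (length c)" unfolding girth_def by (rule INF_lower) (use that in simp)
    then have "enat 5 \<le> enat (length c)" using girth order_trans by (fastforce simp: numeral_eq_enat)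
    then show ?thesis by simp
  qed
  have inV: "u \<in> V \<and> v \<in> V" if "{u, v} \<in> E" for u v using edge_verts[OF that] by auto
  interpret bad_graph V E
  proof
    show False if "{u, v} \<in> E" "{v, w} \<in> E" "{u, w} \<in> E" for u v w
    proof -
      have "is_cycle V E [u, v, w]"
        using that edge_neq[OF that(1)] edge_neq[OF that(2)] edge_neq[OF that(3)] inV[OF that(1)] inV[OF that(2)]
        unfolding is_cycle_def by (simp add: insert_commute)
      then show False using cyc by fastforce
    qed
    show False if "{a, b} \<in> E" "{b, c} \<in> E" "{c, d} \<in> E" "{d, a} \<in> E" "a \<noteq> c" "b \<noteq> d" for a b c d
    proof -
      have "is_cycle V E [a, b, c, d]"
        using that edge_neq[OF that(1)] edge_neq[OF that(2)] edge_neq[OF that(3)] edge_neq[OF that(4)]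
          inV[OF that(1)] inV[OF that(3)]
        unfolding is_cycle_def by auto
      then show False using cyc by fastforce
    qed
    show "\<exists>\<phi>. good_on E \<phi> X" if X: "X \<subset> V" for X
    proof -
      have "simple_graph X {e \<in> E. e \<subseteq> X}"
        using X finite_verts edge_card by unfold_locales (auto intro: finite_subset)
      then have "proper_subgraph X {e \<in> E. e \<subseteq> X} V E"
        using X unfolding proper_subgraph_def subgraph_def by auto
      then show ?thesis using crit unfolding critical_def good_edge_labeling_iff_good_on[symmetric] by blast
    qed
    show "\<not> good_on E \<phi> V" for \<phi>
    proof -
      have "{e \<in> E. e \<subseteq> V} = E" using edge_verts by blast
      then show ?thesis using crit good_edge_labeling_iff_good_on[of V E \<phi>] unfolding critical_def bad_def by auto
    qed
  qed
  have "card B \<le> card V" using V_split(1) finite_verts by (intro card_mono) auto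
  \<comment> \<open>On an empty vertex set \<open>average_degree\<close> is 0 by division by zero,
    so positivity is needed to clear the denominator.\<close>
  then have "card V > 0" using card_B by simp
  then have "(\<Sum>v\<in>V. real (card (N v))) < 3 * real (card V)"
    using avg unfolding average_degree_def degree_eq by (simp add: pos_divide_less_eq)
  then have "real (\<Sum>v\<in>V. card (N v)) < real (3 * card V)" by simp
  then have "(\<Sum>v\<in>V. card (N v)) < 3 * card V" by (simp only: of_nat_less_iff)
  then interpret sparse_bad_graph V E by unfold_locales
  show False by (rule sparse_False)
qed

end
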